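(* Let $\Lambda$ be an odd selfdual lattice of rank $24$ and minimum $2$, and put $R=\Lambda_2$ and $h_R=|R|/24$. Then there exist strongly eutactic root systems $S,T\subset\mathbb R^{24}$ of norm 2, with Coxeter numbers $h_S,h_T$, such that: $R=S\cap T$; $h_S+h_T=3h_R+2$; $\langle s,t\rangle=\pm\tfrac12$ for all $s\in S\setminus R$, $t\in T\setminus R$; and $\mathrm{Sh}(\Lambda)_2=(S\setminus R)\cup(T\setminus R)$. Moreover, $T=R$ or $S=R$ if and only if $R$ is strongly eutactic.
   Context: A selfdual lattice is an integral lattice equal to its dual; odd means some vector has odd norm. Shadow of an odd selfdual $\Lambda$: $\mathrm{Sh}(\Lambda)=\Lambda_0^\sharp\setminus\Lambda$, with $\Lambda_0$ the sublattice of vectors of even norm and $\Lambda_0^\sharp$ its dual. Shell $A_m=\{x\in A:\langle x,x\rangle=m\}$; $\Lambda_2$ is a root system of norm 2. Root systems need not span the ambient space and may be empty; a root system is strongly eutactic if all its irreducible components have the same Coxeter number $h$ (for irreducible $R'\subset\mathbb R^{d}$, $h=|R'|/d$; the empty irreducible system $O_1\subset\mathbb R^1$ has $h=0$), in which case the Coxeter number of a strongly eutactic $S\subset\mathbb R^{24}$ satisfies $|S|=24h_S$. *)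

theory Defs
  imports "HOL-Analysis.Analysis"
begin

type_synonym vec24 = "real^24"

definition lattice24 :: "vec24 set \<Rightarrow> bool" where
  "lattice24 L \<longleftrightarrow> (\<exists>b :: 24 \<Rightarrow> vec24. inj b \<and> independent (range b) \<and>
      L = {(\<Sum>i\<in>UNIV. of_int (c i) *\<^sub>R b i) | c :: 24 \<Rightarrow> int. True})"

definition dual_set :: "vec24 set \<Rightarrow> vec24 set" where
  "dual_set A = {y. \<forall>x\<in>A. x \<bullet> y \<in> \<int>}"

definition integral_lattice :: "vec24 set \<Rightarrow> bool" where
  "integral_lattice L \<longleftrightarrow> lattice24 L \<and> (\<forall>x\<in>L. \<forall>y\<in>L. x \<bullet> y \<in> \<int>)"

definition selfdual :: "vec24 set \<Rightarrow> bool" where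
  "selfdual L \<longleftrightarrow> integral_lattice L \<and> dual_set L = L"

definition odd_lattice :: "vec24 set \<Rightarrow> bool" where
  "odd_lattice L \<longleftrightarrow> (\<exists>x\<in>L. \<exists>k::int. x \<bullet> x = of_int k \<and> odd k)"

definition has_minimum :: "vec24 set \<Rightarrow> real \<Rightarrow> bool" where
  "has_minimum L m \<longleftrightarrow> (\<forall>x\<in>L. x \<noteq> 0 \<longrightarrow> m \<le> x \<bullet> x) \<and> (\<exists>x\<in>L. x \<noteq> 0 \<and> x \<bullet> x = m)"

definition even_part :: "vec24 set \<Rightarrow> vec24 set" where
  "even_part L = {x\<in>L. \<exists>k::int. x \<bullet> x = of_int k \<and> even k}"

definition shadow :: "vec24 set \<Rightarrow> vec24 set" where
  "shadow L = dual_set (even_part L) - L"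

definition shell :: "vec24 set \<Rightarrow> real \<Rightarrow> vec24 set" where
  "shell A m = {x\<in>A. x \<bullet> x = m}"

text \<open>Root system of norm 2 (possibly empty, not necessarily spanning): finite, all norms 2,
  integral (crystallographic) and closed under the reflections s_r(x) = x - (x.r) r.\<close>
definition root_system_norm2 :: "vec24 set \<Rightarrow> bool" where
  "root_system_norm2 S \<longleftrightarrow> finite S \<and> (\<forall>r\<in>S. r \<bullet> r = 2) \<and>
     (\<forall>r\<in>S. \<forall>s\<in>S. r \<bullet> s \<in> \<int>) \<and>
     (\<forall>r\<in>S. \<forall>s\<in>S. s - (s \<bullet> r) *\<^sub>R r \<in> S)"

definition component :: "vec24 set \<Rightarrow> vec24 \<Rightarrow> vec24 set" where
  "component S r = {s\<in>S. (r, s) \<in> {(a, b). a \<in> S \<and> b \<in> S \<and> a \<bullet> b \<noteq> 0}\<^sup>*}"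

text \<open>Strongly eutactic: all irreducible components have the same Coxeter number h,
  where an irreducible component C has Coxeter number |C| / dim(span C); the orthogonal
  complement of span S is made up of copies of the empty irreducible system O_1
  (Coxeter number 0).\<close>
definition strongly_eutactic :: "vec24 set \<Rightarrow> bool" where
  "strongly_eutactic S \<longleftrightarrow> (\<exists>h::real.
      (\<forall>r\<in>S. real (card (component S r)) = h * real (dim (span (component S r)))) \<and>
      (span S \<noteq> UNIV \<longrightarrow> h = 0))"

definition coxeter_number :: "vec24 set \<Rightarrow> real" where
  "coxeter_number S = real (card S) / 24"

end

theory Submission
  imports Defs "HOL-Probability.Probability" "HOL-Complex_Analysis.Complex_Analysis"
begin

text \<open>
  Write \<open>\<Lambda>\<^sub>0\<close> for the even sublattice and \<open>w\<close> for a vector of the shadow, which is the coset \<open>w + \<Lambda>\<close>.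
  The theta function of the shadow is the transform under inversion of that of \<open>\<Lambda>\<close> at \<open>\<tau> + 1\<close>; the relations
  of the modular group make it invariant under \<open>\<tau> \<mapsto> \<tau> + 1\<close>, and by positivity all norms in the shadow are even.
  Hence \<open>\<Lambda>\<^sub>0 \<union> (w + \<Lambda>\<^sub>0)\<close> is an even selfdual lattice for every \<open>w\<close> in the shadow; the two lattices obtained
  in this way have root systems \<open>S\<close> and \<open>T\<close>. For an even selfdual lattice of rank 24 the theta function with a
  harmonic quadratic coefficient is a cusp form of weight 14, so it vanishes; its first coefficient says that the
  roots form an eutactic configuration, and taking traces on the components shows that it is strongly eutactic.
  Pairing the theta functions of \<open>\<Lambda>\<close> and of its shadow with those of weight 2 attached to \<open>D\<^sub>4\<close> and comparing with
  \<open>\<int>\<^sup>2\<^sup>4\<close> yields another cusp form of weight 14, whose first coefficient counts the shadow vectors of norm 2: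
  there are 48 more of them than roots of \<open>\<Lambda>\<close>.
\<close>

section \<open>Fourier series\<close>

definition fourier_coeff :: "(real \<Rightarrow> complex) \<Rightarrow> int \<Rightarrow> complex" where
  "fourier_coeff f k = integral {0..1} (\<lambda>x. f x * cis (- (2 * pi * of_int k * x)))"

lemma has_integral_cis:
  "((\<lambda>x. cis (2 * pi * of_int k * x)) has_integral (if k = 0 then 1 else 0)) {0..1}"
proof (cases "k = 0")
  case False
  define c where "c = 2 * pi * of_int k * \<i>"
  have "c \<noteq> 0" using False by (simp add: c_def)
  have cis: "cis (2 * pi * of_int k * x) = exp (c * of_real x)" for x
    by (simp add: cis_conv_exp c_def algebra_simps)
  have "((\<lambda>x. exp (c * of_real x)) has_integral (exp (c * of_real 1) / c - exp (c * of_real 0) / c)) {0..1}"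
  proof (rule fundamental_theorem_of_calculus)
    fix x :: real
    have "((\<lambda>z. exp (c * z) / c) has_field_derivative exp (c * of_real x)) (at (of_real x))"
      using \<open>c \<noteq> 0\<close> by (auto intro!: derivative_eq_intros)
    then have "((\<lambda>x. exp (c * of_real x) / c) has_vector_derivative exp (c * of_real x)) (at x)"
      by (rule has_vector_derivative_real_field)
    then show "((\<lambda>x. exp (c * of_real x) / c) has_vector_derivative exp (c * of_real x)) (at x within {0..1})"
      by (rule has_vector_derivative_at_within)
  qed simp
  moreover have "exp (c * of_real 1) = 1"
    using cis_multiple_2pi [of "of_int k"] unfolding cis [of 1, symmetric] by simp
  ultimately show ?thesis using False by (simp add: cis)
qed (use has_integral_const_real [of "1::complex" 0 1] in simp)

definition fourier_null :: "(real \<Rightarrow> complex) set" where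
  "fourier_null = {f. continuous_on {0..1} f \<and> (\<forall>k. fourier_coeff f k = 0)}"

lemma fourier_nullD: "f \<in> fourier_null \<Longrightarrow> continuous_on {0..1} f" "f \<in> fourier_null \<Longrightarrow> fourier_coeff f k = 0"
  by (simp_all add: fourier_null_def)

lemma fourier_coeff_add:
  assumes "continuous_on {0..1} f" "continuous_on {0..1} g"
  shows "fourier_coeff (\<lambda>x. f x + g x) k = fourier_coeff f k + fourier_coeff g k"
  unfolding fourier_coeff_def distrib_right
  by (intro integral_add integrable_continuous_real continuous_intros assms)

lemma fourier_coeff_diff:
  assumes "continuous_on {0..1} f" "continuous_on {0..1} g"
  shows "fourier_coeff (\<lambda>x. f x - g x) k = fourier_coeff f k - fourier_coeff g k"
  unfolding fourier_coeff_def left_diff_distrib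
  by (intro integral_diff integrable_continuous_real continuous_intros assms)

lemma fourier_null_add: "f \<in> fourier_null \<Longrightarrow> g \<in> fourier_null \<Longrightarrow> (\<lambda>x. f x + g x) \<in> fourier_null"
  by (auto simp: fourier_null_def fourier_coeff_add intro!: continuous_intros)

lemma fourier_null_cmult: "f \<in> fourier_null \<Longrightarrow> (\<lambda>x. c * f x) \<in> fourier_null"
  by (auto simp: fourier_null_def fourier_coeff_def mult.assoc intro!: continuous_intros)

lemma fourier_null_cis:
  assumes "f \<in> fourier_null" shows "(\<lambda>x. cis (2 * pi * of_int j * x) * f x) \<in> fourier_null"
proof -
  have "cis (2 * pi * of_int j * x) * f x * cis (- (2 * pi * of_int k * x)) =
      f x * cis (- (2 * pi * of_int (k - j) * x))" for k x
  proof -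
    have "cis (2 * pi * of_int j * x) * cis (- (2 * pi * of_int k * x)) =
        cis (- (2 * pi * of_int (k - j) * x))"
      unfolding cis_mult by (intro arg_cong [where f = cis]) (simp add: algebra_simps)
    then show ?thesis by (simp add: mult_ac)
  qed
  then have "fourier_coeff (\<lambda>x. cis (2 * pi * of_int j * x) * f x) k = fourier_coeff f (k - j)" for k
    by (simp only: fourier_coeff_def)
  then show ?thesis using assms by (auto simp: fourier_null_def intro!: continuous_intros)
qed

lemma fourier_null_polynomial:
  assumes "real_polynomial_function p" "f \<in> fourier_null"
  shows "(\<lambda>x. of_real (p (cis (2 * pi * x))) * f x) \<in> fourier_null"
  using assms
proof (induction p arbitrary: f rule: real_polynomial_function.induct)
  case (linear p)
  interpret bounded_linear p by fact
  have p_eq: "p z = Re z * p 1 + Im z * p \<i>" for z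
  proof -
    have "z = Re z *\<^sub>R 1 + Im z *\<^sub>R \<i>" by (simp add: complex_eq_iff)
    then have "p z = p (Re z *\<^sub>R 1 + Im z *\<^sub>R \<i>)" by (rule arg_cong)
    then show ?thesis by (simp only: add scaleR real_scaleR_def)
  qed
  have "of_real (p (cis (2 * pi * x))) =
      (p 1 - \<i> * p \<i>) / 2 * cis (2 * pi * of_int 1 * x) +
      (p 1 + \<i> * p \<i>) / 2 * cis (2 * pi * of_int (- 1) * x)" for x
    unfolding p_eq [of "cis (2 * pi * x)"] by (simp add: complex_eq_iff field_simps)
  moreover have "(\<lambda>x. a * (cis (2 * pi * of_int 1 * x) * f x) +
      b * (cis (2 * pi * of_int (- 1) * x) * f x)) \<in> fourier_null" for a b
    by (intro fourier_null_add fourier_null_cmult fourier_null_cis linear.prems)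
  ultimately show ?case by (simp only: distrib_right mult.assoc [of _ _ "f _"])
next
  case (const c)
  then show ?case by (intro fourier_null_cmult)
next
  case (add p q)
  then show ?case by (simp add: distrib_right fourier_null_add)
next
  case (mult p q)
  then show ?case by (simp add: mult.assoc)
qed

lemma continuous_on_circle_of_loop:
  fixes h :: "real \<Rightarrow> real"
  assumes "continuous_on {0..1} h" "h 0 = h 1"
  obtains H where "continuous_on (sphere 0 1) H" "\<And>x. x \<in> {0..1} \<Longrightarrow> H (cis (2 * pi * x)) = h x"
proof
  let ?H = "h \<circ> (\<lambda>z. Arg2pi z / (2 * pi))"
  have "homotopic_loops UNIV h h"
    using assms by (simp add: homotopic_loops_refl path_def pathfinish_def pathstart_def)
  then show "continuous_on (sphere 0 1) ?H"
    using homotopic_with_imp_continuous [OF homotopic_loops_imp_homotopic_circlemaps] by blast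
  show "?H (cis (2 * pi * x)) = h x" if "x \<in> {0..1}" for x
  proof (cases "x = 1")
    case True
    then show ?thesis using assms Arg2pi_of_real [of 1] by simp
  next
    case False
    then have "Arg2pi (cis (2 * pi * x)) = 2 * pi * x"
      using that by (intro Arg2pi_unique [of 1]) (auto simp: cis_conv_exp)
    then show ?thesis by simp
  qed
qed

lemma fourier_null_orthogonal:
  fixes h :: "real \<Rightarrow> real"
  assumes g: "g \<in> fourier_null" and h: "continuous_on {0..1} h" "h 0 = h 1"
  shows "integral {0..1} (\<lambda>x. of_real (h x) * g x) = 0"
proof -
  obtain H where H: "continuous_on (sphere 0 1) H" "\<And>x. x \<in> {0..1} \<Longrightarrow> H (cis (2 * pi * x)) = h x"
    by (rule continuous_on_circle_of_loop [OF h]) (rule that)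
  note [continuous_intros] = fourier_nullD(1) [OF g] h(1)
  have "compact (g ` {0..1})" by (intro compact_continuous_image continuous_intros) auto
  then obtain B where B: "B > 0" "\<And>x. x \<in> {0..1} \<Longrightarrow> norm (g x) \<le> B"
    using compact_imp_bounded bounded_pos by (metis imageI)
  have "norm (integral {0..1} (\<lambda>x. of_real (h x) * g x)) \<le> e" if "e > 0" for e
  proof -
    obtain p where p: "real_polynomial_function p" "\<And>z. z \<in> sphere 0 1 \<Longrightarrow> \<bar>H z - p z\<bar> < e / B"
      using Stone_Weierstrass_real_polynomial_function [OF compact_sphere H(1), of "e / B"] \<open>B > 0\<close> \<open>e > 0\<close>
      by auto
    let ?P = "\<lambda>x. of_real (p (cis (2 * pi * x))) * g x"
    have P: "?P \<in> fourier_null" by (rule fourier_null_polynomial [OF p(1) g])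
    note [continuous_intros] = fourier_nullD(1) [OF P]
    have "integral {0..1} ?P = 0" using fourier_nullD(2) [OF P, of 0] by (simp add: fourier_coeff_def)
    then have "integral {0..1} (\<lambda>x. of_real (h x) * g x) = integral {0..1} (\<lambda>x. of_real (h x) * g x - ?P x)"
      by (subst integral_diff) (auto intro!: integrable_continuous_real continuous_intros)
    moreover have "norm (integral {0..1} (\<lambda>x. of_real (h x) * g x - ?P x)) \<le> e * (1 - 0)"
    proof (rule integral_bound)
      fix x :: real assume x: "x \<in> {0..1}"
      have "norm (of_real (h x) * g x - ?P x) = \<bar>h x - p (cis (2 * pi * x))\<bar> * norm (g x)"
        by (metis left_diff_distrib norm_mult norm_of_real of_real_diff)
      also have "\<dots> \<le> (e / B) * B"
        using p(2) [of "cis (2 * pi * x)"] H(2) [OF x] B x \<open>e > 0\<close> by (intro mult_mono) auto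
      finally show "norm (of_real (h x) * g x - ?P x) \<le> e" using B by simp
    qed (auto intro!: continuous_intros)
    ultimately show ?thesis by simp
  qed
  then have "norm (integral {0..1} (\<lambda>x. of_real (h x) * g x)) \<le> 0" by (rule field_le_epsilon) auto
  then show ?thesis by simp
qed

lemma fourier_null_eq_0:
  assumes "g \<in> fourier_null" "g 0 = g 1" "x \<in> {0..1}"
  shows "g x = 0"
proof -
  have Re0: "Re (f x) = 0" if f: "f \<in> fourier_null" "f 0 = f 1" for f
  proof -
    note [continuous_intros] = fourier_nullD(1) [OF f(1)]
    have "integral {0..1} (\<lambda>x. of_real (Re (f x)) * f x) = 0"
      using f by (intro fourier_null_orthogonal continuous_intros) auto
    moreover have "(\<lambda>x. of_real (Re (f x)) * f x) integrable_on {0..1}"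
      by (intro integrable_continuous_real continuous_intros)
    ultimately have "((\<lambda>x. of_real (Re (f x)) * f x) has_integral 0) {0..1}"
      using integrable_integral by fastforce
    from has_integral_linear [OF this bounded_linear_Re]
    have "integral {0..1} (\<lambda>x. (Re (f x))\<^sup>2) = 0"
      by (simp add: o_def power2_eq_square integral_unique)
    moreover have "continuous_on {0..1} (\<lambda>x. (Re (f x))\<^sup>2)" by (intro continuous_intros)
    ultimately show ?thesis
      using integral_eq_0_iff [of 0 1 "\<lambda>x. (Re (f x))\<^sup>2"] \<open>x \<in> {0..1}\<close> by auto
  qed
  have "Re (- \<i> * g x) = 0" using assms by (intro Re0 [of "\<lambda>x. - \<i> * g x"] fourier_null_cmult) auto
  with Re0 [OF assms(1,2)] show ?thesis by (simp add: complex_eq_iff)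
qed

theorem fourier_coeff_unique:
  assumes "continuous_on {0..1} f" "f 0 = f 1" and "continuous_on {0..1} g" "g 0 = g 1"
    and "\<And>k. fourier_coeff f k = fourier_coeff g k" and "x \<in> {0..1}"
  shows "f x = g x"
proof -
  have "(\<lambda>x. f x - g x) \<in> fourier_null"
    using assms by (auto simp: fourier_null_def fourier_coeff_diff intro!: continuous_intros)
  then show ?thesis using fourier_null_eq_0 [of "\<lambda>x. f x - g x" x] assms by simp
qed

section \<open>Poisson summation on the line\<close>

lemma
  fixes f :: "'i \<Rightarrow> real \<Rightarrow> complex"
  assumes cont: "\<And>i. continuous_on {a..b} (f i)"
    and bound: "\<And>i x. x \<in> {a..b} \<Longrightarrow> norm (f i x) \<le> M i" and "M summable_on A"
  shows continuous_on_infsum: "continuous_on {a..b} (\<lambda>x. \<Sum>\<^sub>\<infinity>i\<in>A. f i x)"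
    and has_sum_integral: "((\<lambda>i. integral {a..b} (f i)) has_sum integral {a..b} (\<lambda>x. \<Sum>\<^sub>\<infinity>i\<in>A. f i x)) A"
proof -
  have lim: "uniform_limit {a..b} (\<lambda>F x. \<Sum>i\<in>F. f i x) (\<lambda>x. \<Sum>\<^sub>\<infinity>i\<in>A. f i x) (finite_subsets_at_top A)"
    using bound assms(3) by (rule Weierstrass_m_test_general)
  have partial_sums: "continuous_on {a..b} (\<lambda>x. \<Sum>i\<in>F. f i x)" for F
    by (intro continuous_intros cont)
  show "continuous_on {a..b} (\<lambda>x. \<Sum>\<^sub>\<infinity>i\<in>A. f i x)"
    by (rule uniform_limit_theorem [OF _ lim]) (use partial_sums in auto)
  obtain I J where I: "\<And>F. ((\<lambda>x. \<Sum>i\<in>F. f i x) has_integral I F) {a..b}"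
    and J: "((\<lambda>x. \<Sum>\<^sub>\<infinity>i\<in>A. f i x) has_integral J) {a..b}" and lim: "(I \<longlongrightarrow> J) (finite_subsets_at_top A)"
    using uniform_limit_integral [OF lim partial_sums] by auto
  have "I F = (\<Sum>i\<in>F. integral {a..b} (f i))" if "finite F" for F
    using I [of F] that integral_sum [of F f "{a..b}"]
    by (simp add: integral_unique integrable_continuous_real cont)
  then have "eventually (\<lambda>F. I F = (\<Sum>i\<in>F. integral {a..b} (f i))) (finite_subsets_at_top A)"
    by (auto simp: eventually_finite_subsets_at_top)
  with lim have "((\<lambda>F. \<Sum>i\<in>F. integral {a..b} (f i)) \<longlongrightarrow> J) (finite_subsets_at_top A)"
    by (rule Lim_transform_eventually)
  then show "((\<lambda>i. integral {a..b} (f i)) has_sum integral {a..b} (\<lambda>x. \<Sum>\<^sub>\<infinity>i\<in>A. f i x)) A"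
    unfolding has_sum_def integral_unique [OF J] .
qed

lemma filterlim_symmetric_int_intervals:
  "filterlim (\<lambda>n. {- int n..<int n}) (finite_subsets_at_top UNIV) sequentially"
  unfolding filterlim_finite_subsets_at_top
proof (intro allI impI)
  fix X :: "int set" assume X: "finite X \<and> X \<subseteq> UNIV"
  then obtain N where N: "\<And>m. m \<in> X \<Longrightarrow> \<bar>m\<bar> \<le> N"
    by (metis finite_imageI finite_nat_set_iff_bounded_le Max_ge imageI)
  show "\<forall>\<^sub>F n in sequentially. finite {- int n..<int n} \<and> X \<subseteq> {- int n..<int n} \<and> {- int n..<int n} \<subseteq> UNIV"
    using eventually_gt_at_top [of "nat N"]
  proof eventually_elim
    case (elim n)
    then show ?case using N by fastforce
  qed
qed

lemma sum_integral_unit_intervals: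
  fixes f :: "real \<Rightarrow> complex"
  assumes "continuous_on UNIV f"
  shows "(\<Sum>m\<in>{- int n..<int n}. integral {0..1} (\<lambda>x. f (x + of_int m))) = integral {- real n..real n} f"
proof (induction n)
  case (Suc n)
  have f: "f integrable_on {a..b}" for a b
    by (rule integrable_continuous_real) (use assms continuous_on_subset in blast)
  have shift: "integral {0..1} (\<lambda>x. f (x + c)) = integral {c..c + 1} f" for c
    using integral_shift_real_ivl [of c c "c + 1" f] by simp
  have "{- int (Suc n)..<int (Suc n)} = insert (- int (Suc n)) (insert (int n) {- int n..<int n})" by auto
  then have "(\<Sum>m\<in>{- int (Suc n)..<int (Suc n)}. integral {0..1} (\<lambda>x. f (x + of_int m))) =
     integral {- real (Suc n)..- real n} f +
       (integral {real n..real (Suc n)} f + integral {- real n..real n} f)"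
    using Suc.IH by (simp add: shift algebra_simps)
  also have "integral {real n..real (Suc n)} f + integral {- real n..real n} f =
      integral {- real n..real (Suc n)} f"
    using Henstock_Kurzweil_Integration.integral_combine [of "- real n" "real n" "real (Suc n)" f] f
    by (simp add: add.commute)
  also have "integral {- real (Suc n)..- real n} f + integral {- real n..real (Suc n)} f =
      integral {- real (Suc n)..real (Suc n)} f"
    by (rule Henstock_Kurzweil_Integration.integral_combine) (auto intro: f)
  finally show ?case .
qed auto

lemma has_integral_UNIV_imp_LIMSEQ:
  fixes f :: "real \<Rightarrow> 'a::banach"
  assumes "(f has_integral I) UNIV"
  shows "(\<lambda>n. integral {- real n..real n} f) \<longlonglongrightarrow> I"
proof (rule LIMSEQ_I)
  fix e :: real assume "e > 0"
  obtain B where B: "\<And>a b. ball 0 B \<subseteq> cbox a b \<Longrightarrow> \<exists>z. (f has_integral z) (cbox a b) \<and> norm (z - I) < e"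
    using assms \<open>e > 0\<close> unfolding has_integral' [of f I UNIV] by simp blast
  show "\<exists>no. \<forall>n\<ge>no. norm (integral {- real n..real n} f - I) < e"
  proof (intro exI allI impI)
    fix n assume "nat \<lceil>B\<rceil> \<le> n"
    then have "ball 0 B \<subseteq> cbox (- real n) (real n)" by (auto simp: dist_real_def)
    with B obtain z where "(f has_integral z) (cbox (- real n) (real n))" "norm (z - I) < e" by blast
    then show "norm (integral {- real n..real n} f - I) < e" by (auto simp: integral_unique)
  qed
qed

lemma integral_periodization:
  fixes f :: "real \<Rightarrow> complex"
  assumes f: "continuous_on UNIV f" "(f has_integral I) UNIV"
    and M: "\<And>m x. x \<in> {0..1} \<Longrightarrow> norm (f (x + of_int m)) \<le> M m" "M summable_on (UNIV :: int set)"
  shows "integral {0..1} (\<lambda>x. \<Sum>\<^sub>\<infinity>m::int. f (x + of_int m)) = I"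
proof -
  have "continuous_on {0..1} (\<lambda>x. f (x + of_int m))" for m
    by (rule continuous_on_compose2 [OF f(1)]) (auto intro!: continuous_intros)
  from has_sum_integral [OF this M]
  have "((\<lambda>F. \<Sum>m\<in>F. integral {0..1} (\<lambda>x. f (x + of_int m))) \<longlongrightarrow>
      integral {0..1} (\<lambda>x. \<Sum>\<^sub>\<infinity>m::int. f (x + of_int m))) (finite_subsets_at_top UNIV)"
    by (simp only: has_sum_def)
  from filterlim_compose [OF this filterlim_symmetric_int_intervals]
  have "(\<lambda>n. integral {- real n..real n} f) \<longlonglongrightarrow> integral {0..1} (\<lambda>x. \<Sum>\<^sub>\<infinity>m::int. f (x + of_int m))"
    by (simp only: sum_integral_unit_intervals [OF f(1)])
  then show ?thesis using has_integral_UNIV_imp_LIMSEQ [OF f(2)] LIMSEQ_unique by blast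
qed

lemma cis_2pi_of_int [simp]: "cis (2 * pi * of_int k) = 1"
  by (rule cis_multiple_2pi) simp

lemma cis_2pi_add_of_int: "cis (2 * pi * of_int k * (x + of_int m)) = cis (2 * pi * of_int k * x)"
proof -
  have "2 * pi * of_int k * (x + of_int m) = 2 * pi * of_int k * x + 2 * pi * of_int (k * m)"
    by (simp add: algebra_simps)
  then show ?thesis by (simp only: cis_mult [symmetric] cis_2pi_of_int mult_1_right)
qed

lemma
  fixes c :: "int \<Rightarrow> complex"
  assumes "(\<lambda>j. norm (c j)) summable_on UNIV"
  shows continuous_on_fourier_series: "continuous_on {0..1} (\<lambda>x. \<Sum>\<^sub>\<infinity>j. c j * cis (2 * pi * of_int j * x))"
    and fourier_coeff_series: "fourier_coeff (\<lambda>x. \<Sum>\<^sub>\<infinity>j. c j * cis (2 * pi * of_int j * x)) k = c k"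
proof -
  show "continuous_on {0..1} (\<lambda>x. \<Sum>\<^sub>\<infinity>j. c j * cis (2 * pi * of_int j * x))"
    by (rule continuous_on_infsum [OF _ _ assms]) (auto intro!: continuous_intros simp: norm_mult)
  define e where "e j x = c j * cis (2 * pi * of_int j * x) * cis (- (2 * pi * of_int k * x))" for j x
  have e: "e j = (\<lambda>x. c j * cis (2 * pi * of_int (j - k) * x))" for j
    unfolding e_def [abs_def] mult.assoc cis_mult by (simp add: algebra_simps)
  have "((\<lambda>j. integral {0..1} (e j)) has_sum integral {0..1} (\<lambda>x. \<Sum>\<^sub>\<infinity>j. e j x)) UNIV"
    by (rule has_sum_integral [OF _ _ assms]) (auto simp: e norm_mult intro!: continuous_intros)
  moreover have "integral {0..1} (e j) = (if j = k then c k else 0)" for j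
    unfolding e integral_unique [OF has_integral_mult_right [OF has_integral_cis]] by auto
  then have "((\<lambda>j. integral {0..1} (e j)) has_sum c k) UNIV"
    using has_sum_finite_neutralI [of "{k}" UNIV "\<lambda>j. integral {0..1} (e j)" "c k"] by simp
  moreover have "(\<Sum>\<^sub>\<infinity>j. e j x) = (\<Sum>\<^sub>\<infinity>j. c j * cis (2 * pi * of_int j * x)) * cis (- (2 * pi * of_int k * x))"
    for x
    unfolding e_def by (rule infsum_cmult_left')
  ultimately show "fourier_coeff (\<lambda>x. \<Sum>\<^sub>\<infinity>j. c j * cis (2 * pi * of_int j * x)) k = c k"
    unfolding fourier_coeff_def by (simp add: has_sum_unique)
qed

theorem poisson_summation:
  fixes f :: "real \<Rightarrow> complex" and c :: "int \<Rightarrow> complex"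
  assumes f: "continuous_on UNIV f"
    and M: "\<And>m x. x \<in> {0..1} \<Longrightarrow> norm (f (x + of_int m)) \<le> M m" "M summable_on UNIV"
    and transform: "\<And>k. ((\<lambda>x. f x * cis (- (2 * pi * of_int k * x))) has_integral c k) UNIV"
    and c: "(\<lambda>k. norm (c k)) summable_on UNIV"
  shows "(\<Sum>\<^sub>\<infinity>m::int. f (x + of_int m)) = (\<Sum>\<^sub>\<infinity>k::int. c k * cis (2 * pi * of_int k * x))"
proof -
  define F where "F x = (\<Sum>\<^sub>\<infinity>m::int. f (x + of_int m))" for x
  define G where "G x = (\<Sum>\<^sub>\<infinity>k::int. c k * cis (2 * pi * of_int k * x))" for x
  have F_periodic: "F (x + of_int j) = F x" for x j
    unfolding F_def by (rule infsum_reindex_bij_witness [of _ "\<lambda>m. m - j" "\<lambda>m. m + j"])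
      (auto simp: algebra_simps)
  have G_periodic: "G (x + of_int j) = G x" for x j
    by (simp only: G_def cis_2pi_add_of_int)
  have "F x = G x" if "x \<in> {0..1}" for x
  proof (rule fourier_coeff_unique [OF _ _ _ _ _ that])
    have "continuous_on {0..1} (\<lambda>x. f (x + of_int m))" for m :: int
      by (rule continuous_on_compose2 [OF f]) (auto intro!: continuous_intros)
    then show "continuous_on {0..1} F" unfolding F_def by (rule continuous_on_infsum [OF _ M])
    show "continuous_on {0..1} G" unfolding G_def by (rule continuous_on_fourier_series [OF c])
    show "F 0 = F 1" "G 0 = G 1" using F_periodic [of 0 1] G_periodic [of 0 1] by simp_all
    fix k
    have "fourier_coeff F k =
        integral {0..1} (\<lambda>x. \<Sum>\<^sub>\<infinity>m::int. f (x + of_int m) * cis (- (2 * pi * of_int k * (x + of_int m))))"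
      using cis_2pi_add_of_int [of "- k"] by (simp add: fourier_coeff_def F_def infsum_cmult_left')
    also have "\<dots> = c k"
    proof (rule integral_periodization [OF _ transform _ M(2)])
      show "continuous_on UNIV (\<lambda>x. f x * cis (- (2 * pi * of_int k * x)))" by (intro continuous_intros f)
    qed (simp add: norm_mult M(1))
    finally show "fourier_coeff F k = fourier_coeff G k"
      unfolding G_def using fourier_coeff_series [OF c] by simp
  qed
  then have "F (frac x) = G (frac x)" using frac_lt_1 [of x] by (simp add: less_imp_le)
  then show ?thesis
    using F_periodic [of "frac x" "\<lfloor>x\<rfloor>"] G_periodic [of "frac x" "\<lfloor>x\<rfloor>"] by (simp add: frac_def F_def G_def)
qed

section \<open>Gaussian sums over the integers\<close>

definition gauss :: "real \<Rightarrow> 'a::real_inner \<Rightarrow> real" where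
  "gauss t x = exp (- pi * t * (x \<bullet> x))"

lemma gauss_pos [simp]: "gauss t x > 0" and gauss_nonneg [simp]: "gauss t x \<ge> 0"
  by (simp_all add: gauss_def)

lemma gauss_zero [simp]: "gauss t 0 = 1"
  by (simp add: gauss_def)

lemma norm_gauss_cis [simp]: "norm (complex_of_real (gauss t x) * cis \<theta>) = gauss t x"
  by (simp add: norm_mult)

lemma continuous_on_gauss [continuous_intros]:
  "continuous_on A f \<Longrightarrow> continuous_on A (\<lambda>x. gauss t (f x))"
  unfolding gauss_def by (intro continuous_intros)

lemma gauss_add_orthogonal:
  assumes "x \<bullet> u = 0" shows "gauss t (x + c *\<^sub>R u) = gauss t x * gauss (t * (u \<bullet> u)) c"
  using assms unfolding gauss_def exp_add [symmetric]
  by (simp add: inner_add_left inner_add_right inner_commute algebra_simps)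

lemma infsum_of_real:
  assumes "f summable_on A"
  shows "(\<Sum>\<^sub>\<infinity>x\<in>A. of_real (f x) :: 'b :: real_normed_algebra_1) = of_real (\<Sum>\<^sub>\<infinity>x\<in>A. f x)"
  by (intro infsumI has_sum_of_real has_sum_infsum assms)

lemma summable_on_norm_le:
  fixes f :: "'a \<Rightarrow> 'b::banach"
  assumes "g summable_on A" "\<And>x. x \<in> A \<Longrightarrow> norm (f x) \<le> g x"
  shows "f summable_on A"
  by (rule abs_summable_summable, rule Infinite_Sum.abs_summable_on_comparison_test' [OF assms])

lemma summable_on_power_abs_int:
  fixes r :: real
  assumes "0 \<le> r" "r < 1"
  shows "(\<lambda>m::int. r ^ nat \<bar>m\<bar>) summable_on UNIV"
proof -
  have r: "(\<lambda>n::nat. r ^ n) summable_on UNIV"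
    using assms by (intro summable_nonneg_imp_summable_on summable_geometric) auto
  have "(\<lambda>m::int. r ^ nat \<bar>m\<bar>) summable_on range int"
    by (subst summable_on_reindex) (auto simp: o_def r)
  moreover have "(\<lambda>m::int. r ^ nat \<bar>m\<bar>) summable_on range (\<lambda>n. - int n)"
    by (subst summable_on_reindex) (auto simp: o_def r inj_on_def)
  ultimately have "(\<lambda>m::int. r ^ nat \<bar>m\<bar>) summable_on (range int \<union> range (\<lambda>n. - int n))"
    by (rule summable_on_union)
  moreover have "range int \<union> range (\<lambda>n. - int n) = UNIV"
    by (auto simp: image_iff) (metis int_cases2)
  ultimately show ?thesis by simp
qed

lemma gauss_le_geometric:
  fixes x :: real
  assumes "s > 0" "\<bar>x\<bar> \<le> A"
  shows "gauss s (x + of_int m) \<le> exp (pi * s * (2 * A + 1)) * exp (- 2 * pi * s) ^ nat \<bar>m\<bar>"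
proof -
  have "0 \<le> (\<bar>x + of_int m\<bar> - 1)\<^sup>2" by simp
  then have "2 * \<bar>x + of_int m\<bar> - 1 \<le> (x + of_int m)\<^sup>2" by (simp add: power2_diff)
  moreover have "\<bar>of_int m\<bar> \<le> \<bar>x + of_int m\<bar> + A" using assms by linarith
  ultimately have "2 * \<bar>of_int m\<bar> - (2 * A + 1) \<le> (x + of_int m)\<^sup>2" by argo
  then have "pi * s * (2 * \<bar>of_int m\<bar> - (2 * A + 1)) \<le> pi * s * (x + of_int m)\<^sup>2"
    using assms by (intro mult_left_mono) auto
  then show ?thesis
    by (simp add: gauss_def exp_of_nat_mult [symmetric] exp_add [symmetric] power2_eq_square algebra_simps)
qed

lemma summable_on_geometric_int:
  assumes "s > 0" shows "(\<lambda>m::int. C * exp (- 2 * pi * s) ^ nat \<bar>m\<bar>) summable_on UNIV"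
  using assms by (intro summable_on_cmult_right summable_on_power_abs_int) auto

lemma summable_on_gauss_int:
  fixes x :: real
  assumes "s > 0"
  shows "(\<lambda>m::int. gauss s (x + of_int m)) summable_on UNIV"
proof (rule summable_on_comparison_test)
  show "(\<lambda>m::int. exp (pi * s * (2 * \<bar>x\<bar> + 1)) * exp (- 2 * pi * s) ^ nat \<bar>m\<bar>) summable_on UNIV"
    by (rule summable_on_geometric_int [OF assms])
qed (use gauss_le_geometric [OF assms order_refl] in auto)

lemma has_bochner_integral_normal_iexp:
  "has_bochner_integral lborel (\<lambda>x. std_normal_density x *\<^sub>R iexp (t * x)) (of_real (exp (- (t\<^sup>2) / 2)))"
proof -
  interpret real_distribution std_normal_distribution by (rule real_dist_normal_dist)
  have "integrable std_normal_distribution (\<lambda>x. iexp (t * x))" by (rule integrable_iexp) auto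
  moreover have "integral\<^sup>L std_normal_distribution (\<lambda>x. iexp (t * x)) = of_real (exp (- (t\<^sup>2) / 2))"
    using fun_cong [OF char_std_normal_distribution, of t] by (simp add: char_def)
  ultimately show ?thesis
    by (subst (asm) integrable_density, simp_all add: normal_density_nonneg)
       (subst (asm) integral_density, simp_all add: normal_density_nonneg has_bochner_integral_iff)
qed

lemma has_integral_gauss_cis:
  fixes s b :: real
  assumes "s > 0"
  shows "((\<lambda>x. of_real (gauss s x) * cis (2 * pi * b * x)) has_integral
      of_real (gauss (1 / s) b / sqrt s)) UNIV"
proof -
  define d where "d = sqrt (2 * pi * s)"
  have d: "d > 0" "d\<^sup>2 = 2 * pi * s" using assms by (auto simp: d_def)
  define t where "t = 2 * pi * b / d"
  have "((\<lambda>x. std_normal_density (d * x) *\<^sub>R iexp (t * (d * x))) has_integral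
      of_real (exp (- (t\<^sup>2) / 2)) /\<^sub>R d) UNIV"
    using has_bochner_integral_normal_iexp [of t] d(1)
    by (subst (asm) lborel_has_bochner_integral_real_affine_iff [of d _ _ 0])
       (auto simp: has_bochner_integral_iff dest: has_integral_integral_lborel)
  from has_integral_mult_right [OF this, of "of_real (sqrt (2 * pi))"]
  have "((\<lambda>x. of_real (sqrt (2 * pi) * std_normal_density (d * x)) * iexp (t * (d * x))) has_integral
      of_real (sqrt (2 * pi) / d * exp (- (t\<^sup>2) / 2))) UNIV"
    by (simp add: scaleR_conv_of_real field_simps)
  moreover have "sqrt (2 * pi) * std_normal_density (d * x) = gauss s x" for x
    using d by (simp add: std_normal_density_def gauss_def power_mult_distrib power2_eq_square [symmetric])
  moreover have "iexp (t * (d * x)) = cis (2 * pi * b * x)" for x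
    using d(1) by (simp add: cis_conv_exp t_def mult_ac)
  moreover have "exp (- (t\<^sup>2) / 2) = gauss (1 / s) b"
  proof -
    have "t\<^sup>2 = (2 * pi * b)\<^sup>2 / (2 * pi * s)" by (simp add: t_def power_divide d(2))
    then have "- (t\<^sup>2) / 2 = - pi * (1 / s) * (b \<bullet> b)"
      using assms by (simp add: power2_eq_square field_simps)
    then show ?thesis unfolding gauss_def by (rule arg_cong)
  qed
  moreover have "sqrt (2 * pi) / d = 1 / sqrt s" using assms by (simp add: d_def real_sqrt_mult)
  ultimately show ?thesis by simp
qed

theorem poisson_gauss_int:
  fixes s b x :: real
  assumes s: "s > 0"
  shows "(\<Sum>\<^sub>\<infinity>m::int. of_real (gauss s (x + of_int m)) * cis (2 * pi * b * of_int m)) =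
     of_real (1 / sqrt s) * (\<Sum>\<^sub>\<infinity>k::int. of_real (gauss (1 / s) (of_int k - b))
       * cis (2 * pi * x * (of_int k - b)))"
proof -
  define f where "f y = of_real (gauss s y) * cis (2 * pi * b * (y - x))" for y
  define c where "c k = of_real (gauss (1 / s) (of_int k - b) / sqrt s) * cis (- (2 * pi * b * x))"
    for k :: int
  have "(\<Sum>\<^sub>\<infinity>m::int. f (x + of_int m)) = (\<Sum>\<^sub>\<infinity>k::int. c k * cis (2 * pi * of_int k * x))"
  proof (rule poisson_summation)
    show "continuous_on UNIV f" unfolding f_def by (intro continuous_intros)
    show "norm (f (y + of_int m)) \<le> exp (pi * s * (2 * 1 + 1)) * exp (- 2 * pi * s) ^ nat \<bar>m\<bar>"
      if "y \<in> {0..1}" for y m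
      using gauss_le_geometric [OF s, of y 1 m] that by (simp add: f_def)
    show "(\<lambda>m::int. exp (pi * s * (2 * 1 + 1)) * exp (- 2 * pi * s) ^ nat \<bar>m\<bar>) summable_on UNIV"
      by (rule summable_on_geometric_int [OF s])
    show "(\<lambda>k. norm (c k)) summable_on UNIV"
      using summable_on_cmult_right [OF summable_on_gauss_int [of "1 / s" "- b"], of "1 / sqrt s"] s
      by (simp add: c_def norm_mult norm_divide add.commute)
    fix k :: int
    have "f y * cis (- (2 * pi * of_int k * y)) =
        of_real (gauss s y) * cis (2 * pi * (b - of_int k) * y) * cis (- (2 * pi * b * x))" for y
      unfolding f_def mult.assoc cis_mult by (simp add: algebra_simps)
    moreover have "gauss (1 / s) (b - of_int k) = gauss (1 / s) (of_int k - b)"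
      by (simp add: gauss_def algebra_simps)
    ultimately show "((\<lambda>y. f y * cis (- (2 * pi * of_int k * y))) has_integral c k) UNIV"
      using has_integral_mult_left [OF has_integral_gauss_cis [OF s, of "b - of_int k"],
        of "cis (- (2 * pi * b * x))"]
      by (simp only: c_def)
  qed
  moreover have "c k * cis (2 * pi * of_int k * x) =
      of_real (1 / sqrt s) * (of_real (gauss (1 / s) (of_int k - b))
        * cis (2 * pi * x * (of_int k - b)))" for k
    unfolding c_def mult.assoc cis_mult by (simp add: algebra_simps)
  ultimately show ?thesis by (simp only: f_def add_diff_cancel_left' infsum_cmult_right')
qed

lemma infsum_le_norm_infsum:
  fixes f :: "'a \<Rightarrow> real" and c :: complex
  assumes "f summable_on A" "h summable_on B" "\<And>y. y \<in> B \<Longrightarrow> norm (g y) = h y"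
    and "(\<Sum>\<^sub>\<infinity>x\<in>A. of_real (f x)) = c * (\<Sum>\<^sub>\<infinity>y\<in>B. g y)"
  shows "(\<Sum>\<^sub>\<infinity>x\<in>A. f x) \<le> norm c * (\<Sum>\<^sub>\<infinity>y\<in>B. h y)"
proof -
  have "(\<lambda>y. norm (g y)) summable_on B" using assms(2,3) by (simp cong: summable_on_cong)
  then have "norm (\<Sum>\<^sub>\<infinity>y\<in>B. g y) \<le> (\<Sum>\<^sub>\<infinity>y\<in>B. h y)"
    using norm_infsum_bound assms(3) by (metis (mono_tags, lifting) infsum_cong)
  then have "norm (c * (\<Sum>\<^sub>\<infinity>y\<in>B. g y)) \<le> norm c * (\<Sum>\<^sub>\<infinity>y\<in>B. h y)"
    by (simp add: norm_mult mult_left_mono)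
  moreover have "norm (c * (\<Sum>\<^sub>\<infinity>y\<in>B. g y)) = \<bar>\<Sum>\<^sub>\<infinity>x\<in>A. f x\<bar>"
    unfolding assms(4) [symmetric] infsum_of_real [OF assms(1)] by simp
  ultimately show ?thesis by linarith
qed

lemma infsum_gauss_int_bounded:
  assumes s: "s > 0"
  obtains K where "\<And>x :: real. (\<Sum>\<^sub>\<infinity>m::int. gauss s (x + of_int m)) \<le> K"
proof
  show "(\<Sum>\<^sub>\<infinity>m::int. gauss s (x + of_int m)) \<le> norm (complex_of_real (1 / sqrt s)) *
      (\<Sum>\<^sub>\<infinity>k::int. gauss (1 / s) (0 + real_of_int k))" for x :: real
    using poisson_gauss_int [OF s, of x 0] s
    by (intro infsum_le_norm_infsum [where g = "\<lambda>k. of_real (gauss (1 / s) (of_int k)) *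
        cis (2 * pi * x * of_int k)"] summable_on_gauss_int) auto
qed

section \<open>Lattices and their subgroups\<close>

definition add_subgroup :: "'a::ab_group_add set \<Rightarrow> bool" where
  "add_subgroup H \<longleftrightarrow> 0 \<in> H \<and> (\<forall>x\<in>H. \<forall>y\<in>H. x - y \<in> H)"

lemma add_subgroup_zero: "add_subgroup H \<Longrightarrow> 0 \<in> H"
  and add_subgroup_diff: "add_subgroup H \<Longrightarrow> x \<in> H \<Longrightarrow> y \<in> H \<Longrightarrow> x - y \<in> H"
  by (simp_all add: add_subgroup_def)

lemma add_subgroup_uminus: "add_subgroup H \<Longrightarrow> x \<in> H \<Longrightarrow> - x \<in> H"
  using add_subgroup_diff [of H 0 x] by (simp add: add_subgroup_zero)

lemma add_subgroup_add: "add_subgroup H \<Longrightarrow> x \<in> H \<Longrightarrow> y \<in> H \<Longrightarrow> x + y \<in> H"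
  using add_subgroup_diff [of H x "- y"] by (simp add: add_subgroup_uminus)

lemma add_subgroup_Int: "add_subgroup H \<Longrightarrow> add_subgroup K \<Longrightarrow> add_subgroup (H \<inter> K)"
  by (simp add: add_subgroup_def)

lemma add_subgroup_sum:
  "add_subgroup H \<Longrightarrow> (\<And>i. i \<in> I \<Longrightarrow> f i \<in> H) \<Longrightarrow> sum f I \<in> H"
  by (induction I rule: infinite_finite_induct) (auto simp: add_subgroup_zero add_subgroup_add)

lemma add_subgroup_scale_int:
  fixes H :: "'a::real_vector set"
  assumes H: "add_subgroup H" and x: "x \<in> H" shows "of_int k *\<^sub>R x \<in> H"
proof -
  have nat: "of_nat n *\<^sub>R x \<in> H" for n
    by (induction n) (auto simp: scaleR_add_left add_subgroup_zero add_subgroup_add H x)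
  show ?thesis using nat add_subgroup_uminus [OF H nat] by (cases k rule: int_cases2) auto
qed

lemma add_subgroup_int_cyclic:
  fixes J :: "int set"
  assumes J: "add_subgroup J" obtains g where "J = range (\<lambda>k. k * g)"
proof (cases "J = {0}")
  case True
  then show thesis by (intro that [of 0]) auto
next
  case False
  then obtain j where "j \<in> J" "j \<noteq> 0" using add_subgroup_zero [OF J] by auto
  then have "\<bar>j\<bar> \<in> J" "\<bar>j\<bar> > 0" using add_subgroup_uminus [OF J] by (auto simp: abs_if)
  then have ex: "int (nat \<bar>j\<bar>) \<in> J \<and> nat \<bar>j\<bar> > 0" by simp
  define n where "n = (LEAST n. int n \<in> J \<and> n > 0)"
  have n: "int n \<in> J" "n > 0" using LeastI [of "\<lambda>n. int n \<in> J \<and> n > 0", OF ex] by (simp_all add: n_def)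
  have least: "n \<le> j" if "int j \<in> J" "j > 0" for j
    unfolding n_def using that by (intro Least_le) simp
  have multiples: "k * int n \<in> J" for k
  proof (induction k rule: int_induct [of _ 0])
    case base
    show ?case using add_subgroup_zero [OF J] by simp
  next
    case (step1 k)
    then show ?case using add_subgroup_add [OF J _ n(1)] by (simp add: distrib_right)
  next
    case (step2 k)
    then show ?case using add_subgroup_diff [OF J _ n(1)] by (simp add: left_diff_distrib)
  qed
  show thesis
  proof (rule that [of "int n"], intro equalityI subsetI)
    fix m assume "m \<in> J"
    then have "m - m div int n * int n \<in> J" by (intro add_subgroup_diff [OF J] multiples)
    then have mod: "m mod int n \<in> J" by (simp add: minus_div_mult_eq_mod)
    have "0 \<le> m mod int n" "m mod int n < int n" using n(2) by simp_all
    then obtain j where j: "m mod int n = int j" "j < n" by (metis nonneg_int_cases of_nat_less_iff)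
    then have "j = 0" using mod least [of j] by force
    then have "m mod int n = 0" using j(1) by simp
    then have "m = m div int n * int n" using div_mult_mod_eq [of m "int n"] by simp
    then show "m \<in> range (\<lambda>k. k * int n)" by blast
  qed (use multiples in auto)
qed

definition int_span :: "'a::real_vector set \<Rightarrow> 'a set" where
  "int_span B = {(\<Sum>b\<in>B. of_int (c b) *\<^sub>R b) | c :: 'a \<Rightarrow> int. True}"

lemma int_spanI: "x = (\<Sum>b\<in>B. of_int (c b) *\<^sub>R b) \<Longrightarrow> x \<in> int_span B"
  by (auto simp: int_span_def)

lemma int_spanE:
  assumes "x \<in> int_span B" obtains c :: "_ \<Rightarrow> int" where "x = (\<Sum>b\<in>B. of_int (c b) *\<^sub>R b)"
  using assms by (auto simp: int_span_def)

lemma int_span_minimal: "add_subgroup H \<Longrightarrow> B \<subseteq> H \<Longrightarrow> int_span B \<subseteq> H"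
  by (auto simp: int_span_def intro!: add_subgroup_sum add_subgroup_scale_int)

lemma add_subgroup_int_span: "add_subgroup (int_span B)"
  unfolding add_subgroup_def
proof (intro conjI ballI)
  show "0 \<in> int_span B" by (rule int_spanI [where c = "\<lambda>_. 0"]) simp
  fix x y assume "x \<in> int_span B" "y \<in> int_span B"
  then obtain c d where "x = (\<Sum>b\<in>B. of_int (c b) *\<^sub>R b)" "y = (\<Sum>b\<in>B. of_int (d b) *\<^sub>R b)"
    by (auto elim!: int_spanE)
  then show "x - y \<in> int_span B"
    by (intro int_spanI [where c = "\<lambda>b. c b - d b"]) (simp add: sum_subtractf scaleR_left_diff_distrib)
qed

lemma int_span_base:
  assumes "finite B" "b \<in> B" shows "b \<in> int_span B"
proof (rule int_spanI)
  show "b = (\<Sum>v\<in>B. of_int (if v = b then 1 else 0) *\<^sub>R v)"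
    using assms by (simp add: if_distrib [of "\<lambda>k. of_int k *\<^sub>R _"] cong: if_cong)
qed

lemma int_span_linear_image:
  fixes f :: "'a::real_vector \<Rightarrow> 'b::real_vector"
  assumes f: "linear f" "inj f" shows "int_span (f ` B) = f ` int_span B"
proof -
  have reindex: "(\<Sum>b\<in>f ` B. of_int (c b) *\<^sub>R b) = f (\<Sum>b\<in>B. of_int (c (f b)) *\<^sub>R b)" for c :: "'b \<Rightarrow> int"
    using f by (simp add: sum.reindex [OF inj_on_subset [OF f(2) subset_UNIV]] linear_sum linear_scale)
  show ?thesis
  proof (intro equalityI subsetI)
    fix y assume "y \<in> int_span (f ` B)"
    then obtain c where "y = (\<Sum>b\<in>f ` B. of_int (c b) *\<^sub>R b)" by (rule int_spanE)
    then show "y \<in> f ` int_span B" unfolding reindex by (rule image_eqI) (rule int_spanI [OF refl])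
  next
    fix y assume "y \<in> f ` int_span B"
    then obtain c where "y = f (\<Sum>b\<in>B. of_int (c b) *\<^sub>R b)" by (auto elim: int_spanE)
    then show "y \<in> int_span (f ` B)"
      using f(2) by (intro int_spanI [where c = "c \<circ> inv f"]) (simp add: reindex)
  qed
qed

lemma int_span_subset_span: "int_span B \<subseteq> span B"
  by (auto simp: int_span_def intro!: span_sum span_scale intro: span_base)

lemma int_span_insert:
  assumes "finite B" "v \<notin> B"
  shows "int_span (insert v B) = (\<lambda>(m::int, x). x + of_int m *\<^sub>R v) ` (UNIV \<times> int_span B)"
proof (intro equalityI subsetI)
  fix z assume "z \<in> int_span (insert v B)"
  then obtain c where "z = (\<Sum>b\<in>insert v B. of_int (c b) *\<^sub>R b)" by (rule int_spanE)
  then have "z = (\<lambda>(m::int, x). x + of_int m *\<^sub>R v) (c v, \<Sum>b\<in>B. of_int (c b) *\<^sub>R b)"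
    using assms by simp
  then show "z \<in> (\<lambda>(m::int, x). x + of_int m *\<^sub>R v) ` (UNIV \<times> int_span B)"
    by (intro image_eqI) (auto intro: int_spanI)
next
  fix z assume "z \<in> (\<lambda>(m::int, x). x + of_int m *\<^sub>R v) ` (UNIV \<times> int_span B)"
  then obtain m c where "z = (\<Sum>b\<in>B. of_int (c b) *\<^sub>R b) + of_int m *\<^sub>R v"
    by (auto elim: int_spanE)
  also have "(\<Sum>b\<in>B. of_int (c b) *\<^sub>R b) = (\<Sum>b\<in>B. of_int ((c(v := m)) b) *\<^sub>R b)"
    using assms by (intro sum.cong) auto
  finally have "z = (\<Sum>b\<in>insert v B. of_int ((c(v := m)) b) *\<^sub>R b)" using assms by simp
  then show "z \<in> int_span (insert v B)" by (rule int_spanI)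
qed

lemma span_scaleR_iff: "c \<noteq> 0 \<Longrightarrow> c *\<^sub>R x \<in> span S \<longleftrightarrow> x \<in> span S"
  using span_scale [of "c *\<^sub>R x" S "1 / c"] span_scale [of x S c] by auto

lemma bij_betw_int_span_insert:
  assumes "finite B" "v \<notin> span B"
  shows "bij_betw (\<lambda>(m::int, x). x + of_int m *\<^sub>R v) (UNIV \<times> int_span B) (int_span (insert v B))"
proof -
  have "v \<notin> B" using assms span_base by blast
  moreover have "inj_on (\<lambda>(m::int, x). x + of_int m *\<^sub>R v) (UNIV \<times> int_span B)"
  proof (clarsimp simp: inj_on_def)
    fix m m' :: int and x x' assume x: "x \<in> int_span B" "x' \<in> int_span B"
      and eq: "x + of_int m *\<^sub>R v = x' + of_int m' *\<^sub>R v"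
    have "(of_int m - of_int m') *\<^sub>R v = x' - x" using eq by (simp add: algebra_simps)
    also have "\<dots> \<in> span B" using x int_span_subset_span by (intro span_diff) auto
    finally have "m = m'" using assms(2) span_scaleR_iff [of "of_int m - of_int m'" v B] by auto
    then show "m = m' \<and> x = x'" using eq by simp
  qed
  ultimately show ?thesis using int_span_insert [OF assms(1)] by (simp add: bij_betw_def)
qed

lemma add_subgroup_leading_coefficient:
  fixes H K :: "'a::real_vector set"
  assumes H: "add_subgroup H" and K: "add_subgroup K"
  obtains g x where "x \<in> K" "x + of_int g *\<^sub>R v \<in> H" "\<And>y m. y \<in> K \<Longrightarrow> y + of_int m *\<^sub>R v \<in> H \<Longrightarrow> g dvd m"
proof -
  define J where "J = {m::int. \<exists>x\<in>K. x + of_int m *\<^sub>R v \<in> H}"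
  have "add_subgroup J"
    unfolding add_subgroup_def
  proof (intro conjI ballI)
    show "0 \<in> J" using add_subgroup_zero [OF H] add_subgroup_zero [OF K] by (force simp: J_def)
    fix m n assume "m \<in> J" "n \<in> J"
    then obtain x y where xy: "x \<in> K" "x + of_int m *\<^sub>R v \<in> H" "y \<in> K" "y + of_int n *\<^sub>R v \<in> H"
      by (auto simp: J_def)
    have "(x - y) + of_int (m - n) *\<^sub>R v = (x + of_int m *\<^sub>R v) - (y + of_int n *\<^sub>R v)"
      by (simp add: algebra_simps)
    also have "\<dots> \<in> H" using xy by (intro add_subgroup_diff [OF H])
    finally show "m - n \<in> J" using add_subgroup_diff [OF K xy(1,3)] unfolding J_def by blast
  qed
  then obtain g where g: "J = range (\<lambda>k. k * g)" by (rule add_subgroup_int_cyclic)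
  then have "g \<in> J" by (auto intro: image_eqI [of _ _ 1])
  then obtain x where "x \<in> K" "x + of_int g *\<^sub>R v \<in> H" by (auto simp: J_def)
  moreover have "g dvd m" if "y \<in> K" "y + of_int m *\<^sub>R v \<in> H" for y m
  proof -
    have "m \<in> J" using that by (auto simp: J_def)
    then show ?thesis by (auto simp: g)
  qed
  ultimately show thesis by (rule that)
qed

lemma int_span_subgroup_decomposition:
  fixes v :: "'a::real_vector"
  assumes "finite B" "v \<notin> B" and H: "add_subgroup H" "H \<subseteq> int_span (insert v B)"
  obtains g x where "x \<in> int_span B" "x + of_int g *\<^sub>R v \<in> H"
    "\<And>z. z \<in> H \<Longrightarrow> \<exists>k. z - of_int k *\<^sub>R (x + of_int g *\<^sub>R v) \<in> H \<inter> int_span B"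
proof -
  obtain g x where x: "x \<in> int_span B" "x + of_int g *\<^sub>R v \<in> H"
    and g: "\<And>y m. y \<in> int_span B \<Longrightarrow> y + of_int m *\<^sub>R v \<in> H \<Longrightarrow> g dvd m"
    by (rule add_subgroup_leading_coefficient [OF H(1) add_subgroup_int_span]) (rule that)
  show thesis
  proof (rule that [OF x])
    fix z assume z: "z \<in> H"
    then have "z \<in> (\<lambda>(m::int, y). y + of_int m *\<^sub>R v) ` (UNIV \<times> int_span B)"
      using H(2) int_span_insert [OF assms(1,2)] by blast
    then obtain y m where y: "y \<in> int_span B" "z = y + of_int m *\<^sub>R v" by auto
    then have "g dvd m" using z by (intro g) auto
    then obtain k where "m = g * k" by (rule dvdE)
    then have "z - of_int k *\<^sub>R (x + of_int g *\<^sub>R v) = y - of_int k *\<^sub>R x" by (simp add: y(2) algebra_simps)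
    also have "\<dots> \<in> int_span B"
      by (intro add_subgroup_diff add_subgroup_scale_int add_subgroup_int_span y x)
    finally have "z - of_int k *\<^sub>R (x + of_int g *\<^sub>R v) \<in> int_span B" .
    moreover have "z - of_int k *\<^sub>R (x + of_int g *\<^sub>R v) \<in> H"
      using z x(2) by (intro add_subgroup_diff add_subgroup_scale_int H(1))
    ultimately show "\<exists>k. z - of_int k *\<^sub>R (x + of_int g *\<^sub>R v) \<in> H \<inter> int_span B" by blast
  qed
qed

lemma int_span_extend_subgroup:
  fixes v :: "'a::real_vector"
  assumes B: "finite B" "v \<notin> span B" and C: "finite C" "independent C" "H \<inter> int_span B = int_span C"
    and H: "add_subgroup H" "H \<subseteq> int_span (insert v B)"
  obtains D where "finite D" "independent D" "H = int_span D"
proof -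
  have "v \<notin> B" using B(2) span_base by blast
  then obtain g x where x: "x \<in> int_span B" "x + of_int g *\<^sub>R v \<in> H"
    and decompose: "\<And>z. z \<in> H \<Longrightarrow> \<exists>k. z - of_int k *\<^sub>R (x + of_int g *\<^sub>R v) \<in> int_span C"
    using int_span_subgroup_decomposition [OF B(1) _ H] C(3) by metis
  define h where "h = x + of_int g *\<^sub>R v"
  have H_subset: "H \<subseteq> S" if S: "add_subgroup S" "int_span C \<subseteq> S" "h \<in> S" for S
  proof
    fix z assume "z \<in> H"
    then obtain k where "z - of_int k *\<^sub>R h \<in> S" using decompose S(2) unfolding h_def by blast
    then have "(z - of_int k *\<^sub>R h) + of_int k *\<^sub>R h \<in> S" by (intro add_subgroup_add add_subgroup_scale_int S)
    then show "z \<in> S" by simp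
  qed
  show thesis
  proof (cases "g = 0")
    case True
    then have "h \<in> int_span C" using x C(3) by (auto simp: h_def)
    then have "H \<subseteq> int_span C" by (intro H_subset add_subgroup_int_span) auto
    then show thesis using C by (intro that [of C]) auto
  next
    case False
    have "int_span C \<subseteq> span B" using C(3) int_span_subset_span by blast
    then have "span C \<subseteq> span B"
      using int_span_base [OF C(1)] by (intro span_minimal subspace_span) auto
    moreover have "x \<in> span B" using x(1) int_span_subset_span by blast
    then have "h \<notin> span B" using False B(2) by (simp add: h_def span_add_eq span_scaleR_iff)
    ultimately have h: "independent (insert h C)" using C(2) span_base by (auto simp: independent_insert)
    have base: "insert h C \<subseteq> int_span (insert h C)" using C(1) int_span_base by blast
    have "H \<subseteq> int_span (insert h C)"
      using base by (intro H_subset add_subgroup_int_span int_span_minimal) auto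
    moreover have "int_span (insert h C) \<subseteq> H"
      using C x(2) int_span_base [OF C(1)] by (intro int_span_minimal [OF H(1)]) (auto simp: h_def)
    ultimately show thesis using C(1) h by (intro that [of "insert h C"]) auto
  qed
qed

theorem subgroup_of_lattice_has_basis:
  assumes "finite B" "independent B" "add_subgroup H" "H \<subseteq> int_span B"
  obtains C where "finite C" "independent C" "H = int_span C"
proof -
  have "\<exists>C. finite C \<and> independent C \<and> H = int_span C"
    using assms
  proof (induction B arbitrary: H rule: finite_induct)
    case empty
    then have "H = int_span {}" using add_subgroup_zero by (auto simp: int_span_def)
    then show ?case using independent_empty by blast
  next
    case (insert v B)
    have B: "independent B" "v \<notin> span B"
      using insert.prems(1) insert.hyps by (auto simp: independent_insert)
    have "add_subgroup (H \<inter> int_span B)"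
      using insert.prems(2) add_subgroup_int_span by (rule add_subgroup_Int)
    then obtain C where "finite C" "independent C" "H \<inter> int_span B = int_span C"
      using insert.IH [OF B(1)] by auto
    then show ?case
      using int_span_extend_subgroup [OF insert.hyps(1) B(2) _ _ _ insert.prems(2,3)] by metis
  qed
  then show thesis using that by blast
qed

section \<open>Poisson summation over lattices\<close>

lemma summable_on_prod_bounded_fibres:
  fixes f :: "'a \<Rightarrow> real" and g :: "'a \<Rightarrow> 'b \<Rightarrow> real"
  assumes "f summable_on A" "\<And>x. x \<in> A \<Longrightarrow> g x summable_on B" "\<And>x. x \<in> A \<Longrightarrow> infsum (g x) B \<le> K"
    and nonneg: "\<And>x. x \<in> A \<Longrightarrow> f x \<ge> 0" "\<And>x y. x \<in> A \<Longrightarrow> y \<in> B \<Longrightarrow> g x y \<ge> 0"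
  shows "(\<lambda>(x, y). f x * g x y) summable_on A \<times> B"
proof (rule summable_on_SigmaI)
  show "((\<lambda>y. case (x, y) of (x, y) \<Rightarrow> f x * g x y) has_sum f x * infsum (g x) B) B" if "x \<in> A" for x
    unfolding prod.case by (intro has_sum_cmult_right has_sum_infsum assms that)
  show "(\<lambda>x. f x * infsum (g x) B) summable_on A"
  proof (rule summable_on_comparison_test)
    show "(\<lambda>x. f x * K) summable_on A" using assms(1) by (rule summable_on_cmult_left)
  qed (auto intro!: mult_left_mono mult_nonneg_nonneg infsum_nonneg assms)
qed (use nonneg in auto)

definition int_dual :: "'a::real_inner set \<Rightarrow> 'a set" where
  "int_dual B = {y \<in> span B. \<forall>x\<in>B. x \<bullet> y \<in> \<int>}"

locale gaussian_poisson =
  fixes B :: "'a::euclidean_space set" and C :: real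
  assumes finite_basis: "finite B"
    and summable_gauss: "\<And>t a. t > 0 \<Longrightarrow> a \<in> span B \<Longrightarrow> (\<lambda>x. gauss t (x + a)) summable_on int_span B"
    and summable_gauss_dual: "\<And>t. t > 0 \<Longrightarrow> gauss t summable_on int_dual B"
    and poisson: "\<And>t a. t > 0 \<Longrightarrow> a \<in> span B \<Longrightarrow> (\<Sum>\<^sub>\<infinity>x\<in>int_span B. complex_of_real (gauss t (x + a))) =
      of_real (C * (1 / sqrt t) ^ card B) *
        (\<Sum>\<^sub>\<infinity>y\<in>int_dual B. of_real (gauss (1 / t) y) * cis (2 * pi * (y \<bullet> a)))"
begin

lemma infsum_gauss_bounded:
  assumes "t > 0" obtains K where "\<And>a. a \<in> span B \<Longrightarrow> (\<Sum>\<^sub>\<infinity>x\<in>int_span B. gauss t (x + a)) \<le> K"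
proof
  show "(\<Sum>\<^sub>\<infinity>x\<in>int_span B. gauss t (x + a)) \<le>
      norm (complex_of_real (C * (1 / sqrt t) ^ card B)) *
        (\<Sum>\<^sub>\<infinity>y\<in>int_dual B. gauss (1 / t) y)" if "a \<in> span B" for a
    using assms that poisson [OF assms that]
    by (intro infsum_le_norm_infsum [where g = "\<lambda>y. of_real (gauss (1 / t) y) * cis (2 * pi * (y \<bullet> a))"]
        summable_gauss summable_gauss_dual) auto
qed

end

text \<open>Adjoining a basis vector \<open>v\<close> with component \<open>u\<close> orthogonal to the span of \<open>B\<close> splits both Gaussian sums
  into a sum over \<open>B\<close> and a one-dimensional sum in the direction of \<open>u\<close>.\<close>

locale gaussian_poisson_step = gaussian_poisson +
  fixes v p u
  assumes v: "v = p + u" and p: "p \<in> span B" and orthogonal: "\<And>x. x \<in> span B \<Longrightarrow> x \<bullet> u = 0" and u: "u \<noteq> 0"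
begin

lemma inner_u_pos: "u \<bullet> u > 0"
  using u by simp

lemma inner_v_u: "v \<bullet> u = u \<bullet> u"
  using orthogonal [OF p] by (simp add: v inner_add_left)

lemma v_notin_span: "v \<notin> span B"
  using orthogonal [of v] inner_v_u u by auto

definition slice_shift :: "'a \<Rightarrow> real \<Rightarrow> int \<Rightarrow> 'a" where
  "slice_shift a \<alpha> m = (a - \<alpha> *\<^sub>R v) + (\<alpha> + of_int m) *\<^sub>R p"

lemma slice_shift_in_span: "a - \<alpha> *\<^sub>R v \<in> span B \<Longrightarrow> slice_shift a \<alpha> m \<in> span B"
  unfolding slice_shift_def by (intro span_add span_scale p)

lemma gauss_slice:
  assumes "x \<in> int_span B" "a - \<alpha> *\<^sub>R v \<in> span B"
  shows "gauss t ((x + of_int m *\<^sub>R v) + a) =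
      gauss (t * (u \<bullet> u)) (\<alpha> + of_int m) * gauss t (x + slice_shift a \<alpha> m)"
proof -
  have "(x + of_int m *\<^sub>R v) + a = (x + slice_shift a \<alpha> m) + (\<alpha> + of_int m) *\<^sub>R u"
    unfolding slice_shift_def by (simp add: v algebra_simps)
  moreover have "x + slice_shift a \<alpha> m \<in> span B"
    using assms int_span_subset_span slice_shift_in_span by (blast intro: span_add)
  ultimately show ?thesis by (simp only: gauss_add_orthogonal [OF orthogonal] mult.commute)
qed

lemma bij_betw_int_span_step:
  "bij_betw (\<lambda>(m::int, x). x + of_int m *\<^sub>R v) (UNIV \<times> int_span B) (int_span (insert v B))"
  by (rule bij_betw_int_span_insert [OF finite_basis v_notin_span])

lemma summable_gauss_slices:
  assumes t: "t > 0" and a: "a - \<alpha> *\<^sub>R v \<in> span B"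
  shows "(\<lambda>(m::int, x). gauss t ((x + of_int m *\<^sub>R v) + a)) summable_on UNIV \<times> int_span B"
proof -
  obtain K where K: "\<And>a. a \<in> span B \<Longrightarrow> (\<Sum>\<^sub>\<infinity>x\<in>int_span B. gauss t (x + a)) \<le> K"
    by (rule infsum_gauss_bounded [OF t]) (rule that)
  have "(\<lambda>(m::int, x). gauss (t * (u \<bullet> u)) (\<alpha> + of_int m) * gauss t (x + slice_shift a \<alpha> m)) summable_on
      UNIV \<times> int_span B"
    using t inner_u_pos
    by (intro summable_on_prod_bounded_fibres [where K = K] summable_on_gauss_int
      summable_gauss K slice_shift_in_span a) auto
  then show ?thesis
    by (rule summable_on_cong [THEN iffD1, rotated]) (auto simp: gauss_slice [OF _ a])
qed

lemma infsum_gauss_slices: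
  assumes t: "t > 0" and a: "a - \<alpha> *\<^sub>R v \<in> span B"
  shows "(\<Sum>\<^sub>\<infinity>x\<in>int_span (insert v B). complex_of_real (gauss t (x + a))) =
    (\<Sum>\<^sub>\<infinity>m::int. of_real (gauss (t * (u \<bullet> u)) (\<alpha> + of_int m)) *
      (\<Sum>\<^sub>\<infinity>x\<in>int_span B. complex_of_real (gauss t (x + slice_shift a \<alpha> m))))"
proof -
  have "(\<Sum>\<^sub>\<infinity>x\<in>int_span (insert v B). complex_of_real (gauss t (x + a))) =
      (\<Sum>\<^sub>\<infinity>(m::int, x)\<in>UNIV \<times> int_span B. complex_of_real (gauss t ((x + of_int m *\<^sub>R v) + a)))"
    by (subst infsum_reindex_bij_betw [OF bij_betw_int_span_step, symmetric]) (simp only: case_prod_unfold)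
  also have "\<dots> = (\<Sum>\<^sub>\<infinity>m::int. \<Sum>\<^sub>\<infinity>x\<in>int_span B. complex_of_real (gauss t ((x + of_int m *\<^sub>R v) + a)))"
    using summable_on_of_real [OF summable_gauss_slices [OF t a]]
    by (intro infsum_Sigma'_banach [symmetric]) (simp only: case_prod_unfold)
  also have "\<dots> = (\<Sum>\<^sub>\<infinity>m::int. of_real (gauss (t * (u \<bullet> u)) (\<alpha> + of_int m)) *
      (\<Sum>\<^sub>\<infinity>x\<in>int_span B. complex_of_real (gauss t (x + slice_shift a \<alpha> m))))"
    by (simp add: gauss_slice [OF _ a] infsum_cmult_right' cong: infsum_cong)
  finally show ?thesis .
qed

definition dual_lift :: "'a \<Rightarrow> int \<Rightarrow> 'a" where
  "dual_lift y k = y + ((of_int k - y \<bullet> v) / (u \<bullet> u)) *\<^sub>R u"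

lemma inner_dual_lift:
  assumes "y \<in> span B"
  shows "x \<in> span B \<Longrightarrow> x \<bullet> dual_lift y k = x \<bullet> y" "v \<bullet> dual_lift y k = of_int k"
    "dual_lift y k \<bullet> u = of_int k - y \<bullet> v"
  using u orthogonal [OF assms]
  by (simp_all add: dual_lift_def inner_add_left inner_add_right inner_v_u orthogonal inner_commute [of v y])

lemma bij_betw_dual_lift: "bij_betw (\<lambda>(y, k). dual_lift y k) (int_dual B \<times> UNIV) (int_dual (insert v B))"
proof (rule bij_betwI [where g = "\<lambda>z. (z - ((z \<bullet> u) / (u \<bullet> u)) *\<^sub>R u, \<lfloor>v \<bullet> z\<rfloor>)"])
  show "(\<lambda>(y, k). dual_lift y k) \<in> int_dual B \<times> UNIV \<rightarrow> int_dual (insert v B)"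
  proof clarify
    fix y k assume y: "y \<in> int_dual B"
    then have yB: "y \<in> span B" by (simp add: int_dual_def)
    have span_insert: "span B \<subseteq> span (insert v B)" by (intro span_mono) auto
    then have "v - p \<in> span (insert v B)" using p by (intro span_diff) (auto intro: span_base)
    then have "dual_lift y k \<in> span (insert v B)"
      using yB span_insert unfolding dual_lift_def by (auto simp: v intro!: span_add span_scale)
    moreover have "x \<bullet> dual_lift y k \<in> \<int>" if "x \<in> B" for x
      using that y inner_dual_lift(1) [OF yB span_base [OF that]] by (simp add: int_dual_def)
    ultimately show "dual_lift y k \<in> int_dual (insert v B)"
      using inner_dual_lift(2) [OF yB] by (simp add: int_dual_def)
  qed
  show "(\<lambda>z. (z - ((z \<bullet> u) / (u \<bullet> u)) *\<^sub>R u, \<lfloor>v \<bullet> z\<rfloor>)) \<in> int_dual (insert v B) \<rightarrow> int_dual B \<times> UNIV"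
  proof
    fix z assume z: "z \<in> int_dual (insert v B)"
    then obtain c where c: "z - c *\<^sub>R v \<in> span B" by (auto simp: int_dual_def span_breakdown_eq)
    have "(z \<bullet> u) / (u \<bullet> u) = c" using orthogonal [OF c] u by (simp add: inner_diff_left inner_v_u)
    then have "z - ((z \<bullet> u) / (u \<bullet> u)) *\<^sub>R u = (z - c *\<^sub>R v) + c *\<^sub>R p" by (simp add: v algebra_simps)
    then have "z - ((z \<bullet> u) / (u \<bullet> u)) *\<^sub>R u \<in> span B" using span_add [OF c span_scale [OF p]] by (simp only:)
    then show "(z - ((z \<bullet> u) / (u \<bullet> u)) *\<^sub>R u, \<lfloor>v \<bullet> z\<rfloor>) \<in> int_dual B \<times> UNIV"
      using z orthogonal [OF span_base] by (simp add: int_dual_def inner_diff_right)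
  qed
  show "(\<lambda>z. (z - ((z \<bullet> u) / (u \<bullet> u)) *\<^sub>R u, \<lfloor>v \<bullet> z\<rfloor>)) ((\<lambda>(y, k). dual_lift y k) yk) = yk"
    if "yk \<in> int_dual B \<times> UNIV" for yk
    using that inner_dual_lift(2,3) by (auto simp: int_dual_def) (simp add: dual_lift_def)
  show "(\<lambda>(y, k). dual_lift y k) ((\<lambda>z. (z - ((z \<bullet> u) / (u \<bullet> u)) *\<^sub>R u, \<lfloor>v \<bullet> z\<rfloor>)) z) = z"
    if "z \<in> int_dual (insert v B)" for z
  proof -
    have floor: "of_int \<lfloor>v \<bullet> z\<rfloor> = v \<bullet> z" using that by (simp add: int_dual_def)
    have diff: "v \<bullet> z - (z - ((z \<bullet> u) / (u \<bullet> u)) *\<^sub>R u) \<bullet> v = z \<bullet> u"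
      using u by (simp add: inner_commute [of _ v] inner_diff_right inner_v_u)
    show ?thesis by (simp only: prod.case dual_lift_def floor diff) simp
  qed
qed

lemma gauss_dual_lift:
  assumes "y \<in> span B"
  shows "gauss t (dual_lift y k) = gauss t y * gauss (t / (u \<bullet> u)) (of_int k - y \<bullet> v)"
proof -
  have "gauss (t * (u \<bullet> u)) ((of_int k - y \<bullet> v) / (u \<bullet> u)) = gauss (t / (u \<bullet> u)) (of_int k - y \<bullet> v)"
    using u by (simp add: gauss_def)
  then show ?thesis by (simp add: dual_lift_def gauss_add_orthogonal [OF orthogonal [OF assms]])
qed

lemma summable_gauss_dual_lift:
  assumes "t > 0" shows "(\<lambda>(y, k). gauss t (dual_lift y k)) summable_on int_dual B \<times> UNIV"
proof -
  have t: "t / (u \<bullet> u) > 0" using assms inner_u_pos by simp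
  obtain K where K: "\<And>x :: real. (\<Sum>\<^sub>\<infinity>m::int. gauss (t / (u \<bullet> u)) (x + of_int m)) \<le> K"
    by (rule infsum_gauss_int_bounded [OF t]) (rule that)
  have "(\<lambda>(y, k::int). gauss t y * gauss (t / (u \<bullet> u)) (- (y \<bullet> v) + of_int k)) summable_on int_dual B \<times> UNIV"
    by (intro summable_on_prod_bounded_fibres [where K = K]
      summable_on_gauss_int summable_gauss_dual K t assms) auto
  then show ?thesis
    by (rule summable_on_cong [THEN iffD1, rotated]) (auto simp: gauss_dual_lift int_dual_def)
qed

lemma poisson_u_direction:
  assumes t: "t > 0" and y: "y \<in> span B" and a: "a - \<alpha> *\<^sub>R v \<in> span B"
  shows "(\<Sum>\<^sub>\<infinity>m::int. of_real (gauss (t * (u \<bullet> u)) (\<alpha> + of_int m) * gauss (1 / t) y) *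
      cis (2 * pi * (y \<bullet> slice_shift a \<alpha> m))) =
    of_real (1 / sqrt (t * (u \<bullet> u))) *
      (\<Sum>\<^sub>\<infinity>k. of_real (gauss (1 / t) (dual_lift y k)) * cis (2 * pi * (dual_lift y k \<bullet> a)))"
proof -
  define w where "w = of_real (gauss (1 / t) y) * cis (2 * pi * (y \<bullet> a))"
  have "y \<bullet> slice_shift a \<alpha> m = y \<bullet> a + (y \<bullet> v) * of_int m" for m
    using orthogonal [OF y] unfolding slice_shift_def
    by (simp add: v inner_add_right inner_diff_right algebra_simps)
  then have primal_term: "of_real (gauss (t * (u \<bullet> u)) (\<alpha> + of_int m) * gauss (1 / t) y) *
      cis (2 * pi * (y \<bullet> slice_shift a \<alpha> m)) =
      w * (of_real (gauss (t * (u \<bullet> u)) (\<alpha> + of_int m)) * cis (2 * pi * (y \<bullet> v) * of_int m))" for m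
    by (simp add: w_def distrib_left mult.assoc flip: cis_mult)
  have dual_term: "of_real (gauss (1 / t) (dual_lift y k)) * cis (2 * pi * (dual_lift y k \<bullet> a)) =
      w * (of_real (gauss (1 / (t * (u \<bullet> u))) (of_int k - y \<bullet> v)) *
        cis (2 * pi * \<alpha> * (of_int k - y \<bullet> v)))" for k
  proof -
    have "u \<bullet> a = \<alpha> * (u \<bullet> u)"
      using orthogonal [OF a] by (simp add: inner_diff_left inner_v_u inner_commute [of u a])
    then have "dual_lift y k \<bullet> a = y \<bullet> a + \<alpha> * (of_int k - y \<bullet> v)"
      using u by (simp add: dual_lift_def inner_add_left)
    then show ?thesis
      by (simp add: w_def gauss_dual_lift [OF y] distrib_left mult.assoc flip: cis_mult)
  qed
  have "t * (u \<bullet> u) > 0" using t inner_u_pos by simp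
  then show ?thesis
    unfolding primal_term dual_term infsum_cmult_right' by (simp only: poisson_gauss_int mult.left_commute)
qed

lemma poisson_step:
  assumes t: "t > 0" and a: "a - \<alpha> *\<^sub>R v \<in> span B"
  shows "(\<Sum>\<^sub>\<infinity>x\<in>int_span (insert v B). complex_of_real (gauss t (x + a))) =
    of_real (C * (1 / sqrt t) ^ card B) * (of_real (1 / sqrt (t * (u \<bullet> u))) *
      (\<Sum>\<^sub>\<infinity>y\<in>int_dual (insert v B). of_real (gauss (1 / t) y) * cis (2 * pi * (y \<bullet> a))))"
proof -
  let ?const = "complex_of_real (C * (1 / sqrt t) ^ card B)"
  let ?dual_term = "\<lambda>y. of_real (gauss (1 / t) y) * cis (2 * pi * (y \<bullet> a))"
  define E where "E m = gauss (t * (u \<bullet> u)) (\<alpha> + of_int m)" for m :: int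
  define H where "H m y = of_real (E m * gauss (1 / t) y) * cis (2 * pi * (y \<bullet> slice_shift a \<alpha> m))" for m y
  have summable_H: "(\<lambda>(m, y). H m y) summable_on UNIV \<times> int_dual B"
  proof (rule summable_on_norm_le)
    show "(\<lambda>(m, y). E m * gauss (1 / t) y) summable_on UNIV \<times> int_dual B"
      using t inner_u_pos unfolding E_def
      by (intro summable_on_prod_bounded_fibres [OF summable_on_gauss_int summable_gauss_dual order_refl])
        auto
  qed (auto simp: H_def E_def norm_mult)
  have summable_dual_terms: "(\<lambda>(y, k). ?dual_term (dual_lift y k)) summable_on int_dual B \<times> UNIV"
    using t by (intro summable_on_norm_le [OF summable_gauss_dual_lift [of "1 / t"]]) auto
  have "(\<Sum>\<^sub>\<infinity>x\<in>int_span (insert v B). complex_of_real (gauss t (x + a))) =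
      (\<Sum>\<^sub>\<infinity>m. of_real (E m) * (\<Sum>\<^sub>\<infinity>x\<in>int_span B. complex_of_real (gauss t (x + slice_shift a \<alpha> m))))"
    unfolding E_def by (rule infsum_gauss_slices [OF t a])
  also have "\<dots> = (\<Sum>\<^sub>\<infinity>m. ?const * (\<Sum>\<^sub>\<infinity>y\<in>int_dual B. H m y))"
    by (simp add: poisson [OF t slice_shift_in_span [OF a]] H_def
      mult.assoc mult.left_commute infsum_cmult_right')
  also have "\<dots> = ?const * (\<Sum>\<^sub>\<infinity>y\<in>int_dual B. \<Sum>\<^sub>\<infinity>m. H m y)"
    by (simp only: infsum_cmult_right' infsum_swap_banach [OF summable_H])
  also have "(\<Sum>\<^sub>\<infinity>y\<in>int_dual B. \<Sum>\<^sub>\<infinity>m. H m y) =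
      (\<Sum>\<^sub>\<infinity>y\<in>int_dual B. of_real (1 / sqrt (t * (u \<bullet> u))) * (\<Sum>\<^sub>\<infinity>k. ?dual_term (dual_lift y k)))"
    unfolding H_def E_def by (intro infsum_cong poisson_u_direction t a) (simp add: int_dual_def)
  also have "\<dots> = of_real (1 / sqrt (t * (u \<bullet> u))) * (\<Sum>\<^sub>\<infinity>(y, k)\<in>int_dual B \<times> UNIV. ?dual_term (dual_lift y k))"
    by (simp only: infsum_cmult_right' infsum_Sigma'_banach [OF summable_dual_terms])
  also have "(\<Sum>\<^sub>\<infinity>(y, k)\<in>int_dual B \<times> UNIV. ?dual_term (dual_lift y k)) =
      (\<Sum>\<^sub>\<infinity>y\<in>int_dual (insert v B). ?dual_term y)"
    by (subst infsum_reindex_bij_betw [OF bij_betw_dual_lift, symmetric]) (simp only: case_prod_unfold)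
  finally show ?thesis .
qed

lemma gaussian_poisson_insert: "gaussian_poisson (insert v B) (C / norm u)"
proof
  show "finite (insert v B)" using finite_basis by simp
  show "gauss t summable_on int_dual (insert v B)" if "t > 0" for t
    using summable_gauss_dual_lift [OF that]
    by (subst summable_on_reindex_bij_betw [OF bij_betw_dual_lift, symmetric]) (simp only: case_prod_unfold)
  fix t :: real and a assume t: "t > 0" and "a \<in> span (insert v B)"
  then obtain \<alpha> where a: "a - \<alpha> *\<^sub>R v \<in> span B" by (auto simp: span_breakdown_eq)
  show "(\<lambda>x. gauss t (x + a)) summable_on int_span (insert v B)"
    using summable_gauss_slices [OF t a]
    by (subst summable_on_reindex_bij_betw [OF bij_betw_int_span_step, symmetric])
      (simp only: case_prod_unfold)
  have "v \<notin> B" using v_notin_span span_base by blast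
  then have "C * (1 / sqrt t) ^ card B * (1 / sqrt (t * (u \<bullet> u))) =
      C / norm u * (1 / sqrt t) ^ card (insert v B)"
    using finite_basis by (simp add: real_sqrt_mult norm_eq_sqrt_inner)
  then show "(\<Sum>\<^sub>\<infinity>x\<in>int_span (insert v B). complex_of_real (gauss t (x + a))) =
      of_real (C / norm u * (1 / sqrt t) ^ card (insert v B)) *
      (\<Sum>\<^sub>\<infinity>y\<in>int_dual (insert v B). of_real (gauss (1 / t) y) * cis (2 * pi * (y \<bullet> a)))"
    unfolding poisson_step [OF t a] by (simp only: mult.assoc [symmetric] of_real_mult [symmetric])
qed

end

lemma gaussian_poisson_empty: "gaussian_poisson {} 1"
  by unfold_locales (auto simp: int_span_def int_dual_def)

theorem gaussian_poisson_independent: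
  fixes B :: "'a::euclidean_space set"
  assumes "finite B" "independent B"
  obtains C where "gaussian_poisson B C"
proof -
  have "\<exists>C. gaussian_poisson B C"
    using assms
  proof (induction B rule: finite_induct)
    case empty
    then show ?case using gaussian_poisson_empty by blast
  next
    case (insert v B)
    then have "independent B" "v \<notin> span B" by (auto simp: independent_insert)
    then obtain C where "gaussian_poisson B C" using insert.IH by blast
    then interpret gaussian_poisson B C .
    obtain p u where "p \<in> span B" "\<And>x. x \<in> span B \<Longrightarrow> orthogonal u x" "v = p + u"
      by (rule orthogonal_subspace_decomp_exists [of B v]) (rule that)
    then interpret gaussian_poisson_step B C v p u
      using \<open>v \<notin> span B\<close> by unfold_locales (auto simp: orthogonal_def inner_commute)
    show ?case using gaussian_poisson_insert by blast
  qed
  then show thesis using that by blast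
qed

text \<open>Evaluating Poisson summation at \<open>t = 1\<close> and \<open>a = 0\<close> gives the value of the constant.\<close>

theorem poisson_unimodular:
  fixes B :: "'a::euclidean_space set"
  assumes B: "finite B" "independent B" "span B = UNIV" and dual: "int_dual B = int_span B" and t: "t > 0"
  shows "(\<lambda>x. gauss t (x + a)) summable_on int_span B"
    and "(\<Sum>\<^sub>\<infinity>x\<in>int_span B. complex_of_real (gauss t (x + a))) =
      of_real ((1 / sqrt t) ^ DIM('a)) * (\<Sum>\<^sub>\<infinity>y\<in>int_span B. of_real (gauss (1 / t) y) * cis (2 * pi * (y \<bullet> a)))"
proof -
  obtain C where "gaussian_poisson B C" using gaussian_poisson_independent [OF B(1,2)] .
  then interpret gaussian_poisson B C .
  show "(\<lambda>x. gauss t (x + a)) summable_on int_span B" using t by (intro summable_gauss) (simp_all add: B(3))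
  let ?\<theta> = "\<Sum>\<^sub>\<infinity>x\<in>int_span B. gauss 1 x"
  have summable: "gauss 1 summable_on int_span B" using summable_gauss [of 1 0] B(3) by simp
  have "complex_of_real ?\<theta> = of_real C * of_real ?\<theta>"
    using poisson [of 1 0] by (simp add: B(3) dual infsum_of_real [OF summable])
  then have "?\<theta> = C * ?\<theta>" by (simp only: of_real_mult [symmetric] of_real_eq_iff)
  moreover have "sum (gauss 1) {0 :: 'a} \<le> ?\<theta>"
    by (rule finite_sum_le_infsum [OF summable])
      (use add_subgroup_zero [OF add_subgroup_int_span, of B] in auto)
  then have "?\<theta> \<noteq> 0" by auto
  ultimately have "C = 1" by simp
  moreover have "card B = DIM('a)" using B by (simp add: dim_span_eq_card_independent [symmetric])
  ultimately show "(\<Sum>\<^sub>\<infinity>x\<in>int_span B. complex_of_real (gauss t (x + a))) =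
      of_real ((1 / sqrt t) ^ DIM('a)) * (\<Sum>\<^sub>\<infinity>y\<in>int_span B. of_real (gauss (1 / t) y) * cis (2 * pi * (y \<bullet> a)))"
    using poisson [OF t, of a] by (simp add: B(3) dual)
qed

section \<open>Cusp forms of weight 14\<close>

definition nome :: "complex \<Rightarrow> complex" where
  "nome \<tau> = exp (pi * \<i> * \<tau>)"

lemma norm_nome [simp]: "norm (nome \<tau>) = exp (- pi * Im \<tau>)"
  by (simp add: nome_def norm_exp_eq_Re)

lemma norm_nome_squared: "norm (nome \<tau>) ^ 2 = exp (- 2 * pi * Im \<tau>)"
  unfolding norm_nome by (simp add: exp_of_nat_mult [symmetric])

lemma nome_in_ball: "Im \<tau> > 0 \<Longrightarrow> nome \<tau> \<in> ball 0 1"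
  by simp

lemma nome_add_1: "nome (\<tau> + 1) = - nome \<tau>" and nome_diff_1: "nome (\<tau> - 1) = - nome \<tau>"
  by (simp_all add: nome_def algebra_simps exp_add exp_diff)

lemma Im_inversion: "Im (- 1 / \<tau>) = Im \<tau> / (norm \<tau>)\<^sup>2"
  by (simp add: Im_divide cmod_power2)

lemma Im_inversion_pos: "Im \<tau> > 0 \<Longrightarrow> Im (- 1 / \<tau>) > 0"
  unfolding Im_inversion by (auto intro!: divide_pos_pos)

lemma eventually_nhds_unit_ball: "eventually (\<lambda>z. z \<in> ball 0 1) (nhds (0::complex))"
  by (intro eventually_nhds_in_open) auto

lemma holomorphic_factor_zero:
  assumes "f holomorphic_on S" "open S" "a \<in> S" "f a = 0"
  obtains g where "g holomorphic_on S" "\<And>z. z \<in> S \<Longrightarrow> f z = (z - a) * g z"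
proof
  show "(\<lambda>z. if z = a then deriv f a else (f z - f a) / (z - a)) holomorphic_on S"
    using assms by (intro pole_lemma) (auto simp: interior_open)
qed (use assms in auto)

lemma holomorphic_even_factor_zero:
  assumes f: "f holomorphic_on ball 0 r" and even: "\<And>z. z \<in> ball 0 r \<Longrightarrow> f (- z) = f z"
    and a: "a \<in> ball 0 r" "f a = 0"
  obtains g where "g holomorphic_on ball 0 r" "\<And>z. g (- z) = g z" "\<And>z. z \<in> ball 0 r \<Longrightarrow> f z = (z\<^sup>2 - a\<^sup>2) * g z"
proof -
  have holomorphic_minus: "(\<lambda>z. h (- z)) holomorphic_on ball 0 r" if "h holomorphic_on ball 0 r" for h
    by (rule holomorphic_on_compose_gen [OF _ that, unfolded o_def]) (auto intro!: holomorphic_intros)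
  obtain f1 where f1: "f1 holomorphic_on ball 0 r" "\<And>z. z \<in> ball 0 r \<Longrightarrow> f z = (z - a) * f1 z"
    using holomorphic_factor_zero [OF f open_ball a] by auto
  obtain h where h: "h holomorphic_on ball 0 r" "h (- a) = 0" "\<And>z. z \<in> ball 0 r \<Longrightarrow> f z = (z - a) * h z"
  proof (cases "a = 0")
    case True
    have "f z = (z - a) * ((f1 z - f1 (- z)) / 2)" if "z \<in> ball 0 r" for z
      using f1(2) [OF that] f1(2) [of "- z"] even [OF that] that True by (simp add: algebra_simps)
    moreover have "(\<lambda>z. (f1 z - f1 (- z)) / 2) holomorphic_on ball 0 r"
      by (intro holomorphic_intros f1(1) holomorphic_minus) simp
    ultimately show thesis using True by (intro that [of "\<lambda>z. (f1 z - f1 (- z)) / 2"]) auto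
  next
    case False
    then have "f1 (- a) = 0" using f1(2) [of "- a"] even [OF a(1)] a by simp
    then show thesis using f1 by (intro that)
  qed
  obtain g where g: "g holomorphic_on ball 0 r" "\<And>z. z \<in> ball 0 r \<Longrightarrow> h z = (z - - a) * g z"
    using holomorphic_factor_zero [OF h(1) open_ball _ h(2)] a by auto
  have factored: "f z = (z\<^sup>2 - a\<^sup>2) * g z" if "z \<in> ball 0 r" for z
    using h(3) [OF that] g(2) [OF that] by (simp add: power2_eq_square algebra_simps)
  show thesis
  proof (rule that [of "\<lambda>z. (g z + g (- z)) / 2"])
    show "(\<lambda>z. (g z + g (- z)) / 2) holomorphic_on ball 0 r"
      by (intro holomorphic_intros g(1) holomorphic_minus) simp
    show "f z = (z\<^sup>2 - a\<^sup>2) * ((g z + g (- z)) / 2)" if "z \<in> ball 0 r" for z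
      using factored [OF that] factored [of "- z"] even [OF that] that by (simp add: distrib_left)
  qed (simp add: add.commute)
qed

lemma exp_1_ge: "(27 / 10 :: real) \<le> exp 1"
  using e_approx_32 by (simp add: abs_if split: if_splits)

lemma exp_minus_pi_le: "exp (- pi) \<le> 1 / 19"
proof -
  have "19 \<le> (27 / 10 :: real) ^ 3" by (simp add: power3_eq_cube)
  also have "\<dots> \<le> exp 1 ^ 3" using exp_1_ge by (intro power_mono) auto
  also have "\<dots> = exp (3::real)" by (simp add: exp_of_nat_mult [symmetric])
  also have "\<dots> \<le> exp pi" using pi_gt3 by simp
  finally show ?thesis by (simp add: exp_minus field_simps)
qed

lemma exp_times_power_7_le:
  fixes y :: real
  assumes "y \<ge> 1"
  shows "exp (- 2 * pi * y) * y ^ 7 \<le> 1 / 340"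
proof -
  have "1 + (2 * pi * y / 7 - 1) \<le> exp (2 * pi * y / 7 - 1)" by (rule exp_ge_add_one_self)
  then have tangent: "2 * pi * y / 7 * exp 1 \<le> exp (2 * pi * y / 7)"
    unfolding exp_diff by (simp add: field_simps)
  have "23 / 10 * y \<le> 2 * 3 * y / 7 * (27 / 10)" using assms by simp
  also have "\<dots> \<le> 2 * pi * y / 7 * exp 1"
    using assms pi_gt3 exp_1_ge by (intro mult_mono divide_right_mono) auto
  also note tangent
  finally have "(23 / 10 * y) ^ 7 \<le> exp (2 * pi * y / 7) ^ 7"
    using assms by (intro power_mono) auto
  also have "\<dots> = exp (2 * pi * y)" by (simp add: exp_of_nat_mult [symmetric])
  finally have "(23 / 10) ^ 7 * y ^ 7 \<le> exp (2 * pi * y)" by (simp only: power_mult_distrib)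
  moreover have "340 * y ^ 7 \<le> (23 / 10) ^ 7 * y ^ 7"
    using assms by (intro mult_right_mono) (auto simp: power_numeral_even power_numeral_odd field_simps)
  ultimately have "340 * y ^ 7 \<le> exp (2 * pi * y)" by (rule order_trans [rotated])
  then show ?thesis by (simp add: exp_minus field_simps)
qed

text \<open>A cusp form is given as a function \<open>\<Phi>\<close> of the nome; being even, \<open>\<Phi>\<close> is a function of \<open>q = w\<^sup>2\<close>.
  It vanishes at \<open>\<tau> = \<i>\<close>, so it is divisible by \<open>q (q - exp (- 2 \<pi>))\<close>. The maximum principle on
  \<open>\<bar>q\<bar> \<le> exp (- \<pi>)\<close>, whose boundary comes from the line \<open>Im \<tau> = 1/2\<close> that inversion and translation carry
  into \<open>Im \<tau> \<ge> 1\<close>, bounds the supremum of \<open>\<bar>\<Phi>\<bar> (Im \<tau>)\<^sup>7\<close> over \<open>Im \<tau> \<ge> 1\<close> by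
  \<open>256 / (340 (1 - exp (- \<pi>)))\<close> times itself.\<close>

locale weight14_cusp_form =
  fixes \<Phi> :: "complex \<Rightarrow> complex"
  assumes holomorphic: "\<Phi> holomorphic_on ball 0 1"
    and zero: "\<Phi> 0 = 0"
    and even: "\<And>w. w \<in> ball 0 1 \<Longrightarrow> \<Phi> (- w) = \<Phi> w"
    and inversion: "\<And>\<tau>. Im \<tau> > 0 \<Longrightarrow> \<Phi> (nome (- 1 / \<tau>)) = \<tau> ^ 14 * \<Phi> (nome \<tau>)"
begin

lemma zero_at_i: "\<Phi> (exp (- pi)) = 0"
proof -
  have "nome \<i> = complex_of_real (exp (- pi))"
    by (simp add: nome_def mult.assoc flip: exp_of_real)
  moreover have "- 1 / \<i> = \<i>" "\<i> ^ 14 = - 1"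
    by (simp_all add: complex_eq_iff power_numeral_even power_numeral_odd)
  ultimately show ?thesis using inversion [of \<i>] by (simp add: eq_neg_iff_add_eq_0)
qed

lemma factor_double_zero:
  obtains g where "g holomorphic_on ball 0 1" "\<And>z. g (- z) = g z" "\<And>z. z \<in> ball 0 1 \<Longrightarrow> \<Phi> z = z\<^sup>2 * g z"
  by (rule holomorphic_even_factor_zero [OF holomorphic even _ zero]) (use that in auto)

lemma factorization:
  obtains \<Psi> where "\<Psi> holomorphic_on ball 0 1"
    "\<And>z. z \<in> ball 0 1 \<Longrightarrow> \<Phi> z = z\<^sup>2 * (z\<^sup>2 - (of_real (exp (- pi)))\<^sup>2) * \<Psi> z"
proof -
  let ?\<kappa> = "complex_of_real (exp (- pi))"
  have \<kappa>: "?\<kappa> \<in> ball 0 1" "?\<kappa> \<noteq> 0" by simp_all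
  obtain g where g: "g holomorphic_on ball 0 1" "\<And>z. g (- z) = g z" "\<And>z. z \<in> ball 0 1 \<Longrightarrow> \<Phi> z = z\<^sup>2 * g z"
    by (rule factor_double_zero) (rule that)
  have "g ?\<kappa> = 0" using g(3) [OF \<kappa>(1)] zero_at_i \<kappa>(2) by simp
  then obtain \<Psi> where "\<Psi> holomorphic_on ball 0 1" "\<And>z. z \<in> ball 0 1 \<Longrightarrow> g z = (z\<^sup>2 - ?\<kappa>\<^sup>2) * \<Psi> z"
    using holomorphic_even_factor_zero [OF g(1,2) \<kappa>(1)] by metis
  then show thesis using g(3) by (intro that) (auto simp: mult.assoc)
qed

definition weighted_norm :: "complex \<Rightarrow> real" where
  "weighted_norm \<tau> = norm (\<Phi> (nome \<tau>)) * Im \<tau> ^ 7"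

definition weighted_sup :: real where
  "weighted_sup = (SUP \<tau>\<in>{\<tau>. Im \<tau> \<ge> 1}. weighted_norm \<tau>)"

lemma bdd_above_weighted_norm: "bdd_above (weighted_norm ` {\<tau>. Im \<tau> \<ge> 1})"
proof -
  obtain f where f: "f holomorphic_on ball 0 1" "\<And>z. z \<in> ball 0 1 \<Longrightarrow> \<Phi> z = z\<^sup>2 * f z"
    by (rule factor_double_zero) (rule that)
  have "cball 0 (exp (- pi)) \<subseteq> (ball 0 1 :: complex set)"
    by (intro cball_subset_ball_iff [THEN iffD2]) simp
  then have "compact (f ` cball 0 (exp (- pi)))"
    by (intro compact_continuous_image holomorphic_on_imp_continuous_on holomorphic_on_subset [OF f(1)]) auto
  then obtain K where K: "\<And>z. z \<in> cball 0 (exp (- pi)) \<Longrightarrow> norm (f z) \<le> K"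
    using compact_imp_bounded bounded_iff by (metis imageI)
  have "weighted_norm \<tau> \<le> (1 / 340) * K" if \<tau>: "Im \<tau> \<ge> 1" for \<tau>
  proof -
    have "weighted_norm \<tau> = (exp (- 2 * pi * Im \<tau>) * Im \<tau> ^ 7) * norm (f (nome \<tau>))"
      using f(2) [OF nome_in_ball] \<tau> unfolding weighted_norm_def norm_nome_squared [symmetric]
      by (simp add: norm_mult norm_power)
    also have "\<dots> \<le> (1 / 340) * K"
      using \<tau> by (intro mult_mono exp_times_power_7_le K) auto
    finally show ?thesis .
  qed
  then show ?thesis by (intro bdd_aboveI2 [where M = "(1 / 340) * K"]) auto
qed

lemma weighted_norm_le_sup: "Im \<tau> \<ge> 1 \<Longrightarrow> weighted_norm \<tau> \<le> weighted_sup"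
  unfolding weighted_sup_def by (intro cSUP_upper bdd_above_weighted_norm) simp

lemma weighted_sup_nonneg: "weighted_sup \<ge> 0"
  by (rule order_trans [OF _ weighted_norm_le_sup [of \<i>]]) (simp_all add: weighted_norm_def)

lemma norm_le_on_half_line:
  assumes "Im \<tau> = 1 / 2" "\<bar>Re \<tau>\<bar> \<le> 1 / 2"
  shows "norm (\<Phi> (nome \<tau>)) \<le> 128 * weighted_sup"
proof -
  have "\<tau> \<noteq> 0" using assms by auto
  have "(Re \<tau>)\<^sup>2 \<le> (1 / 2)\<^sup>2" using assms(2) by (simp add: abs_le_square_iff [symmetric])
  then have "(norm \<tau>)\<^sup>2 \<le> 1 / 2" unfolding cmod_power2 assms(1) by (simp add: power2_eq_square)
  then have "Im (- 1 / \<tau>) \<ge> 1"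
    unfolding Im_inversion assms(1) using \<open>\<tau> \<noteq> 0\<close> by (simp add: field_simps)
  then have "weighted_norm (- 1 / \<tau>) \<le> weighted_sup" by (rule weighted_norm_le_sup)
  moreover have "norm (\<Phi> (nome (- 1 / \<tau>))) = norm \<tau> ^ 14 * norm (\<Phi> (nome \<tau>))"
    using inversion [of \<tau>] assms(1) by (simp add: norm_mult norm_power)
  moreover have "norm \<tau> ^ 14 * norm (\<Phi> (nome \<tau>)) * (Im \<tau> / (norm \<tau>)\<^sup>2) ^ 7 = norm (\<Phi> (nome \<tau>)) / 128"
    unfolding assms(1) using \<open>\<tau> \<noteq> 0\<close> by (simp add: power_divide power_mult [symmetric])
  ultimately have "norm (\<Phi> (nome \<tau>)) / 128 \<le> weighted_sup"
    unfolding weighted_norm_def Im_inversion by (simp only:)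
  then show ?thesis by simp
qed

lemma norm_le_on_circle:
  assumes z: "norm z = exp (- pi / 2)"
  shows "norm (\<Phi> z) \<le> 128 * weighted_sup"
proof -
  have "z \<noteq> 0" using z by auto
  define \<tau> where "\<tau> = Ln z / (pi * \<i>)"
  have nome: "nome \<tau> = z" using \<open>z \<noteq> 0\<close> by (simp add: \<tau>_def nome_def)
  have Re: "Re \<tau> = Im (Ln z) / pi" and Im: "Im \<tau> = 1 / 2"
    using \<open>z \<noteq> 0\<close> z by (simp_all add: \<tau>_def Re_divide Im_divide power2_eq_square)
  have "\<bar>Re \<tau>\<bar> \<le> 1"
    using Im_Ln_le_pi [OF \<open>z \<noteq> 0\<close>] mpi_less_Im_Ln [OF \<open>z \<noteq> 0\<close>]
    unfolding Re by (simp add: abs_le_iff field_simps)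
  then have "\<bar>Re \<tau>\<bar> \<le> 1 / 2 \<or> \<bar>Re (\<tau> - 1)\<bar> \<le> 1 / 2 \<or> \<bar>Re (\<tau> + 1)\<bar> \<le> 1 / 2"
    by (simp add: abs_if split: if_splits; arith)
  moreover have "Im (\<tau> - 1) = 1 / 2" "Im (\<tau> + 1) = 1 / 2" using Im by simp_all
  moreover have "\<Phi> (nome (\<tau> - 1)) = \<Phi> z" "\<Phi> (nome (\<tau> + 1)) = \<Phi> z"
    using even [of z] z by (simp_all add: nome nome_add_1 nome_diff_1)
  ultimately show ?thesis using norm_le_on_half_line Im nome by metis
qed

lemma norm_quotient_le:
  assumes \<Psi>: "\<Psi> holomorphic_on ball 0 1"
    and factor: "\<And>z. z \<in> ball 0 1 \<Longrightarrow> \<Phi> z = z\<^sup>2 * (z\<^sup>2 - (of_real \<kappa>)\<^sup>2) * \<Psi> z" and \<kappa>: "\<kappa> = exp (- pi)"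
    and z: "norm z \<le> exp (- pi / 2)"
  shows "norm (\<Psi> z) \<le> 128 * weighted_sup / (\<kappa> * (\<kappa> - \<kappa>\<^sup>2))"
proof (rule maximum_modulus_frontier [where f = \<Psi> and \<xi> = z and S = "cball 0 (exp (- pi / 2))"])
  have "cball 0 (exp (- pi / 2)) \<subseteq> (ball 0 1 :: complex set)"
    by (intro cball_subset_ball_iff [THEN iffD2]) simp
  then have "\<Psi> holomorphic_on cball 0 (exp (- pi / 2))" by (rule holomorphic_on_subset [OF \<Psi>])
  then show "\<Psi> holomorphic_on interior (cball 0 (exp (- pi / 2)))"
    "continuous_on (closure (cball 0 (exp (- pi / 2)))) \<Psi>"
    using interior_subset holomorphic_on_subset by (auto intro: holomorphic_on_imp_continuous_on)
  fix z :: complex assume "z \<in> frontier (cball 0 (exp (- pi / 2)))"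
  then have norm_z: "norm z = exp (- pi / 2)" by simp
  have norm_z_squared: "norm (z\<^sup>2) = \<kappa>" by (simp add: norm_power norm_z \<kappa> exp_of_nat_mult [symmetric])
  have \<kappa>_pos: "0 < \<kappa>" "\<kappa> < 1" by (simp_all add: \<kappa>)
  have "\<kappa> - \<kappa>\<^sup>2 \<le> norm (z\<^sup>2 - (of_real \<kappa>)\<^sup>2)"
    using norm_triangle_ineq2 [of "z\<^sup>2" "(of_real \<kappa>)\<^sup>2"] norm_z_squared by (simp add: norm_power)
  then have "\<kappa> * (\<kappa> - \<kappa>\<^sup>2) * norm (\<Psi> z) \<le> norm (z\<^sup>2) * norm (z\<^sup>2 - (of_real \<kappa>)\<^sup>2) * norm (\<Psi> z)"
    unfolding norm_z_squared using \<kappa>_pos by (intro mult_right_mono mult_left_mono) auto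
  also have "\<dots> = norm (\<Phi> z)" using factor [of z] norm_z by (simp add: norm_mult)
  also have "\<dots> \<le> 128 * weighted_sup" by (rule norm_le_on_circle [OF norm_z])
  finally show "norm (\<Psi> z) \<le> 128 * weighted_sup / (\<kappa> * (\<kappa> - \<kappa>\<^sup>2))"
    using \<kappa>_pos by (simp add: pos_le_divide_eq mult.commute power2_eq_square)
qed (use z in auto)

lemma weighted_norm_contraction:
  assumes \<tau>: "Im \<tau> \<ge> 1" shows "weighted_norm \<tau> \<le> 9 / 10 * weighted_sup"
proof -
  obtain \<Psi> \<kappa> where \<kappa>_def: "\<kappa> = exp (- pi)" and \<Psi>: "\<Psi> holomorphic_on ball 0 1"
    "\<And>z. z \<in> ball 0 1 \<Longrightarrow> \<Phi> z = z\<^sup>2 * (z\<^sup>2 - (of_real \<kappa>)\<^sup>2) * \<Psi> z"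
    by (rule factorization) (rule that [OF refl])
  have \<kappa>: "0 < \<kappa>" "\<kappa> < 1" "\<kappa> \<le> 1 / 19" using exp_minus_pi_le by (simp_all add: \<kappa>_def)
  have small: "norm (nome \<tau>) \<le> \<kappa>" using \<tau> by (simp add: \<kappa>_def)
  have "norm (nome \<tau>) \<le> exp (- pi / 2)" by (rule order_trans [OF small]) (simp add: \<kappa>_def)
  then have quotient: "norm (\<Psi> (nome \<tau>)) \<le> 128 * weighted_sup / (\<kappa> * (\<kappa> - \<kappa>\<^sup>2))"
    by (intro norm_quotient_le \<Psi> \<kappa>_def)
  have "norm ((nome \<tau>)\<^sup>2) \<le> \<kappa>\<^sup>2" unfolding norm_power using small by (intro power_mono) auto
  then have distance: "norm ((nome \<tau>)\<^sup>2 - (of_real \<kappa>)\<^sup>2) \<le> 2 * \<kappa>\<^sup>2"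
    using norm_triangle_ineq4 [of "(nome \<tau>)\<^sup>2" "(of_real \<kappa>)\<^sup>2"] by (simp add: norm_power)
  have "weighted_norm \<tau> = (exp (- 2 * pi * Im \<tau>) * Im \<tau> ^ 7) *
      (norm ((nome \<tau>)\<^sup>2 - (of_real \<kappa>)\<^sup>2) * norm (\<Psi> (nome \<tau>)))"
    using \<Psi>(2) [OF nome_in_ball] \<tau> unfolding weighted_norm_def norm_nome_squared [symmetric]
    by (simp only: norm_mult norm_power mult_ac)
  also have "\<dots> \<le> (1 / 340) * ((2 * \<kappa>\<^sup>2) * (128 * weighted_sup / (\<kappa> * (\<kappa> - \<kappa>\<^sup>2))))"
    using \<tau> \<kappa> weighted_sup_nonneg by (intro mult_mono exp_times_power_7_le distance quotient) auto
  also have "\<dots> = 256 / 340 * weighted_sup / (1 - \<kappa>)"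
    using \<kappa> by (simp add: field_simps power2_eq_square)
  also have "\<dots> \<le> 256 / 340 * weighted_sup / (1 - 1 / 19)"
    using \<kappa> weighted_sup_nonneg by (intro divide_left_mono) auto
  also have "\<dots> \<le> 9 / 10 * weighted_sup" using weighted_sup_nonneg by simp
  finally show ?thesis .
qed

lemma weighted_sup_eq_0: "weighted_sup = 0"
proof -
  have "\<i> \<in> {\<tau>. Im \<tau> \<ge> 1}" by simp
  then have "weighted_sup \<le> 9 / 10 * weighted_sup"
    using cSUP_least [of "{\<tau>. Im \<tau> \<ge> 1}" weighted_norm] weighted_norm_contraction
    by (metis (mono_tags, lifting) empty_iff mem_Collect_eq weighted_sup_def)
  then show ?thesis using weighted_sup_nonneg by simp
qed

theorem eq_0: "w \<in> ball 0 1 \<Longrightarrow> \<Phi> w = 0"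
proof (rule analytic_continuation_open [of "ball 0 (exp (- pi / 2))" "ball 0 1" \<Phi> "\<lambda>_. 0"])
  obtain \<Psi> where \<Psi>: "\<Psi> holomorphic_on ball 0 1"
    "\<And>z. z \<in> ball 0 1 \<Longrightarrow> \<Phi> z = z\<^sup>2 * (z\<^sup>2 - (of_real (exp (- pi)))\<^sup>2) * \<Psi> z"
    by (rule factorization) (rule that)
  show "ball 0 (exp (- pi / 2)) \<subseteq> (ball 0 1 :: complex set)" by (rule subset_ball) simp
  then show "\<Phi> z = 0" if "z \<in> ball 0 (exp (- pi / 2))" for z
    using that norm_quotient_le [OF \<Psi> refl, of z] \<Psi>(2) [of z] by (auto simp: weighted_sup_eq_0)
qed (auto intro: holomorphic)

corollary fps_eq_0:
  assumes "\<Phi> has_fps_expansion F" shows "F = 0"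
proof -
  have "eventually (\<lambda>w. \<Phi> w = 0) (nhds 0)" using eventually_nhds_unit_ball by eventually_elim (rule eq_0)
  then have "\<Phi> has_fps_expansion 0" by (simp add: has_fps_expansion_0_iff)
  with assms show ?thesis by (rule fps_expansion_unique_complex)
qed

end

section \<open>Theta functions\<close>

definition theta :: "('a \<Rightarrow> real) \<Rightarrow> ('a \<Rightarrow> complex) \<Rightarrow> 'a set \<Rightarrow> complex \<Rightarrow> complex" where
  "theta \<nu> c X \<tau> = (\<Sum>\<^sub>\<infinity>x\<in>X. c x * exp (pi * \<i> * \<tau> * \<nu> x))"

definition theta_summable :: "('a \<Rightarrow> real) \<Rightarrow> ('a \<Rightarrow> complex) \<Rightarrow> 'a set \<Rightarrow> bool" where
  "theta_summable \<nu> c X \<longleftrightarrow> (\<forall>r>0. (\<lambda>x. norm (c x) * exp (- pi * r * \<nu> x)) summable_on X)"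

lemma theta_summableD:
  assumes "theta_summable \<nu> c X" "r > 0"
  shows "(\<lambda>x. norm (c x) * exp (- pi * r * \<nu> x)) summable_on X"
  using assms by (simp add: theta_summable_def)

lemma norm_theta_term: "norm (c * exp (pi * \<i> * \<tau> * of_real v)) = norm c * exp (- pi * Im \<tau> * v)"
proof -
  have "Re (pi * \<i> * \<tau> * of_real v) = - pi * Im \<tau> * v" by simp
  then show ?thesis by (simp only: norm_mult norm_exp_eq_Re)
qed

lemma theta_summable_imp_summable_on:
  assumes "theta_summable \<nu> c X" "Im \<tau> > 0"
  shows "(\<lambda>x. c x * exp (pi * \<i> * \<tau> * \<nu> x)) summable_on X"
proof (rule summable_on_norm_le)
  show "(\<lambda>x. norm (c x) * exp (- pi * Im \<tau> * \<nu> x)) summable_on X"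
    using assms by (simp add: theta_summable_def)
qed (simp only: norm_theta_term order_refl)

lemma theta_summable_linear_growth:
  assumes "theta_summable \<nu> (\<lambda>_. 1) X" and "\<And>x. x \<in> X \<Longrightarrow> \<nu> x \<ge> 0" and "\<And>x. x \<in> X \<Longrightarrow> norm (c x) \<le> K * (1 + \<nu> x)"
  shows "theta_summable \<nu> c X"
  unfolding theta_summable_def
proof (intro allI impI)
  fix r :: real assume r: "r > 0"
  define A where "A = max 1 (2 / (pi * r))"
  have "2 / (pi * r) * (pi * r / 2) \<le> A * (pi * r / 2)"
    using r by (intro mult_right_mono) (auto simp: A_def)
  then have A: "1 \<le> A" "1 \<le> A * (pi * r / 2)" using r by (auto simp: A_def)
  have majorant: "(\<lambda>x. \<bar>K\<bar> * A * exp (- pi * (r / 2) * \<nu> x)) summable_on X"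
    using theta_summableD [OF assms(1), of "r / 2"] r by (intro summable_on_cmult_right) simp
  show "(\<lambda>x. norm (c x) * exp (- pi * r * \<nu> x)) summable_on X"
  proof (rule summable_on_comparison_test [OF majorant])
    fix x assume x: "x \<in> X"
    have "1 + \<nu> x \<le> A * 1 + (A * (pi * r / 2)) * \<nu> x"
      using mult_right_mono [OF A(2) assms(2) [OF x]] A(1) by linarith
    also have "\<dots> = A * (1 + pi * (r / 2) * \<nu> x)" by (simp add: algebra_simps)
    also have "\<dots> \<le> A * exp (pi * (r / 2) * \<nu> x)" using A by (intro mult_left_mono exp_ge_add_one_self) auto
    finally have growth: "1 + \<nu> x \<le> A * exp (pi * (r / 2) * \<nu> x)" .
    have "norm (c x) \<le> \<bar>K\<bar> * (1 + \<nu> x)"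
      using assms(2) [OF x] by (intro order_trans [OF assms(3) [OF x]] mult_right_mono) auto
    also have "\<dots> \<le> \<bar>K\<bar> * (A * exp (pi * (r / 2) * \<nu> x))" using growth by (intro mult_left_mono) auto
    finally have "norm (c x) * exp (- pi * r * \<nu> x) \<le>
        \<bar>K\<bar> * (A * exp (pi * (r / 2) * \<nu> x)) * exp (- pi * r * \<nu> x)"
      by (rule mult_right_mono) simp
    also have "\<dots> = \<bar>K\<bar> * A * exp (- pi * (r / 2) * \<nu> x)"
    proof -
      have "exp (pi * (r / 2) * \<nu> x) * exp (- pi * r * \<nu> x) = exp (- pi * (r / 2) * \<nu> x)"
        unfolding exp_add [symmetric] by (simp add: field_simps)
      then show ?thesis by (simp only: mult.assoc)
    qed
    finally show "norm (c x) * exp (- pi * r * \<nu> x) \<le> \<bar>K\<bar> * A * exp (- pi * (r / 2) * \<nu> x)" .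
  qed auto
qed

lemma theta_holomorphic:
  assumes s: "theta_summable \<nu> c X" and \<nu>: "\<And>x. x \<in> X \<Longrightarrow> \<nu> x \<ge> 0"
  shows "theta \<nu> c X holomorphic_on {\<tau>. Im \<tau> > 0}"
proof -
  have "theta \<nu> c X field_differentiable at z" if z: "Im z > 0" for z
  proof -
    define r where "r = Im z / 2"
    have r: "r > 0" using z by (simp add: r_def)
    have Im: "Im \<tau> \<ge> r" if "\<tau> \<in> cball z r" for \<tau>
      using that abs_Im_le_cmod [of "z - \<tau>"] by (simp add: dist_norm r_def)
    have limit: "uniform_limit (cball z r) (\<lambda>Y \<tau>. \<Sum>x\<in>Y. c x * exp (pi * \<i> * \<tau> * \<nu> x))
        (\<lambda>\<tau>. \<Sum>\<^sub>\<infinity>x\<in>X. c x * exp (pi * \<i> * \<tau> * \<nu> x)) (finite_subsets_at_top X)"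
    proof (rule Weierstrass_m_test_general)
      show "(\<lambda>x. norm (c x) * exp (- pi * r * \<nu> x)) summable_on X"
        using s r by (simp add: theta_summable_def)
      show "norm (c x * exp (pi * \<i> * \<tau> * \<nu> x)) \<le> norm (c x) * exp (- pi * r * \<nu> x)"
        if "x \<in> X" "\<tau> \<in> cball z r" for x \<tau>
        unfolding norm_theta_term using Im [OF that(2)] \<nu> [OF that(1)]
        by (intro mult_left_mono) (auto intro: mult_right_mono)
    qed
    have "(\<lambda>\<tau>. \<Sum>\<^sub>\<infinity>x\<in>X. c x * exp (pi * \<i> * \<tau> * \<nu> x)) holomorphic_on ball z r"
      by (rule holomorphic_uniform_limit [OF _ limit])
        (auto intro!: always_eventually continuous_intros holomorphic_intros)
    then have "theta \<nu> c X holomorphic_on ball z r" unfolding theta_def [abs_def] .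
    then show ?thesis using r holomorphic_on_imp_differentiable_at [of _ "ball z r" z] by simp
  qed
  then show ?thesis by (auto simp: holomorphic_on_def intro: field_differentiable_at_within)
qed

lemma holomorphic_eqI_connected:
  assumes S: "open S" "connected S" and f: "f holomorphic_on S" and g: "g holomorphic_on S"
    and U: "connected U" "U \<subseteq> S" "a \<in> U" "b \<in> U" "a \<noteq> b" and eq: "\<And>z. z \<in> U \<Longrightarrow> f z = g z" and z: "z \<in> S"
  shows "f z = g z"
proof -
  have "f z - g z = 0"
  proof (rule analytic_continuation [where f = "\<lambda>z. f z - g z" and \<xi> = a, OF _ S U(2)])
    show "(\<lambda>z. f z - g z) holomorphic_on S" by (intro holomorphic_intros f g)
    show "a islimpt U" using U by (intro connected_imp_perfect) auto
  qed (use U eq z in auto)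
  then show ?thesis by simp
qed

lemma upper_half_plane_eqI:
  assumes f: "f holomorphic_on {\<tau>. Im \<tau> > 0}" and g: "g holomorphic_on {\<tau>. Im \<tau> > 0}"
    and eq: "\<And>t. t > 0 \<Longrightarrow> f (\<i> * of_real t) = g (\<i> * of_real t)" and \<tau>: "Im \<tau> > 0"
  shows "f \<tau> = g \<tau>"
proof (rule holomorphic_eqI_connected [OF _ _ f g])
  let ?U = "(\<lambda>t. \<i> * complex_of_real t) ` {0<..}"
  show "open {\<tau>. Im \<tau> > 0}" by (rule open_halfspace_Im_gt)
  show "connected {\<tau>. Im \<tau> > 0}" by (intro convex_connected convex_halfspace_Im_gt)
  show "connected ?U" by (intro connected_continuous_image continuous_intros) (simp add: connected_Ioi)
  show "\<i> * of_real 1 \<in> ?U" "\<i> * of_real 2 \<in> ?U" by (intro imageI; simp)+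
qed (use eq \<tau> in auto)

lemma inversion_from_imaginary_axis:
  assumes f: "f holomorphic_on {\<tau>. Im \<tau> > 0}" and g: "g holomorphic_on {\<tau>. Im \<tau> > 0}"
    and eq: "\<And>t. t > 0 \<Longrightarrow> g (\<i> * of_real (1 / t)) = k * (\<i> * of_real t) ^ n * f (\<i> * of_real t)"
      and \<tau>: "Im \<tau> > 0"
  shows "g (- 1 / \<tau>) = k * \<tau> ^ n * f \<tau>"
proof (rule upper_half_plane_eqI [where f = "\<lambda>\<tau>. g (- 1 / \<tau>)" and g = "\<lambda>\<tau>. k * \<tau> ^ n * f \<tau>"])
  show "(\<lambda>\<tau>. g (- 1 / \<tau>)) holomorphic_on {\<tau>. Im \<tau> > 0}"
    by (intro holomorphic_on_compose_gen [OF _ g, unfolded o_def] holomorphic_intros)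
      (auto dest: Im_inversion_pos)
  show "g (- 1 / (\<i> * of_real t)) = k * (\<i> * of_real t) ^ n * f (\<i> * of_real t)" if "t > 0" for t
  proof -
    have "- 1 / (\<i> * of_real t) = \<i> * of_real (1 / t)" using that
      by (simp add: complex_eq_iff Re_divide Im_divide power2_eq_square)
    then show ?thesis using eq [OF that] by (simp only:)
  qed
qed (use \<tau> in \<open>auto intro!: holomorphic_intros f\<close>)

lemma theta_imaginary_axis: "theta \<nu> c X (\<i> * of_real t) = (\<Sum>\<^sub>\<infinity>x\<in>X. c x * of_real (exp (- pi * t * \<nu> x)))"
proof -
  have "pi * \<i> * (\<i> * of_real t) * \<nu> x = complex_of_real (- pi * t * \<nu> x)" for x by (simp add: complex_eq_iff)
  then show ?thesis unfolding theta_def by (simp only: exp_of_real)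
qed

definition theta_coeff :: "('a \<Rightarrow> nat) \<Rightarrow> ('a \<Rightarrow> complex) \<Rightarrow> 'a set \<Rightarrow> nat \<Rightarrow> complex" where
  "theta_coeff n c X k = (\<Sum>\<^sub>\<infinity>x\<in>{x \<in> X. n x = k}. c x)"

definition theta_series :: "('a \<Rightarrow> nat) \<Rightarrow> ('a \<Rightarrow> complex) \<Rightarrow> 'a set \<Rightarrow> complex \<Rightarrow> complex" where
  "theta_series n c X w = (\<Sum>\<^sub>\<infinity>x\<in>X. c x * w ^ n x)"

lemma theta_series_nome:
  assumes "\<And>x. x \<in> X \<Longrightarrow> \<nu> x = real (n x)"
  shows "theta_series n c X (nome \<tau>) = theta \<nu> c X \<tau>"
  unfolding theta_series_def theta_def nome_def using assms
  by (intro infsum_cong) (simp add: exp_of_nat_mult [symmetric] mult.commute)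

lemma theta_series_zero: "theta_series n c X 0 = theta_coeff n c X 0"
proof -
  have "theta_series n c X 0 = infsum c {x \<in> X. n x = 0}"
    unfolding theta_series_def by (rule infsum_cong_neutral) (auto simp: zero_power)
  then show ?thesis by (simp add: theta_coeff_def)
qed

lemma theta_series_sums:
  assumes s: "theta_summable \<nu> c X" and \<nu>: "\<And>x. x \<in> X \<Longrightarrow> \<nu> x = real (n x)" and w: "norm w < 1"
  shows "(\<lambda>k. theta_coeff n c X k * w ^ k) sums theta_series n c X w"
proof -
  define r where "r = (norm w + 1) / 2"
  have r: "0 < r" "r < 1" "norm w \<le> r" using w by (auto simp: r_def add_nonneg_pos)
  have "(\<lambda>x. norm (c x) * exp (- pi * (- ln r / pi) * \<nu> x)) summable_on X"
    using r by (intro theta_summableD s) (simp add: divide_neg_pos)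
  moreover have "exp (- pi * (- ln r / pi) * \<nu> x) = r ^ n x" if "x \<in> X" for x
    using r \<nu> [OF that] by (simp add: powr_realpow [symmetric] powr_def mult.commute)
  ultimately have "(\<lambda>x. norm (c x) * r ^ n x) summable_on X"
    by (subst (asm) summable_on_cong [where g = "\<lambda>x. norm (c x) * r ^ n x"]) auto
  then have summable: "(\<lambda>x. c x * w ^ n x) summable_on X"
    by (rule summable_on_norm_le)
      (use r in \<open>auto simp: norm_mult norm_power intro!: mult_left_mono power_mono\<close>)
  have fibres: "bij_betw snd (Sigma UNIV (\<lambda>k. {x \<in> X. n x = k})) X"
    by (auto simp: bij_betw_def inj_on_def image_iff)
  have "((\<lambda>x. c x * w ^ n x) has_sum theta_series n c X w) X"
    using summable by (simp add: theta_series_def)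
  then have "((\<lambda>p. c (snd p) * w ^ n (snd p)) has_sum
      theta_series n c X w) (Sigma UNIV (\<lambda>k. {x \<in> X. n x = k}))"
    by (subst has_sum_reindex_bij_betw [OF fibres, where f = "\<lambda>x. c x * w ^ n x"])
  then have "((\<lambda>k. theta_coeff n c X k * w ^ k) has_sum theta_series n c X w) UNIV"
  proof (rule has_sum_Sigma')
    fix k
    have "((\<lambda>x. c x * w ^ n x) has_sum infsum (\<lambda>x. c x * w ^ n x) {x \<in> X. n x = k}) {x \<in> X. n x = k}"
      using summable by (intro has_sum_infsum) (rule summable_on_subset, auto)
    moreover have "infsum (\<lambda>x. c x * w ^ n x) {x \<in> X. n x = k} = infsum (\<lambda>x. c x * w ^ k) {x \<in> X. n x = k}"
      by (intro infsum_cong) auto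
    ultimately show "((\<lambda>x. c (snd (k, x)) * w ^ n (snd (k, x))) has_sum
        theta_coeff n c X k * w ^ k) {x \<in> X. n x = k}"
      by (simp add: theta_coeff_def infsum_cmult_left')
  qed
  then show ?thesis by (rule has_sum_imp_sums)
qed

lemma
  assumes s: "theta_summable \<nu> c X" and \<nu>: "\<And>x. x \<in> X \<Longrightarrow> \<nu> x = real (n x)"
  shows theta_series_has_fps_expansion: "theta_series n c X has_fps_expansion Abs_fps (theta_coeff n c X)"
    and theta_series_holomorphic: "theta_series n c X holomorphic_on ball 0 1"
proof -
  let ?F = "Abs_fps (theta_coeff n c X)"
  have radius: "fps_conv_radius ?F \<ge> 1"
    unfolding fps_conv_radius_def
  proof (rule conv_radius_geI_ex')
    fix r :: real assume "0 < r" "ereal r < 1"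
    then show "summable (\<lambda>k. fps_nth ?F k * of_real r ^ k)"
      using theta_series_sums [OF s \<nu>, of "of_real r"] by (auto simp: sums_iff)
  qed
  have eval: "eval_fps ?F w = theta_series n c X w" if "w \<in> ball 0 1" for w
    using theta_series_sums [OF s \<nu>, of w] that by (simp add: eval_fps_def sums_iff)
  have "eval_fps ?F holomorphic_on ball 0 1"
  proof (intro holomorphic_on_eval_fps subsetI)
    fix w :: complex assume "w \<in> ball 0 1"
    then have "ereal (norm w) < 1" by (simp add: one_ereal_def)
    from less_le_trans [OF this radius] show "w \<in> eball 0 (fps_conv_radius ?F)" by (simp add: in_eball_iff)
  qed
  then show "theta_series n c X holomorphic_on ball 0 1"
    by (rule holomorphic_transform) (rule eval)
  show "theta_series n c X has_fps_expansion ?F"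
    unfolding has_fps_expansion_def using eventually_nhds_unit_ball
    by (intro conjI less_le_trans [OF _ radius]) (simp, erule eventually_mono, rule eval)
qed

lemma theta_summable_finite_shell:
  assumes "theta_summable \<nu> (\<lambda>_. 1) X"
  shows "finite {x \<in> X. \<nu> x = k}"
proof (rule ccontr)
  assume inf: "infinite {x \<in> X. \<nu> x = k}"
  have "(\<lambda>x. norm (1::complex) * exp (- pi * 1 * \<nu> x)) summable_on {x \<in> X. \<nu> x = k}"
    by (rule summable_on_subset [OF theta_summableD [OF assms zero_less_one]]) blast
  moreover have "(\<lambda>x. norm (1::complex) * exp (- pi * 1 * \<nu> x)) summable_on {x \<in> X. \<nu> x = k} \<longleftrightarrow>
      (\<lambda>x. exp (- pi * k)) summable_on {x \<in> X. \<nu> x = k}"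
    by (rule summable_on_cong) simp
  ultimately show False using infsum_diverge_constant [OF inf exp_not_eq_zero] by blast
qed

abbreviation alternating :: "('a \<Rightarrow> nat) \<Rightarrow> 'a \<Rightarrow> complex" where
  "alternating n x \<equiv> (- 1) ^ n x"

lemma theta_series_minus: "theta_series n (\<lambda>_. 1) X (- w) = theta_series n (alternating n) X w"
  by (simp add: theta_series_def power_minus [of w])

lemma theta_series_alternating_minus: "theta_series n (alternating n) X (- w) = theta_series n (\<lambda>_. 1) X w"
  by (simp flip: theta_series_minus)

lemma theta_add_1:
  assumes "\<And>x. x \<in> X \<Longrightarrow> \<nu> x = real (n x)"
  shows "theta \<nu> (\<lambda>_. 1) X (\<tau> + 1) = theta \<nu> (alternating n) X \<tau>"
  using theta_series_nome [of X \<nu> n "\<lambda>_. 1" "\<tau> + 1"] theta_series_nome [of X \<nu> n "alternating n" \<tau>] assms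
  by (simp add: nome_add_1 theta_series_minus)

lemma theta_summable_alternating: "theta_summable \<nu> (\<lambda>_. 1) X \<Longrightarrow> theta_summable \<nu> (alternating n) X"
  by (simp add: theta_summable_def norm_power)

lemma theta_coeff_alternating: "theta_coeff n (alternating n) X k = (- 1) ^ k * theta_coeff n (\<lambda>_. 1) X k"
  unfolding theta_coeff_def infsum_cmult_right' [symmetric] by (intro infsum_cong) auto

section \<open>Eutactic root systems\<close>

definition eutactic :: "'a::euclidean_space set \<Rightarrow> bool" where
  "eutactic S \<longleftrightarrow> (\<exists>c. \<forall>u. (\<Sum>s\<in>S. (s \<bullet> u)\<^sup>2) = c * (u \<bullet> u))"

lemma sum_Basis_inner_squared: "(\<Sum>e\<in>Basis. (x \<bullet> e)\<^sup>2) = x \<bullet> x"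
  unfolding power2_eq_square by (rule euclidean_inner [symmetric])

lemma eutactic_sum_squares:
  fixes S :: "'a::euclidean_space set"
  assumes "eutactic S"
  shows "(\<Sum>s\<in>S. (s \<bullet> u)\<^sup>2) = (\<Sum>s\<in>S. s \<bullet> s) / DIM('a) * (u \<bullet> u)"
proof -
  obtain c where c: "\<And>u. (\<Sum>s\<in>S. (s \<bullet> u)\<^sup>2) = c * (u \<bullet> u)"
    using assms by (auto simp: eutactic_def)
  have "(\<Sum>s\<in>S. s \<bullet> s) = (\<Sum>s\<in>S. \<Sum>e\<in>Basis. (s \<bullet> e)\<^sup>2)"
    by (simp only: sum_Basis_inner_squared)
  also have "\<dots> = (\<Sum>e\<in>Basis. \<Sum>s\<in>S. (s \<bullet> e)\<^sup>2)" by (rule sum.swap)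
  also have "\<dots> = c * DIM('a)" by (simp add: c)
  finally show ?thesis by (simp add: c)
qed

lemma eutactic_norm2_sum_squares:
  fixes S :: "vec24 set"
  assumes "eutactic S" "\<And>s. s \<in> S \<Longrightarrow> s \<bullet> s = 2"
  shows "(\<Sum>s\<in>S. (s \<bullet> u)\<^sup>2) = real (card S) / 12 * (u \<bullet> u)"
  using eutactic_sum_squares [OF assms(1), of u] assms(2) by simp

definition frame_operator :: "'a::real_inner set \<Rightarrow> 'a \<Rightarrow> 'a" where
  "frame_operator S x = (\<Sum>s\<in>S. (s \<bullet> x) *\<^sub>R s)"

lemma linear_frame_operator: "linear (frame_operator S)"
  unfolding frame_operator_def
  by (intro linearI) (simp_all add: inner_add_right scaleR_add_left sum.distrib scaleR_sum_right)

lemma inner_frame_operator: "frame_operator S x \<bullet> y = (\<Sum>s\<in>S. (s \<bullet> x) * (s \<bullet> y))"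
  by (simp add: frame_operator_def inner_sum_left)

lemma frame_operator_eq_scaleR_on_span:
  assumes "\<And>s. s \<in> A \<Longrightarrow> frame_operator S s = c *\<^sub>R s" and "x \<in> span A"
  shows "frame_operator S x = c *\<^sub>R x"
  using linear_eq_on [OF linear_frame_operator linear_scale_self assms(2,1)] by simp

lemma component_subset: "component S r \<subseteq> S"
  by (auto simp: component_def)

lemma mem_component: "r \<in> S \<Longrightarrow> r \<in> component S r"
  by (simp add: component_def)

lemma component_orthogonal:
  assumes "s \<in> S" "s \<notin> component S r" "x \<in> span (component S r)"
  shows "s \<bullet> x = 0"
proof -
  have "s \<bullet> c = 0" if "c \<in> component S r" for c
  proof (rule ccontr)
    assume "s \<bullet> c \<noteq> 0"
    then have "(c, s) \<in> {(a, b). a \<in> S \<and> b \<in> S \<and> a \<bullet> b \<noteq> 0}"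
      using assms(1) that by (simp add: component_def inner_commute)
    then have "s \<in> component S r" using that by (auto simp: component_def intro: rtrancl_into_rtrancl)
    then show False using assms(2) by simp
  qed
  then show ?thesis
    using orthogonal_to_span [OF assms(3), of s] by (simp add: orthogonal_def)
qed

lemma sum_orthonormal_inner_squared:
  fixes E :: "'a::euclidean_space set"
  assumes "pairwise orthogonal E" "\<And>e. e \<in> E \<Longrightarrow> norm e = 1" "finite E" "s \<in> span E"
  shows "(\<Sum>e\<in>E. (s \<bullet> e)\<^sup>2) = s \<bullet> s"
proof -
  have "s = (\<Sum>e\<in>E. (s \<bullet> e) *\<^sub>R e)"
    using orthonormal_basis_expand [OF assms(1,2,4,3)] by simp
  then have "s \<bullet> s = s \<bullet> (\<Sum>e\<in>E. (s \<bullet> e) *\<^sub>R e)" by simp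
  then show ?thesis by (simp add: inner_sum_right power2_eq_square)
qed

text \<open>Compares the two expressions for the trace of the frame operator on the span of a component.\<close>

lemma card_component_eq:
  assumes S: "finite S" "\<And>s. s \<in> S \<Longrightarrow> s \<bullet> s = 2"
    and c: "\<And>x. x \<in> span (component S r) \<Longrightarrow> (\<Sum>s\<in>S. (s \<bullet> x)\<^sup>2) = c * (x \<bullet> x)"
  shows "2 * real (card (component S r)) = c * real (dim (span (component S r)))"
proof -
  let ?C = "component S r"
  obtain E where E: "E \<subseteq> span ?C" "pairwise orthogonal E" "\<And>e. e \<in> E \<Longrightarrow> norm e = 1" "independent E"
    "card E = dim (span ?C)" "span E = span ?C"
    by (rule orthonormal_basis_subspace [OF subspace_span, of ?C]) (rule that)
  have finite: "finite E" using E(4) by (rule independent_imp_finite)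
  have inside: "(\<Sum>e\<in>E. (s \<bullet> e)\<^sup>2) = 2" if "s \<in> ?C" for s
    using that S(2) [OF subsetD [OF component_subset that]]
    by (subst sum_orthonormal_inner_squared [OF E(2,3) finite]) (simp_all add: E(6) span_base)
  have outside: "(\<Sum>e\<in>E. (s \<bullet> e)\<^sup>2) = 0" if "s \<in> S - ?C" for s
    using that E(1) component_orthogonal by (intro sum.neutral) auto
  have "(\<Sum>e\<in>E. \<Sum>s\<in>S. (s \<bullet> e)\<^sup>2) = real (card E) * c"
    using E(1,3) by (simp add: c subset_iff flip: power2_norm_eq_inner)
  then have "c * real (dim (span ?C)) = (\<Sum>e\<in>E. \<Sum>s\<in>S. (s \<bullet> e)\<^sup>2)"
    by (simp only: E(5) mult.commute)
  also have "\<dots> = (\<Sum>s\<in>S. \<Sum>e\<in>E. (s \<bullet> e)\<^sup>2)" by (rule sum.swap)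
  also have "\<dots> = (\<Sum>s\<in>?C. \<Sum>e\<in>E. (s \<bullet> e)\<^sup>2)"
    by (rule sum.mono_neutral_right [OF S(1) component_subset ballI [OF outside]])
  also have "\<dots> = 2 * real (card ?C)" using inside by simp
  finally show ?thesis by simp
qed

lemma root_system_norm2D:
  assumes "root_system_norm2 R"
  shows "finite R" "r \<in> R \<Longrightarrow> r \<bullet> r = 2" "r \<in> R \<Longrightarrow> s \<in> R \<Longrightarrow> s - (s \<bullet> r) *\<^sub>R r \<in> R"
  using assms by (simp_all add: root_system_norm2_def)

lemma bij_betw_reflection:
  assumes R: "root_system_norm2 R" and r: "r \<in> R"
  shows "bij_betw (\<lambda>s. s - (s \<bullet> r) *\<^sub>R r) R R"
  using root_system_norm2D(2) [OF R r] root_system_norm2D(3) [OF R r]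
  by (intro bij_betwI [where g = "\<lambda>s. s - (s \<bullet> r) *\<^sub>R r"]) (auto simp: inner_diff_left scaleR_diff_left)

lemma frame_operator_root:
  assumes R: "root_system_norm2 R" and r: "r \<in> R"
  shows "frame_operator R r = ((\<Sum>s\<in>R. (s \<bullet> r)\<^sup>2) / 2) *\<^sub>R r"
proof -
  let ?\<sigma> = "\<lambda>s. s - (s \<bullet> r) *\<^sub>R r"
  have "frame_operator R r = (\<Sum>s\<in>R. (?\<sigma> s \<bullet> r) *\<^sub>R ?\<sigma> s)"
    unfolding frame_operator_def by (rule sum.reindex_bij_betw [OF bij_betw_reflection [OF R r], symmetric])
  also have "\<dots> = (\<Sum>s\<in>R. (s \<bullet> r)\<^sup>2 *\<^sub>R r - (s \<bullet> r) *\<^sub>R s)"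
    using root_system_norm2D(2) [OF R r]
    by (intro sum.cong) (auto simp: inner_diff_left algebra_simps power2_eq_square)
  also have "\<dots> = (\<Sum>s\<in>R. (s \<bullet> r)\<^sup>2) *\<^sub>R r - frame_operator R r"
    by (simp add: sum_subtractf frame_operator_def scaleR_sum_left)
  finally have "2 *\<^sub>R frame_operator R r = (\<Sum>s\<in>R. (s \<bullet> r)\<^sup>2) *\<^sub>R r" by (simp add: scaleR_2 eq_diff_eq)
  then have "(1 / 2) *\<^sub>R (2 *\<^sub>R frame_operator R r) = (1 / 2) *\<^sub>R ((\<Sum>s\<in>R. (s \<bullet> r)\<^sup>2) *\<^sub>R r)" by (simp only:)
  then show ?thesis by simp
qed

lemma sum_squares_component:
  assumes R: "root_system_norm2 R" and r: "r \<in> R" and s: "s \<in> component R r"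
  shows "(\<Sum>t\<in>R. (t \<bullet> s)\<^sup>2) = (\<Sum>t\<in>R. (t \<bullet> r)\<^sup>2)"
proof -
  have step: "(\<Sum>t\<in>R. (t \<bullet> a)\<^sup>2) = (\<Sum>t\<in>R. (t \<bullet> b)\<^sup>2)" if "a \<in> R" "b \<in> R" "a \<bullet> b \<noteq> 0" for a b
  proof -
    have "frame_operator R a \<bullet> b = frame_operator R b \<bullet> a" by (simp add: inner_frame_operator mult.commute)
    then show ?thesis using that by (simp add: frame_operator_root [OF R] inner_commute)
  qed
  have "(r, s) \<in> {(a, b). a \<in> R \<and> b \<in> R \<and> a \<bullet> b \<noteq> 0}\<^sup>*" using s by (simp add: component_def)
  then show ?thesis by (induction rule: rtrancl_induct) (use step in auto)
qed

lemma card_component_root_system: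
  assumes R: "root_system_norm2 R" and r: "r \<in> R"
  shows "4 * real (card (component R r)) = (\<Sum>s\<in>R. (s \<bullet> r)\<^sup>2) * real (dim (span (component R r)))"
proof -
  let ?c = "(\<Sum>s\<in>R. (s \<bullet> r)\<^sup>2) / 2"
  have "(\<Sum>s\<in>R. (s \<bullet> x)\<^sup>2) = ?c * (x \<bullet> x)" if "x \<in> span (component R r)" for x
  proof -
    have "frame_operator R s = ?c *\<^sub>R s" if s: "s \<in> component R r" for s
      using frame_operator_root [OF R] sum_squares_component [OF R r s] s component_subset by fastforce
    then have "frame_operator R x = ?c *\<^sub>R x" using that by (rule frame_operator_eq_scaleR_on_span)
    then show ?thesis using inner_frame_operator [of R x x] by (simp add: power2_eq_square)
  qed
  from card_component_eq [OF root_system_norm2D(1,2) [OF R] this] show ?thesis by simp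
qed

lemma eutactic_imp_strongly_eutactic:
  assumes R: "root_system_norm2 R" and "eutactic R" shows "strongly_eutactic R"
proof -
  obtain c where c: "\<And>u. (\<Sum>s\<in>R. (s \<bullet> u)\<^sup>2) = c * (u \<bullet> u)" using assms(2) by (auto simp: eutactic_def)
  have "c = 0" if "span R \<noteq> UNIV"
  proof -
    have "dim R < DIM(vec24)" using that dim_eq_full [of R] dim_subset_UNIV [of R] by linarith
    then obtain u where u: "u \<noteq> 0" "\<And>y. y \<in> span R \<Longrightarrow> orthogonal u y"
      by (rule orthogonal_to_subspace_exists) (rule that)
    have "(\<Sum>s\<in>R. (s \<bullet> u)\<^sup>2) = 0"
      using u(2) by (intro sum.neutral) (auto simp: orthogonal_def inner_commute span_base)
    then show "c = 0" using c [of u] u(1) by simp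
  qed
  moreover have "real (card (component R r)) = c / 2 * real (dim (span (component R r)))" for r
    using card_component_eq [OF root_system_norm2D(1,2) [OF R] c, of r] by simp
  ultimately show ?thesis unfolding strongly_eutactic_def by (intro exI [of _ "c / 2"]) auto
qed

lemma strongly_eutactic_imp_eutactic:
  assumes R: "root_system_norm2 R" and "strongly_eutactic R" shows "eutactic R"
proof -
  obtain h where h: "\<And>r. r \<in> R \<Longrightarrow> real (card (component R r)) = h * real (dim (span (component R r)))"
    and h_zero: "span R \<noteq> UNIV \<Longrightarrow> h = 0"
    using assms(2) by (auto simp: strongly_eutactic_def)
  have nonempty: "card (component R r) \<noteq> 0" if "r \<in> R" for r
    using mem_component [OF that] finite_subset [OF component_subset root_system_norm2D(1) [OF R]] by auto
  have root: "frame_operator R r = (2 * h) *\<^sub>R r" if "r \<in> R" for r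
  proof -
    have "real (dim (span (component R r))) \<noteq> 0" using h [OF that] nonempty [OF that]
      by (metis mult_zero_right of_nat_eq_0_iff)
    then have "(\<Sum>s\<in>R. (s \<bullet> r)\<^sup>2) = 4 * h"
      using card_component_root_system [OF R that] h [OF that] by simp
    then show ?thesis by (simp add: frame_operator_root [OF R that])
  qed
  show ?thesis
  proof (cases "R = {}")
    case False
    then have "h \<noteq> 0" using h nonempty by fastforce
    then have "x \<in> span R" for x using h_zero by blast
    then have "frame_operator R x = (2 * h) *\<^sub>R x" for x
      using frame_operator_eq_scaleR_on_span [of R R "2 * h" x] root by blast
    then have "(\<Sum>s\<in>R. (s \<bullet> u)\<^sup>2) = (2 * h) * (u \<bullet> u)" for u
      using inner_frame_operator [of R u u] by (simp add: power2_eq_square)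
    then show ?thesis by (auto simp: eutactic_def)
  qed (auto simp: eutactic_def)
qed

theorem strongly_eutactic_iff_eutactic: "root_system_norm2 R \<Longrightarrow> strongly_eutactic R \<longleftrightarrow> eutactic R"
  using eutactic_imp_strongly_eutactic strongly_eutactic_imp_eutactic by blast

text \<open>For \<open>s \<in> S - R\<close> the eutaxy of \<open>R\<close> and \<open>T\<close> gives \<open>4 (h\<^sub>T - h\<^sub>R)\<close> for the sum of \<open>(s \<bullet> t)\<^sup>2\<close> over
  \<open>T - R\<close>, whereas \<open>s \<bullet> t = \<plusminus>1/2\<close> gives \<open>24 (h\<^sub>T - h\<^sub>R) / 4\<close>.\<close>

lemma eutactic_half_inner_imp_eq:
  fixes R S T :: "vec24 set"
  assumes "finite T" "R \<subseteq> T" "R \<subseteq> S" and norm2: "\<And>x. x \<in> S \<union> T \<Longrightarrow> x \<bullet> x = 2"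
    and eutactic: "eutactic R" "eutactic T"
    and half: "\<forall>s\<in>S - R. \<forall>t\<in>T - R. s \<bullet> t = 1/2 \<or> s \<bullet> t = -1/2"
  shows "T = R \<or> S = R"
proof (cases "S = R")
  case False
  then obtain s where s: "s \<in> S - R" using \<open>R \<subseteq> S\<close> by blast
  have "(t \<bullet> s)\<^sup>2 = 1 / 4" if "t \<in> T - R" for t
  proof -
    have "s \<bullet> t = 1/2 \<or> s \<bullet> t = -1/2" using half s that by blast
    moreover have "(1 / 2 :: real)\<^sup>2 = 1 / 4" "(- 1 / 2 :: real)\<^sup>2 = 1 / 4" by (simp_all add: power2_eq_square)
    ultimately show ?thesis by (metis inner_commute)
  qed
  then have "(\<Sum>t\<in>T - R. (t \<bullet> s)\<^sup>2) = (\<Sum>t\<in>T - R. 1 / 4)" by (rule sum.cong [OF refl])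
  then have "(\<Sum>t\<in>T - R. (t \<bullet> s)\<^sup>2) = real (card (T - R)) / 4" by simp
  moreover have "(\<Sum>t\<in>T - R. (t \<bullet> s)\<^sup>2) = (\<Sum>t\<in>T. (t \<bullet> s)\<^sup>2) - (\<Sum>t\<in>R. (t \<bullet> s)\<^sup>2)"
    by (rule sum_diff [OF \<open>finite T\<close> \<open>R \<subseteq> T\<close>])
  moreover have "real (card (T - R)) = real (card T) - real (card R)"
    using card_Diff_subset [OF finite_subset] card_mono assms(1,2) by (metis of_nat_diff)
  moreover have "(\<Sum>t\<in>T. (t \<bullet> s)\<^sup>2) = real (card T) / 12 * (s \<bullet> s)"
      "(\<Sum>t\<in>R. (t \<bullet> s)\<^sup>2) = real (card R) / 12 * (s \<bullet> s)"
    by (intro eutactic_norm2_sum_squares eutactic; use norm2 \<open>R \<subseteq> T\<close> in blast)+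
  moreover have "s \<bullet> s = 2" using s norm2 by blast
  ultimately have "real (card T) = real (card R)" by simp
  then have "T = R" using card_subset_eq [OF \<open>finite T\<close> \<open>R \<subseteq> T\<close>] by simp
  then show ?thesis ..
qed simp

section \<open>Selfdual lattices\<close>

lemma int_span_range:
  fixes b :: "'i::finite \<Rightarrow> 'a::real_vector"
  assumes "inj b"
  shows "int_span (range b) = {(\<Sum>i\<in>UNIV. of_int (c i) *\<^sub>R b i) | c :: 'i \<Rightarrow> int. True}"
proof (intro equalityI subsetI)
  fix x assume "x \<in> int_span (range b)"
  then obtain c where "x = (\<Sum>v\<in>range b. of_int (c v) *\<^sub>R v)" by (rule int_spanE)
  then have "x = (\<Sum>i\<in>UNIV. of_int ((c \<circ> b) i) *\<^sub>R b i)" using assms by (simp add: sum.reindex)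
  then show "x \<in> {(\<Sum>i\<in>UNIV. of_int (c i) *\<^sub>R b i) | c :: 'i \<Rightarrow> int. True}" by blast
next
  fix x assume "x \<in> {(\<Sum>i\<in>UNIV. of_int (c i) *\<^sub>R b i) | c :: 'i \<Rightarrow> int. True}"
  then obtain c :: "'i \<Rightarrow> int" where "x = (\<Sum>i\<in>UNIV. of_int (c i) *\<^sub>R b i)" by blast
  then show "x \<in> int_span (range b)"
    using assms by (intro int_spanI [where c = "c \<circ> inv b"]) (simp add: sum.reindex)
qed

lemma lattice24_iff_int_span:
  "lattice24 L \<longleftrightarrow> (\<exists>B. finite B \<and> independent B \<and> span B = UNIV \<and> L = int_span B)"
proof -
  have "lattice24 L \<longleftrightarrow> (\<exists>b :: 24 \<Rightarrow> vec24. inj b \<and> independent (range b) \<and> L = int_span (range b))"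
    unfolding lattice24_def by (intro ex_cong1 conj_cong refl) (simp add: int_span_range)
  also have "\<dots> \<longleftrightarrow> (\<exists>B. finite B \<and> independent B \<and> span B = UNIV \<and> L = int_span B)"
  proof (intro iffI; elim exE conjE)
    fix b :: "24 \<Rightarrow> vec24" assume b: "inj b" "independent (range b)" "L = int_span (range b)"
    have "UNIV \<subseteq> span (range b)"
      by (rule card_ge_dim_independent) (use b in \<open>simp_all add: card_image\<close>)
    then show "\<exists>B. finite B \<and> independent B \<and> span B = UNIV \<and> L = int_span B"
      using b by (intro exI [of _ "range b"]) auto
  next
    fix B assume B: "finite B" "independent B" "span B = UNIV" "L = int_span B"
    then have "card B = CARD(24)" using dim_span_eq_card_independent [OF B(2)] by simp
    then obtain b :: "24 \<Rightarrow> vec24" where "bij_betw b UNIV B"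
      using finite_same_card_bij [of "UNIV :: 24 set" B] B(1) by auto
    then show "\<exists>b :: 24 \<Rightarrow> vec24. inj b \<and> independent (range b) \<and> L = int_span (range b)"
      using B by (auto simp: bij_betw_def)
  qed
  finally show ?thesis .
qed

lemma int_dual_eq_dual_set:
  assumes "span B = UNIV" "finite B" shows "int_dual B = dual_set (int_span B)"
proof (intro equalityI subsetI)
  fix y assume y: "y \<in> int_dual B"
  have "add_subgroup {x. x \<bullet> y \<in> \<int>}" by (simp add: add_subgroup_def inner_diff_left)
  then have "int_span B \<subseteq> {x. x \<bullet> y \<in> \<int>}" using y by (intro int_span_minimal) (auto simp: int_dual_def)
  then show "y \<in> dual_set (int_span B)" by (auto simp: dual_set_def)
next
  fix y assume "y \<in> dual_set (int_span B)"
  then show "y \<in> int_dual B" using assms int_span_base [OF assms(2)] by (simp add: int_dual_def dual_set_def)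
qed

definition norm_nat :: "'a::real_inner \<Rightarrow> nat" where
  "norm_nat x = nat \<lfloor>x \<bullet> x\<rfloor>"

lemma real_norm_nat: "x \<bullet> x \<in> \<int> \<Longrightarrow> real (norm_nat x) = x \<bullet> x"
  by (auto simp: norm_nat_def elim!: Ints_cases)

lemma theta_coeff_norm_nat:
  fixes X :: "vec24 set"
  assumes "\<And>x. x \<in> X \<Longrightarrow> x \<bullet> x \<in> \<int>" "finite (shell X (real k))"
  shows "theta_coeff norm_nat c X k = (\<Sum>x\<in>shell X (real k). c x)"
proof -
  have "norm_nat x = k \<longleftrightarrow> x \<bullet> x = real k" if "x \<in> X" for x
    unfolding real_norm_nat [OF assms(1) [OF that], symmetric] by simp
  then have "{x \<in> X. norm_nat x = k} = shell X (real k)" by (auto simp: shell_def)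
  then show ?thesis using assms(2) by (simp add: theta_coeff_def)
qed

lemma even_norm_nat:
  assumes "x \<bullet> x / 2 \<in> \<int>" shows "even (norm_nat x)"
proof -
  obtain k where "x \<bullet> x / 2 = of_int k" using assms by (rule Ints_cases)
  then have "x \<bullet> x = of_int (2 * k)" by simp
  moreover have "k \<ge> 0" using calculation inner_ge_zero [of x] by simp
  ultimately have "norm_nat x = 2 * nat k" unfolding norm_nat_def by (simp only: floor_of_int)
  then show ?thesis by simp
qed

locale selfdual_lattice =
  fixes L :: "vec24 set"
  assumes selfdual: "selfdual L"
begin

lemma mem_iff: "y \<in> L \<longleftrightarrow> (\<forall>x\<in>L. x \<bullet> y \<in> \<int>)"
proof -
  have "y \<in> L \<longleftrightarrow> y \<in> dual_set L" using selfdual by (simp add: selfdual_def)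
  then show ?thesis by (simp add: dual_set_def)
qed

lemma inner_Ints: "x \<in> L \<Longrightarrow> y \<in> L \<Longrightarrow> x \<bullet> y \<in> \<int>"
  using mem_iff [of y] by blast

lemma add_subgroup: "add_subgroup L"
  unfolding add_subgroup_def
proof (intro conjI ballI)
  show "x - y \<in> L" if "x \<in> L" "y \<in> L" for x y
    using that by (subst mem_iff) (auto simp: inner_diff_right inner_Ints)
qed (subst mem_iff, simp)

lemmas zero_mem = add_subgroup_zero [OF add_subgroup]
  and diff_mem = add_subgroup_diff [OF add_subgroup]
  and add_mem = add_subgroup_add [OF add_subgroup]
  and uminus_mem = add_subgroup_uminus [OF add_subgroup]

lemma scale_mem: "x \<in> L \<Longrightarrow> k \<in> \<int> \<Longrightarrow> k *\<^sub>R x \<in> L"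
  using add_subgroup_scale_int [OF add_subgroup] by (auto elim: Ints_cases)

lemma lattice_basis:
  obtains B where "finite B" "independent B" "span B = UNIV" "L = int_span B"
proof -
  have "lattice24 L" using selfdual by (simp add: selfdual_def integral_lattice_def)
  then show thesis using that by (auto simp: lattice24_iff_int_span)
qed

theorem
  assumes t: "t > 0"
  shows summable_gauss: "(\<lambda>x. gauss t (x + a)) summable_on L"
    and poisson: "(\<Sum>\<^sub>\<infinity>x\<in>L. complex_of_real (gauss t (x + a))) =
      of_real (1 / t ^ 12) * (\<Sum>\<^sub>\<infinity>y\<in>L. of_real (gauss (1 / t) y) * cis (2 * pi * (y \<bullet> a)))"
proof -
  obtain B where B: "finite B" "independent B" "span B = UNIV" "L = int_span B" by (rule lattice_basis)
  have "int_dual B = int_span B"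
    using int_dual_eq_dual_set [OF B(3,1)] selfdual B(4) by (simp add: selfdual_def)
  from poisson_unimodular [OF B(1-3) this t, of a]
  have "(\<lambda>x. gauss t (x + a)) summable_on L"
    "(\<Sum>\<^sub>\<infinity>x\<in>L. complex_of_real (gauss t (x + a))) =
      of_real ((1 / sqrt t) ^ 24) * (\<Sum>\<^sub>\<infinity>y\<in>L. of_real (gauss (1 / t) y) * cis (2 * pi * (y \<bullet> a)))"
    by (simp_all add: B(4))
  moreover have "(1 / sqrt t) ^ 24 = 1 / t ^ 12"
    using t power_mult [of "sqrt t" 2 12] by (simp add: power_divide)
  ultimately show "(\<lambda>x. gauss t (x + a)) summable_on L"
    "(\<Sum>\<^sub>\<infinity>x\<in>L. complex_of_real (gauss t (x + a))) =
      of_real (1 / t ^ 12) * (\<Sum>\<^sub>\<infinity>y\<in>L. of_real (gauss (1 / t) y) * cis (2 * pi * (y \<bullet> a)))"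
    by simp_all
qed

lemma theta_summable: "theta_summable (\<lambda>x. x \<bullet> x) (\<lambda>_. 1) L"
  using summable_gauss [of _ 0] by (simp add: theta_summable_def gauss_def)

lemma norm_eq_norm_nat: "x \<in> L \<Longrightarrow> x \<bullet> x = real (norm_nat x)"
  by (simp add: real_norm_nat inner_Ints)

lemma finite_shell: "finite (shell L m)"
  using theta_summable_finite_shell [OF theta_summable] by (simp add: shell_def)

lemma theta_coeff_shell: "theta_coeff norm_nat c L k = (\<Sum>x\<in>shell L (real k). c x)"
  by (intro theta_coeff_norm_nat inner_Ints finite_shell)

lemma shell_0: "shell L 0 = {0}"
  using zero_mem by (auto simp: shell_def)

lemma root_system_shell: "root_system_norm2 (shell L 2)"
  unfolding root_system_norm2_def
proof (intro conjI ballI)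
  show "finite (shell L 2)" by (rule finite_shell)
  fix r s assume "r \<in> shell L 2" "s \<in> shell L 2"
  then have rs: "r \<in> L" "s \<in> L" "r \<bullet> r = 2" "s \<bullet> s = 2" by (simp_all add: shell_def)
  show "r \<bullet> s \<in> \<int>" by (rule inner_Ints [OF rs(1,2)])
  have "s - (s \<bullet> r) *\<^sub>R r \<in> L" using rs by (intro diff_mem scale_mem inner_Ints)
  moreover have "(s - (s \<bullet> r) *\<^sub>R r) \<bullet> (s - (s \<bullet> r) *\<^sub>R r) = 2"
    using rs by (simp add: inner_diff_left inner_diff_right inner_commute)
  ultimately show "s - (s \<bullet> r) *\<^sub>R r \<in> shell L 2" by (simp add: shell_def)
qed (simp add: shell_def)

end

lemma theta_axis_gauss:
  "theta (\<lambda>x. x \<bullet> x) c X (\<i> * of_real t) = (\<Sum>\<^sub>\<infinity>x\<in>X. c x * of_real (gauss t x))"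
  by (simp add: theta_imaginary_axis gauss_def)

section \<open>Roots of even selfdual lattices\<close>

lemma higher_deriv_sum_exp:
  "(deriv ^^ n) (\<lambda>\<epsilon>. \<Sum>x\<in>F. c x * exp (\<epsilon> * z x)) = (\<lambda>\<epsilon>. \<Sum>x\<in>F. c x * z x ^ n * exp (\<epsilon> * z x :: complex))"
proof (induction n)
  case (Suc n)
  have "deriv (\<lambda>\<epsilon>. \<Sum>x\<in>F. c x * z x ^ n * exp (\<epsilon> * z x)) \<epsilon> = (\<Sum>x\<in>F. c x * z x ^ Suc n * exp (\<epsilon> * z x))" for \<epsilon>
    by (intro DERIV_imp_deriv derivative_eq_intros refl) (auto intro!: sum.cong)
  then show ?case using Suc.IH by simp
qed simp

lemma
  fixes c z :: "'a \<Rightarrow> complex"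
  assumes summable: "(\<lambda>x. norm (c x) * exp (norm (z x))) summable_on X"
  shows exp_sum_holomorphic: "(\<lambda>\<epsilon>. \<Sum>\<^sub>\<infinity>x\<in>X. c x * exp (\<epsilon> * z x)) holomorphic_on ball 0 1"
    and higher_deriv_exp_sum: "((\<lambda>x. c x * z x ^ n) has_sum
        (deriv ^^ n) (\<lambda>\<epsilon>. \<Sum>\<^sub>\<infinity>x\<in>X. c x * exp (\<epsilon> * z x)) 0) X"
proof -
  have lim: "uniform_limit (cball 0 1) (\<lambda>F \<epsilon>. \<Sum>x\<in>F. c x * exp (\<epsilon> * z x))
      (\<lambda>\<epsilon>. \<Sum>\<^sub>\<infinity>x\<in>X. c x * exp (\<epsilon> * z x)) (finite_subsets_at_top X)"
  proof (rule Weierstrass_m_test_general [OF _ summable])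
    fix x and \<epsilon> :: complex assume "\<epsilon> \<in> cball 0 1"
    then have "norm (\<epsilon> * z x) \<le> 1 * norm (z x)" unfolding norm_mult by (intro mult_right_mono) auto
    then have "norm (exp (\<epsilon> * z x)) \<le> exp (norm (z x))"
      using norm_exp [of "\<epsilon> * z x"] by (metis exp_le_cancel_iff mult_1 order_trans)
    then show "norm (c x * exp (\<epsilon> * z x)) \<le> norm (c x) * exp (norm (z x))"
      unfolding norm_mult by (rule mult_left_mono) simp
  qed
  have partial_sums: "(\<lambda>\<epsilon>. \<Sum>x\<in>F. c x * exp (\<epsilon> * z x)) holomorphic_on A" for F A
    by (intro holomorphic_intros)
  show "(\<lambda>\<epsilon>. \<Sum>\<^sub>\<infinity>x\<in>X. c x * exp (\<epsilon> * z x)) holomorphic_on ball 0 1"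
    by (rule holomorphic_uniform_limit [OF _ lim]) (use partial_sums holomorphic_on_imp_continuous_on in auto)
  show "((\<lambda>x. c x * z x ^ n) has_sum (deriv ^^ n) (\<lambda>\<epsilon>. \<Sum>\<^sub>\<infinity>x\<in>X. c x * exp (\<epsilon> * z x)) 0) X"
    using higher_deriv_complex_uniform_limit [OF
      uniform_limit_on_subset [OF lim ball_subset_cball], of 0 n] partial_sums
    by (simp add: has_sum_def higher_deriv_sum_exp)
qed

lemma unit_ball_eqI:
  assumes f: "f holomorphic_on ball 0 1" and g: "g holomorphic_on ball 0 1"
    and eq: "\<And>x::real. f (of_real x) = g (of_real x)" and z: "z \<in> ball 0 1"
  shows "f z = g z"
proof (rule holomorphic_eqI_connected [OF open_ball connected_ball f g])
  let ?U = "complex_of_real ` {-1<..<1}"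
  show "connected ?U" by (intro connected_continuous_image continuous_intros connected_Ioo)
  show "of_real 0 \<in> ?U" "of_real (1 / 2) \<in> ?U" by (intro imageI; simp)+
qed (use eq z in auto)

lemma second_deriv_gauss_mult:
  assumes "f holomorphic_on ball 0 1"
  shows "(deriv ^^ 2) (\<lambda>\<epsilon>. exp (- c * \<epsilon>\<^sup>2) * f \<epsilon>) 0 = (deriv ^^ 2) f 0 - 2 * c * f 0"
proof -
  define e where "e \<epsilon> = exp (- c * \<epsilon>\<^sup>2)" for \<epsilon>
  have "deriv e = (\<lambda>\<epsilon>. - 2 * c * \<epsilon> * e \<epsilon>)"
    unfolding e_def by (intro ext DERIV_imp_deriv) (auto intro!: derivative_eq_intros)
  moreover have "deriv (\<lambda>\<epsilon>. - 2 * c * \<epsilon> * e \<epsilon>) 0 = - 2 * c"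
    unfolding e_def by (intro DERIV_imp_deriv) (auto intro!: derivative_eq_intros)
  moreover have "(deriv ^^ 2) (\<lambda>\<epsilon>. e \<epsilon> * f \<epsilon>) 0 =
      (\<Sum>i = 0..2. of_nat (2 choose i) * (deriv ^^ i) e 0 * (deriv ^^ (2 - i)) f 0)"
    by (rule higher_deriv_mult [OF _ assms]) (auto simp: e_def intro!: holomorphic_intros)
  ultimately have "(deriv ^^ 2) (\<lambda>\<epsilon>. e \<epsilon> * f \<epsilon>) 0 = (deriv ^^ 2) f 0 - 2 * c * f 0"
    by (simp add: numeral_2_eq_2 e_def)
  then show ?thesis by (simp only: e_def)
qed

lemma gauss_exp_le:
  fixes x u :: "'a::real_inner"
  assumes "t > 0"
  shows "gauss t x * exp (b * \<bar>x \<bullet> u\<bar>) \<le> exp (b\<^sup>2 * (u \<bullet> u) / (2 * pi * t)) * gauss (t / 2) x"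
proof -
  have "\<bar>b\<bar> * \<bar>x \<bullet> u\<bar> \<le> \<bar>b\<bar> * (norm x * norm u)"
    by (intro mult_left_mono Cauchy_Schwarz_ineq2) simp
  moreover have "b * \<bar>x \<bullet> u\<bar> \<le> \<bar>b\<bar> * \<bar>x \<bullet> u\<bar>" by (intro mult_right_mono) auto
  moreover have "0 \<le> (pi * t * norm x - \<bar>b\<bar> * norm u)\<^sup>2 / (2 * pi * t)" using assms by simp
  moreover have "(pi * t * norm x - \<bar>b\<bar> * norm u)\<^sup>2 / (2 * pi * t) =
      pi * (t / 2) * (x \<bullet> x) + b\<^sup>2 * (u \<bullet> u) / (2 * pi * t) - \<bar>b\<bar> * (norm x * norm u)"
    using assms unfolding power2_norm_eq_inner [symmetric] by (simp add: power2_eq_square field_simps)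
  ultimately have "- pi * t * (x \<bullet> x) + b * \<bar>x \<bullet> u\<bar> \<le> b\<^sup>2 * (u \<bullet> u) / (2 * pi * t) + - pi * (t / 2) * (x \<bullet> x)"
    by simp
  then show ?thesis unfolding gauss_def exp_add [symmetric] by (simp only: exp_le_cancel_iff)
qed

lemma has_sum_diff:
  fixes f g :: "'a \<Rightarrow> 'b :: real_normed_field"
  assumes "(f has_sum a) A" "(g has_sum b) A" shows "((\<lambda>x. f x - g x) has_sum (a - b)) A"
  using has_sum_add [OF assms(1) has_sum_uminusI [OF assms(2)]] by simp

lemma has_sum_sum:
  fixes f :: "'i \<Rightarrow> 'a \<Rightarrow> 'b :: {topological_comm_monoid_add}"
  assumes "\<And>i. i \<in> I \<Longrightarrow> (f i has_sum s i) A"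
  shows "((\<lambda>x. \<Sum>i\<in>I. f i x) has_sum (\<Sum>i\<in>I. s i)) A"
  using assms by (induction I rule: infinite_finite_induct) (auto intro: has_sum_add)

context selfdual_lattice
begin

lemma summable_gauss_exp:
  assumes "t > 0" shows "(\<lambda>x. gauss t x * exp (b * \<bar>x \<bullet> u\<bar>)) summable_on L"
proof (rule summable_on_comparison_test)
  show "(\<lambda>x. exp (b\<^sup>2 * (u \<bullet> u) / (2 * pi * t)) * gauss (t / 2) x) summable_on L"
    using summable_gauss [of "t / 2" 0] assms by (intro summable_on_cmult_right) simp
qed (use gauss_exp_le [OF assms] in auto)

definition gauss_moment :: "vec24 \<Rightarrow> real \<Rightarrow> complex" where
  "gauss_moment u t = (\<Sum>\<^sub>\<infinity>x\<in>L. of_real (gauss t x) * of_real ((x \<bullet> u)\<^sup>2))"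

definition gauss_exp_sum :: "vec24 \<Rightarrow> real \<Rightarrow> complex \<Rightarrow> complex \<Rightarrow> complex" where
  "gauss_exp_sum u t b \<epsilon> = (\<Sum>\<^sub>\<infinity>x\<in>L. of_real (gauss t x) * exp (\<epsilon> * (b * of_real (x \<bullet> u))))"

lemma
  assumes "t > 0"
  shows gauss_exp_sum_holomorphic: "gauss_exp_sum u t b holomorphic_on ball 0 1"
    and higher_deriv_gauss_exp_sum: "((\<lambda>x. of_real (gauss t x) * (b * of_real (x \<bullet> u)) ^ n) has_sum
        (deriv ^^ n) (gauss_exp_sum u t b) 0) L"
proof -
  have "(\<lambda>x. norm (complex_of_real (gauss t x)) * exp (norm (b * complex_of_real (x \<bullet> u)))) summable_on L"
    using summable_gauss_exp [OF assms, of "norm b" u] by (simp add: norm_mult)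
  from exp_sum_holomorphic [OF this] higher_deriv_exp_sum [OF this]
  show "gauss_exp_sum u t b holomorphic_on ball 0 1"
    "((\<lambda>x. of_real (gauss t x) * (b * of_real (x \<bullet> u)) ^ n) has_sum (deriv ^^ n) (gauss_exp_sum u t b) 0) L"
    by (simp_all only: gauss_exp_sum_def [abs_def])
qed

lemma has_sum_gauss_moment:
  assumes "t > 0" shows "((\<lambda>x. of_real (gauss t x) * of_real ((x \<bullet> u)\<^sup>2)) has_sum gauss_moment u t) L"
  using has_sum_imp_summable [OF higher_deriv_gauss_exp_sum [OF assms, of 1 u 2]]
  by (simp add: gauss_moment_def)

lemma second_deriv_gauss_exp_sum:
  assumes "t > 0" shows "(deriv ^^ 2) (gauss_exp_sum u t b) 0 = b\<^sup>2 * gauss_moment u t"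
  using higher_deriv_gauss_exp_sum [OF assms, of b u 2]
    has_sum_cmult_right [OF has_sum_gauss_moment [OF assms, of u], of "b\<^sup>2"]
  by (simp add: power_mult_distrib mult.left_commute has_sum_unique)

lemma poisson_complex_shift:
  fixes \<epsilon> :: complex
  assumes t: "t > 0" and \<epsilon>: "\<epsilon> \<in> ball 0 1"
  shows "exp (- of_real (pi * t * (u \<bullet> u)) * \<epsilon>\<^sup>2) * gauss_exp_sum u t (- of_real (2 * pi * t)) \<epsilon> =
    of_real (1 / t ^ 12) * gauss_exp_sum u (1 / t) (2 * pi * \<i>) \<epsilon>"
proof (rule unit_ball_eqI [OF _ _ _ \<epsilon>])
  show "(\<lambda>\<epsilon>. exp (- of_real (pi * t * (u \<bullet> u)) * \<epsilon>\<^sup>2) *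
      gauss_exp_sum u t (- of_real (2 * pi * t)) \<epsilon>) holomorphic_on ball 0 1"
    "(\<lambda>\<epsilon>. of_real (1 / t ^ 12) * gauss_exp_sum u (1 / t) (2 * pi * \<i>) \<epsilon>) holomorphic_on ball 0 1"
    using t by (auto intro!: holomorphic_intros gauss_exp_sum_holomorphic)
  fix x :: real
  have "complex_of_real (gauss t (v + x *\<^sub>R u)) =
      exp (- of_real (pi * t * (u \<bullet> u)) * (of_real x)\<^sup>2) *
        (of_real (gauss t v) * exp (of_real x * (- of_real (2 * pi * t) * of_real (v \<bullet> u))))" for v
  proof -
    have "gauss t (v + x *\<^sub>R u) = exp (- (pi * t * (u \<bullet> u)) * x\<^sup>2) *
        (gauss t v * exp (x * (- (2 * pi * t) * (v \<bullet> u))))"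
      unfolding gauss_def exp_add [symmetric]
      by (simp add: inner_add_left inner_add_right inner_commute power2_eq_square algebra_simps)
    then show ?thesis by (simp flip: exp_of_real)
  qed
  moreover have "cis (2 * pi * (v \<bullet> (x *\<^sub>R u))) = exp (of_real x * (2 * pi * \<i> * of_real (v \<bullet> u)))" for v
    by (simp add: cis_conv_exp mult_ac)
  ultimately show "exp (- of_real (pi * t * (u \<bullet> u)) * (of_real x)\<^sup>2) *
      gauss_exp_sum u t (- of_real (2 * pi * t)) (of_real x) =
      of_real (1 / t ^ 12) * gauss_exp_sum u (1 / t) (2 * pi * \<i>) (of_real x)"
    using poisson [OF t, of "x *\<^sub>R u"] by (simp only: gauss_exp_sum_def infsum_cmult_right')
qed

text \<open>The second derivative of Poisson summation with respect to the shift.\<close>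

lemma gauss_moment_inversion:
  assumes t: "t > 0"
  shows "gauss_moment u (1 / t) =
    of_real (t ^ 13 / (2 * pi)) * of_real (u \<bullet> u) * (\<Sum>\<^sub>\<infinity>x\<in>L. of_real (gauss t x))
      - of_real (t ^ 14) * gauss_moment u t"
proof -
  let ?\<Theta> = "\<Sum>\<^sub>\<infinity>x\<in>L. complex_of_real (gauss t x)"
  let ?lhs = "\<lambda>\<epsilon>::complex. exp (- of_real (pi * t * (u \<bullet> u)) * \<epsilon>\<^sup>2) *
      gauss_exp_sum u t (- of_real (2 * pi * t)) \<epsilon>"
  let ?rhs = "\<lambda>\<epsilon>. of_real (1 / t ^ 12) * gauss_exp_sum u (1 / t) (2 * pi * \<i>) \<epsilon>"
  have "eventually (\<lambda>\<epsilon>. ?lhs \<epsilon> = ?rhs \<epsilon>) (nhds 0)"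
    using eventually_nhds_unit_ball by eventually_elim (rule poisson_complex_shift [OF t])
  then have "(deriv ^^ 2) ?lhs 0 = (deriv ^^ 2) ?rhs 0" by (rule higher_deriv_cong_ev) simp
  moreover have "(deriv ^^ 2) ?lhs 0 = of_real (4 * pi\<^sup>2 * t\<^sup>2) *
      gauss_moment u t - of_real (2 * pi * t * (u \<bullet> u)) * ?\<Theta>"
    unfolding second_deriv_gauss_mult [OF gauss_exp_sum_holomorphic [OF t]] second_deriv_gauss_exp_sum [OF t]
    by (simp add: gauss_exp_sum_def power_mult_distrib)
  moreover have "(deriv ^^ 2) ?rhs 0 = - of_real (4 * pi\<^sup>2 / t ^ 12) * gauss_moment u (1 / t)"
    using t by (subst higher_deriv_cmult [of _ "ball 0 1"])
      (auto intro!: gauss_exp_sum_holomorphic simp: second_deriv_gauss_exp_sum power_mult_distrib)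
  ultimately have "of_real (4 * pi\<^sup>2 * t\<^sup>2) * gauss_moment u t - of_real (2 * pi * t * (u \<bullet> u)) * ?\<Theta> =
      - (of_real (4 * pi\<^sup>2 / t ^ 12) * gauss_moment u (1 / t))"
    by (simp only: mult_minus_left)
  then have second_deriv: "of_real (4 * pi\<^sup>2 / t ^ 12) * gauss_moment u (1 / t) =
      of_real (2 * pi * t * (u \<bullet> u)) * ?\<Theta> - of_real (4 * pi\<^sup>2 * t\<^sup>2) * gauss_moment u t"
    by (metis minus_diff_eq minus_minus)
  have "gauss_moment u (1 / t) = of_real (t ^ 12 / (4 * pi\<^sup>2)) *
      (of_real (4 * pi\<^sup>2 / t ^ 12) * gauss_moment u (1 / t))"
    using t by (simp add: mult.assoc [symmetric])
  also have "\<dots> = of_real (t ^ 13 / (2 * pi)) * of_real (u \<bullet> u) * ?\<Theta> - of_real (t ^ 14) * gauss_moment u t"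
    unfolding second_deriv by (simp add: field_simps power2_eq_square power_numeral_reduce)
  finally show ?thesis .
qed

definition harmonic :: "vec24 \<Rightarrow> vec24 \<Rightarrow> complex" where
  "harmonic u x = of_real ((x \<bullet> u)\<^sup>2 - (u \<bullet> u) * (x \<bullet> x) / 24)"

abbreviation theta_harmonic :: "vec24 \<Rightarrow> complex \<Rightarrow> complex" where
  "theta_harmonic u \<equiv> theta (\<lambda>x. x \<bullet> x) (harmonic u) L"

lemma theta_summable_harmonic: "theta_summable (\<lambda>x. x \<bullet> x) (harmonic u) L"
proof (rule theta_summable_linear_growth [OF theta_summable])
  fix x
  have "norm (harmonic u x) \<le> \<bar>(x \<bullet> u)\<^sup>2\<bar> + \<bar>(u \<bullet> u) * (x \<bullet> x) / 24\<bar>"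
    unfolding harmonic_def norm_of_real by (rule abs_triangle_ineq4)
  also have "\<dots> \<le> (x \<bullet> x) * (u \<bullet> u) + (u \<bullet> u) * (x \<bullet> x)"
    using Cauchy_Schwarz_ineq [of x u] by (intro add_mono) auto
  also have "\<dots> \<le> 2 * (u \<bullet> u) * (1 + x \<bullet> x)" by (simp add: algebra_simps)
  finally show "norm (harmonic u x) \<le> 2 * (u \<bullet> u) * (1 + x \<bullet> x)" .
qed simp

lemma theta_harmonic_axis:
  assumes t: "t > 0"
  shows "theta_harmonic u (\<i> * of_real t) = gauss_moment u t -
      of_real (u \<bullet> u / 24) * (\<Sum>e\<in>Basis. gauss_moment e t)"
proof -
  have "((\<lambda>x. of_real (gauss t x) * of_real ((x \<bullet> u)\<^sup>2) -
      of_real (u \<bullet> u / 24) * (\<Sum>e\<in>Basis. of_real (gauss t x) * of_real ((x \<bullet> e)\<^sup>2))) has_sum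
    (gauss_moment u t - of_real (u \<bullet> u / 24) * (\<Sum>e\<in>Basis. gauss_moment e t))) L"
    by (intro has_sum_diff has_sum_cmult_right has_sum_sum has_sum_gauss_moment t)
  moreover have "harmonic u x * of_real (gauss t x) = of_real (gauss t x) * of_real ((x \<bullet> u)\<^sup>2) -
      of_real (u \<bullet> u / 24) * (\<Sum>e\<in>Basis. of_real (gauss t x) * of_real ((x \<bullet> e)\<^sup>2))" for x
    unfolding sum_distrib_left [symmetric] of_real_sum [symmetric] sum_Basis_inner_squared harmonic_def
    by (simp add: algebra_simps)
  ultimately show ?thesis unfolding theta_axis_gauss by (simp only: infsumI)
qed

lemma theta_harmonic_inversion_axis:
  assumes t: "t > 0"
  shows "theta_harmonic u (\<i> * of_real (1 / t)) = - of_real (t ^ 14) * theta_harmonic u (\<i> * of_real t)"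
proof -
  let ?c = "of_real (t ^ 13 / (2 * pi)) * (\<Sum>\<^sub>\<infinity>x\<in>L. complex_of_real (gauss t x))"
  have inversion: "gauss_moment v (1 / t) = of_real (v \<bullet> v) * ?c - of_real (t ^ 14) * gauss_moment v t" for v
    using gauss_moment_inversion [OF t] by (simp add: mult_ac)
  have "(\<Sum>e\<in>(Basis :: vec24 set). of_real (e \<bullet> e) * ?c) = 24 * ?c" by simp
  then have "(\<Sum>e\<in>Basis. gauss_moment e (1 / t)) = 24 * ?c - of_real (t ^ 14) * (\<Sum>e\<in>Basis. gauss_moment e t)"
    by (simp only: inversion sum_subtractf sum_distrib_left)
  then have "theta_harmonic u (\<i> * of_real (1 / t)) =
      (of_real (u \<bullet> u) * ?c - of_real (t ^ 14) * gauss_moment u t)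
      - of_real (u \<bullet> u / 24) * (24 * ?c - of_real (t ^ 14) * (\<Sum>e\<in>Basis. gauss_moment e t))"
    using t by (simp only: theta_harmonic_axis zero_less_divide_1_iff inversion [of u])
  also have "\<dots> = - of_real (t ^ 14) * theta_harmonic u (\<i> * of_real t)"
    unfolding theta_harmonic_axis [OF t] by (simp add: algebra_simps)
  finally show ?thesis .
qed

lemma theta_harmonic_inversion:
  assumes \<tau>: "Im \<tau> > 0"
  shows "theta_harmonic u (- 1 / \<tau>) = \<tau> ^ 14 * theta_harmonic u \<tau>"
proof -
  have holomorphic: "theta_harmonic u holomorphic_on {\<tau>. Im \<tau> > 0}"
    by (rule theta_holomorphic [OF theta_summable_harmonic]) simp
  have "theta_harmonic u (- 1 / \<tau>) = 1 * \<tau> ^ 14 * theta_harmonic u \<tau>"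
  proof (rule inversion_from_imaginary_axis [OF holomorphic holomorphic _ \<tau>])
    have "\<i> ^ 14 = - 1" by (simp add: power_numeral_even power_numeral_odd)
    then have "(\<i> * of_real t) ^ 14 = - complex_of_real (t ^ 14)" for t by (simp add: power_mult_distrib)
    then show "theta_harmonic u (\<i> * of_real (1 / t)) = 1 * (\<i> * of_real t) ^ 14 *
        theta_harmonic u (\<i> * of_real t)" if "t > 0" for t
      using theta_harmonic_inversion_axis [OF that] by (simp only: mult_1)
  qed
  then show ?thesis by simp
qed

end

locale even_selfdual_lattice = selfdual_lattice +
  assumes even: "x \<in> L \<Longrightarrow> x \<bullet> x / 2 \<in> \<int>"
begin

abbreviation harmonic_series :: "vec24 \<Rightarrow> complex \<Rightarrow> complex" where
  "harmonic_series u \<equiv> theta_series norm_nat (harmonic u) L"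

lemma weight14_cusp_form_harmonic_series: "weight14_cusp_form (harmonic_series u)"
proof
  show "harmonic_series u holomorphic_on ball 0 1"
    by (rule theta_series_holomorphic [OF theta_summable_harmonic norm_eq_norm_nat])
  show "harmonic_series u 0 = 0" by (simp add: theta_series_zero theta_coeff_shell shell_0 harmonic_def)
  show "harmonic_series u (- w) = harmonic_series u w" for w
    unfolding theta_series_def by (intro infsum_cong) (simp add: even_norm_nat even power_minus_even)
  have "harmonic_series u (nome \<tau>) = theta_harmonic u \<tau>" for \<tau>
    by (rule theta_series_nome [OF norm_eq_norm_nat])
  then show "harmonic_series u (nome (- 1 / \<tau>)) = \<tau> ^ 14 * harmonic_series u (nome \<tau>)" if "Im \<tau> > 0" for \<tau>
    using theta_harmonic_inversion [OF that] by (simp only:)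
qed

lemma sum_harmonic_roots: "(\<Sum>x\<in>shell L 2. harmonic u x) = 0"
proof -
  have "Abs_fps (theta_coeff norm_nat (harmonic u) L) = 0"
    by (rule weight14_cusp_form.fps_eq_0 [OF weight14_cusp_form_harmonic_series
      theta_series_has_fps_expansion [OF theta_summable_harmonic norm_eq_norm_nat]])
  then have "theta_coeff norm_nat (harmonic u) L 2 = 0" by (simp add: fps_eq_iff)
  then show ?thesis by (simp add: theta_coeff_shell)
qed

theorem eutactic_roots: "eutactic (shell L 2)"
  unfolding eutactic_def
proof (intro exI allI)
  fix u
  have "complex_of_real (\<Sum>x\<in>shell L 2. (x \<bullet> u)\<^sup>2 - (u \<bullet> u) * (x \<bullet> x) / 24) = 0"
    using sum_harmonic_roots [of u] by (simp add: harmonic_def)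
  then have "(\<Sum>x\<in>shell L 2. (x \<bullet> u)\<^sup>2 - (u \<bullet> u) * (x \<bullet> x) / 24) = 0" by (simp only: of_real_eq_0_iff)
  moreover have "(\<Sum>x\<in>shell L 2. (u \<bullet> u) * (x \<bullet> x) / 24) = (\<Sum>x\<in>shell L 2. (u \<bullet> u) / 12)"
    by (intro sum.cong) (auto simp: shell_def)
  ultimately show "(\<Sum>x\<in>shell L 2. (x \<bullet> u)\<^sup>2) = real (card (shell L 2)) / 12 * (u \<bullet> u)"
    by (simp add: sum_subtractf)
qed

theorem strongly_eutactic_roots: "strongly_eutactic (shell L 2)"
  using root_system_shell eutactic_roots by (rule eutactic_imp_strongly_eutactic)

end

section \<open>The shadow of an odd selfdual lattice\<close>

lemma i_times_power_12: "(\<i> * of_real t) ^ 12 = of_real (t ^ 12)"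
  using power_mult [of \<i> 2 6] by (simp add: power_mult_distrib)

context selfdual_lattice
begin

abbreviation theta_lattice :: "complex \<Rightarrow> complex" where
  "theta_lattice \<equiv> theta (\<lambda>x. x \<bullet> x) (\<lambda>_. 1) L"

lemma theta_lattice_holomorphic: "theta_lattice holomorphic_on {\<tau>. Im \<tau> > 0}"
  by (rule theta_holomorphic [OF theta_summable]) simp

lemma poisson_axis:
  assumes "t > 0"
  shows "(\<Sum>\<^sub>\<infinity>x\<in>L. complex_of_real (gauss (1 / t) (x + a))) =
    1 * (\<i> * of_real t) ^ 12 * (\<Sum>\<^sub>\<infinity>y\<in>L. of_real (gauss t y) * cis (2 * pi * (y \<bullet> a)))"
  unfolding i_times_power_12 using poisson [of "1 / t" a] assms by (simp add: power_divide)

lemma theta_lattice_inversion: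
  assumes "Im \<tau> > 0" shows "theta_lattice (- 1 / \<tau>) = \<tau> ^ 12 * theta_lattice \<tau>"
proof -
  have "theta_lattice (- 1 / \<tau>) = 1 * \<tau> ^ 12 * theta_lattice \<tau>"
  proof (rule inversion_from_imaginary_axis [OF theta_lattice_holomorphic theta_lattice_holomorphic _ assms])
    show "theta_lattice (\<i> * of_real (1 / t)) = 1 * (\<i> * of_real t) ^ 12 * theta_lattice (\<i> * of_real t)"
      if "t > 0" for t
      using poisson_axis [OF that, of 0] unfolding theta_axis_gauss by simp
  qed
  then show ?thesis by simp
qed

lemma lattice24_commensurable:
  assumes N: "add_subgroup N" and c: "c \<noteq> 0"
    and NL: "\<And>x. x \<in> N \<Longrightarrow> c *\<^sub>R x \<in> L" and LN: "\<And>x. x \<in> L \<Longrightarrow> c *\<^sub>R x \<in> N"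
  shows "lattice24 N"
proof -
  obtain B where B: "finite B" "independent B" "span B = UNIV" "L = int_span B" by (rule lattice_basis)
  have "add_subgroup ((\<lambda>x. c *\<^sub>R x) ` N)"
    using add_subgroup_zero [OF N] add_subgroup_diff [OF N]
    by (force simp: add_subgroup_def simp flip: scaleR_diff_right)
  moreover have "(\<lambda>x. c *\<^sub>R x) ` N \<subseteq> int_span B" using NL B(4) by blast
  ultimately obtain C where C: "finite C" "independent C" "(\<lambda>x. c *\<^sub>R x) ` N = int_span C"
    by (rule subgroup_of_lattice_has_basis [OF B(1,2)]) (rule that)
  define D where "D = (\<lambda>x. (1 / c) *\<^sub>R x) ` C"
  have inj: "inj (\<lambda>x::vec24. (1 / c) *\<^sub>R x)" using c by (simp add: inj_on_def)
  have linear: "linear (\<lambda>x::vec24. (1 / c) *\<^sub>R x)" by (rule linear_scaleR)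
  have "N = (\<lambda>x. (1 / c) *\<^sub>R x) ` int_span C" using c by (simp add: C(3) [symmetric] image_image)
  then have N_eq: "N = int_span D" unfolding D_def by (simp only: int_span_linear_image [OF linear inj])
  moreover have "independent D"
    unfolding D_def by (rule linear_independent_injective_image [OF linear C(2)])
      (rule inj_on_subset [OF inj subset_UNIV])
  moreover have "B \<subseteq> span D"
  proof
    fix b assume "b \<in> B"
    then have "c *\<^sub>R b \<in> N" using B LN int_span_base by blast
    then have "c *\<^sub>R b \<in> span D" using N_eq int_span_subset_span by blast
    then show "b \<in> span D" using c by (simp add: span_scaleR_iff)
  qed
  then have "span D = UNIV" using B(3) span_minimal [OF _ subspace_span] by blast
  ultimately show ?thesis using C(1) by (auto simp: lattice24_iff_int_span D_def)
qed

end

lemma Ints_half_shift: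
  fixes r :: real
  assumes "2 * r \<in> \<int>" "r \<notin> \<int>" shows "r - 1 / 2 \<in> \<int>"
proof -
  obtain k where k: "2 * r = of_int k" using assms(1) by (auto elim: Ints_cases)
  have "odd k"
  proof
    assume "even k"
    then obtain m where "k = 2 * m" by (rule evenE)
    then show False using k assms(2) by simp
  qed
  then obtain m where "k = 2 * m + 1" by (rule oddE)
  then have "r - 1 / 2 = of_int m" using k by (simp add: field_simps)
  then show ?thesis by simp
qed

locale odd_selfdual_lattice = selfdual_lattice +
  assumes odd: "odd_lattice L"
begin

lemma even_part_subset: "even_part L \<subseteq> L"
  by (auto simp: even_part_def)

lemma even_part_iff_even: "x \<in> L \<Longrightarrow> x \<bullet> x = of_int k \<Longrightarrow> x \<in> even_part L \<longleftrightarrow> even k"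
  by (auto simp: even_part_def)

lemma even_part_add_iff:
  assumes "x \<in> L" "y \<in> L"
  shows "x + y \<in> even_part L \<longleftrightarrow> (x \<in> even_part L \<longleftrightarrow> y \<in> even_part L)"
proof -
  obtain k l m where klm: "x \<bullet> x = of_int k" "y \<bullet> y = of_int l" "x \<bullet> y = of_int m"
    using inner_Ints assms by (meson Ints_cases)
  then have "(x + y) \<bullet> (x + y) = of_int (k + l + 2 * m)"
    by (simp add: inner_add_left inner_add_right inner_commute)
  then have "x + y \<in> even_part L \<longleftrightarrow> even (k + l + 2 * m)"
    by (rule even_part_iff_even [OF add_mem [OF assms]])
  then show ?thesis
    by (simp add: even_part_iff_even [OF assms(1) klm(1)] even_part_iff_even [OF assms(2) klm(2)])
qed

lemma uminus_even_part: "x \<in> even_part L \<Longrightarrow> - x \<in> even_part L"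
  by (auto simp: even_part_def uminus_mem)

lemma even_part_diff_iff:
  assumes "x \<in> L" "y \<in> L"
  shows "x - y \<in> even_part L \<longleftrightarrow> (x \<in> even_part L \<longleftrightarrow> y \<in> even_part L)"
  using even_part_add_iff [of x "- y"] assms uminus_mem uminus_even_part [of y] uminus_even_part [of "- y"]
  by auto

lemma add_subgroup_even_part: "add_subgroup (even_part L)"
  using even_part_subset even_part_diff_iff zero_mem by (auto simp: add_subgroup_def even_part_def)

lemma double_in_even_part: "x \<in> L \<Longrightarrow> 2 *\<^sub>R x \<in> even_part L"
  using even_part_add_iff [of x x] by (simp add: scaleR_2)

lemma even_part_iff_half_norm: "x \<in> L \<Longrightarrow> x \<in> even_part L \<longleftrightarrow> x \<bullet> x / 2 \<in> \<int>"
proof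
  assume "x \<in> L" "x \<bullet> x / 2 \<in> \<int>"
  then obtain m where "x \<bullet> x / 2 = of_int m" by (auto elim: Ints_cases)
  then have "x \<bullet> x = of_int (2 * m)" by simp
  from even_part_iff_even [OF \<open>x \<in> L\<close> this] show "x \<in> even_part L" by simp
qed (auto simp: even_part_def elim!: evenE)

lemma half_norm_odd:
  assumes "x \<in> L" "x \<notin> even_part L" shows "x \<bullet> x / 2 - 1 / 2 \<in> \<int>"
  using assms inner_Ints [of x x] by (intro Ints_half_shift) (auto simp: even_part_iff_half_norm)

lemma odd_vector: obtains x where "x \<in> L" "x \<notin> even_part L"
  using odd even_part_iff_even unfolding odd_lattice_def by metis

lemma shadow_inner_even_part: "v \<in> shadow L \<Longrightarrow> x \<in> even_part L \<Longrightarrow> x \<bullet> v \<in> \<int>"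
  by (simp add: shadow_def dual_set_def)

lemma shadow_notin: "v \<in> shadow L \<Longrightarrow> v \<notin> L"
  by (simp add: shadow_def)

lemma shadow_inner_odd_notin_Ints:
  assumes v: "v \<in> shadow L" and x: "x \<in> L" "x \<notin> even_part L" shows "x \<bullet> v \<notin> \<int>"
proof
  assume xv: "x \<bullet> v \<in> \<int>"
  have "z \<bullet> v \<in> \<int>" if z: "z \<in> L" for z
  proof (cases "z \<in> even_part L")
    case False
    then have "(z - x) \<bullet> v \<in> \<int>" using x z by (intro shadow_inner_even_part v) (simp add: even_part_diff_iff)
    then have "(z - x) \<bullet> v + x \<bullet> v \<in> \<int>" using xv by (rule Ints_add)
    then show ?thesis by (simp add: inner_diff_left)
  qed (rule shadow_inner_even_part [OF v])
  then have "v \<in> L" using mem_iff by blast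
  then show False using shadow_notin [OF v] by simp
qed

text \<open>Twice the shadow consists of the characteristic vectors of the lattice.\<close>

lemma shadow_iff: "v \<in> shadow L \<longleftrightarrow> (\<forall>x\<in>L. x \<bullet> v - x \<bullet> x / 2 \<in> \<int>)"
proof
  assume v: "v \<in> shadow L"
  show "\<forall>x\<in>L. x \<bullet> v - x \<bullet> x / 2 \<in> \<int>"
  proof
    fix x assume x: "x \<in> L"
    show "x \<bullet> v - x \<bullet> x / 2 \<in> \<int>"
    proof (cases "x \<in> even_part L")
      case True
      then show ?thesis using v x shadow_inner_even_part
        by (intro Ints_diff) (auto simp: even_part_iff_half_norm)
    next
      case False
      have "2 * (x \<bullet> v) \<in> \<int>" using shadow_inner_even_part [OF v double_in_even_part [OF x]] by simp
      then have "(x \<bullet> v - 1 / 2) - (x \<bullet> x / 2 - 1 / 2) \<in> \<int>"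
        using False x v
        by (intro Ints_diff [of "x \<bullet> v - 1 / 2"] Ints_half_shift half_norm_odd shadow_inner_odd_notin_Ints)
      then show ?thesis by simp
    qed
  qed
next
  assume v: "\<forall>x\<in>L. x \<bullet> v - x \<bullet> x / 2 \<in> \<int>"
  have inner_iff: "x \<bullet> v \<in> \<int> \<longleftrightarrow> x \<in> even_part L" if "x \<in> L" for x
  proof -
    have "x \<bullet> v \<in> \<int> \<longleftrightarrow> x \<bullet> x / 2 \<in> \<int>"
      using v that Ints_add [of "x \<bullet> v - x \<bullet> x / 2" "x \<bullet> x / 2"] Ints_diff [of "x \<bullet> v" "x \<bullet> v - x \<bullet> x / 2"]
      by auto
    then show ?thesis using even_part_iff_half_norm [OF that] by simp
  qed
  obtain z where "z \<in> L" "z \<notin> even_part L" by (rule odd_vector)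
  then have "v \<notin> L" using inner_iff inner_Ints by blast
  moreover have "v \<in> dual_set (even_part L)"
    using inner_iff even_part_subset unfolding dual_set_def by blast
  ultimately show "v \<in> shadow L" by (simp add: shadow_def)
qed

lemma shadow_nonempty: obtains w where "w \<in> shadow L"
proof -
  obtain B where B: "finite B" "independent B" "span B = UNIV" "L = int_span B" by (rule lattice_basis)
  obtain g :: "vec24 \<Rightarrow> real" where g: "linear g" "\<And>b. b \<in> B \<Longrightarrow> g b = b \<bullet> b / 2"
    using linear_independent_extend [OF B(2), of "\<lambda>b. b \<bullet> b / 2"] by blast
  define w where "w = adjoint g 1"
  have w: "x \<bullet> w = g x" for x
    unfolding w_def using adjoint_works [OF g(1), of x 1] by simp
  have "add_subgroup {x \<in> L. x \<bullet> w - x \<bullet> x / 2 \<in> \<int>}"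
    unfolding add_subgroup_def
  proof (intro conjI ballI)
    fix x y assume xy: "x \<in> {x \<in> L. x \<bullet> w - x \<bullet> x / 2 \<in> \<int>}" "y \<in> {x \<in> L. x \<bullet> w - x \<bullet> x / 2 \<in> \<int>}"
    then have "(x \<bullet> w - x \<bullet> x / 2) - (y \<bullet> w - y \<bullet> y / 2) + (x \<bullet> y - y \<bullet> y) \<in> \<int>"
      using inner_Ints
      by (intro Ints_add Ints_diff [of "x \<bullet> w - x \<bullet> x / 2"] Ints_diff [of "x \<bullet> y"]) auto
    moreover have "(x - y) \<bullet> w - (x - y) \<bullet> (x - y) / 2 =
        (x \<bullet> w - x \<bullet> x / 2) - (y \<bullet> w - y \<bullet> y / 2) + (x \<bullet> y - y \<bullet> y)"
      by (simp add: inner_diff_left inner_diff_right inner_commute field_simps)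
    ultimately show "x - y \<in> {x \<in> L. x \<bullet> w - x \<bullet> x / 2 \<in> \<int>}" using xy diff_mem by simp
  qed (simp add: zero_mem)
  moreover have "B \<subseteq> {x \<in> L. x \<bullet> w - x \<bullet> x / 2 \<in> \<int>}"
    by (auto simp: w g(2) B(4) int_span_base [OF B(1)])
  ultimately have "L \<subseteq> {x \<in> L. x \<bullet> w - x \<bullet> x / 2 \<in> \<int>}" unfolding B(4) by (rule int_span_minimal)
  then have "w \<in> shadow L" by (auto simp: shadow_iff)
  then show thesis by (rule that)
qed

lemma shadow_add_mem:
  assumes "v \<in> shadow L" "x \<in> L" shows "v + x \<in> shadow L"
  unfolding shadow_iff
proof
  fix z assume z: "z \<in> L"
  have "(z \<bullet> v - z \<bullet> z / 2) + z \<bullet> x \<in> \<int>"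
    using z assms inner_Ints by (intro Ints_add) (auto simp: shadow_iff)
  then show "z \<bullet> (v + x) - z \<bullet> z / 2 \<in> \<int>" by (simp add: inner_add_right algebra_simps)
qed

lemma shadow_diff:
  assumes "v \<in> shadow L" "w \<in> shadow L" shows "v - w \<in> L"
proof (subst mem_iff, intro ballI)
  fix z assume "z \<in> L"
  then have "(z \<bullet> v - z \<bullet> z / 2) - (z \<bullet> w - z \<bullet> z / 2) \<in> \<int>"
    using assms by (intro Ints_diff [of "z \<bullet> v - z \<bullet> z / 2"]) (auto simp: shadow_iff)
  then show "z \<bullet> (v - w) \<in> \<int>" by (simp add: inner_diff_right)
qed

lemma bij_betw_shadow: assumes "w \<in> shadow L" shows "bij_betw (\<lambda>x. x + w) L (shadow L)"
proof (rule bij_betwI [of _ _ _ "\<lambda>v. v - w"])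
  show "(\<lambda>x. x + w) \<in> L \<rightarrow> shadow L" using shadow_add_mem [OF assms] by (simp add: add.commute)
  show "(\<lambda>v. v - w) \<in> shadow L \<rightarrow> L" using shadow_diff [OF _ assms] by simp
qed auto

abbreviation theta_shadow :: "complex \<Rightarrow> complex" where
  "theta_shadow \<equiv> theta (\<lambda>x. x \<bullet> x) (\<lambda>_. 1) (shadow L)"

abbreviation theta_alternating :: "complex \<Rightarrow> complex" where
  "theta_alternating \<equiv> theta (\<lambda>x. x \<bullet> x) (alternating norm_nat) L"

lemma theta_summable_shadow: "theta_summable (\<lambda>x. x \<bullet> x) (\<lambda>_. 1) (shadow L)"
proof -
  obtain w where w: "w \<in> shadow L" by (rule shadow_nonempty)
  have "gauss r summable_on shadow L" if "r > 0" for r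
    by (subst summable_on_reindex_bij_betw [OF bij_betw_shadow [OF w], symmetric])
      (rule summable_gauss [OF that])
  then show ?thesis by (simp add: theta_summable_def gauss_def [abs_def])
qed

lemma theta_shadow_holomorphic: "theta_shadow holomorphic_on {\<tau>. Im \<tau> > 0}"
  by (rule theta_holomorphic [OF theta_summable_shadow]) simp

lemma theta_alternating_holomorphic: "theta_alternating holomorphic_on {\<tau>. Im \<tau> > 0}"
  by (rule theta_holomorphic [OF theta_summable_alternating [OF theta_summable]]) simp

lemma theta_lattice_add_1: "theta_lattice (\<tau> + 1) = theta_alternating \<tau>"
  by (rule theta_add_1) (rule norm_eq_norm_nat)

lemma theta_alternating_add_1: "theta_alternating (\<tau> + 1) = theta_lattice \<tau>"
proof -
  have "theta_alternating (\<tau> + 1) = theta_series norm_nat (alternating norm_nat) L (- nome \<tau>)"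
    by (simp only: theta_series_nome [OF norm_eq_norm_nat, symmetric] nome_add_1)
  also have "\<dots> = theta_lattice \<tau>"
    by (simp only: theta_series_alternating_minus theta_series_nome [OF norm_eq_norm_nat])
  finally show ?thesis .
qed

lemma cis_inner_shadow:
  assumes "x \<in> L" "w \<in> shadow L"
  shows "cis (2 * pi * (x \<bullet> w)) = alternating norm_nat x"
proof -
  have "cis (2 * pi * (x \<bullet> w)) = cis (2 * pi * (x \<bullet> w - x \<bullet> x / 2)) * cis (real (norm_nat x) * pi)"
    unfolding cis_mult norm_eq_norm_nat [OF assms(1)] by (simp add: algebra_simps)
  also have "cis (2 * pi * (x \<bullet> w - x \<bullet> x / 2)) = 1"
    using assms by (intro cis_multiple_2pi) (simp add: shadow_iff)
  finally show ?thesis by (simp flip: Complex.DeMoivre)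
qed

lemma theta_shadow_inversion:
  assumes "Im \<tau> > 0" shows "theta_shadow (- 1 / \<tau>) = \<tau> ^ 12 * theta_alternating \<tau>"
proof -
  obtain w where w: "w \<in> shadow L" by (rule shadow_nonempty)
  have "theta_shadow (- 1 / \<tau>) = 1 * \<tau> ^ 12 * theta_alternating \<tau>"
  proof (rule inversion_from_imaginary_axis [OF theta_alternating_holomorphic
    theta_shadow_holomorphic _ assms])
    fix t :: real assume t: "t > 0"
    have "theta_shadow (\<i> * of_real (1 / t)) = (\<Sum>\<^sub>\<infinity>x\<in>L. complex_of_real (gauss (1 / t) (x + w)))"
      unfolding theta_axis_gauss
      by (subst infsum_reindex_bij_betw [OF bij_betw_shadow [OF w], symmetric]) simp
    also have "\<dots> = 1 * (\<i> * of_real t) ^ 12 * theta_alternating (\<i> * of_real t)"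
      unfolding poisson_axis [OF t] theta_axis_gauss
      by (simp only: cis_inner_shadow [OF _ w] mult.commute [of "alternating norm_nat _"] cong: infsum_cong)
    finally show "theta_shadow (\<i> * of_real (1 / t)) =
        1 * (\<i> * of_real t) ^ 12 * theta_alternating (\<i> * of_real t)" .
  qed
  then show ?thesis by simp
qed

lemma theta_alternating_inversion:
  assumes "Im \<tau> > 0" shows "theta_alternating (- 1 / \<tau>) = \<tau> ^ 12 * theta_shadow \<tau>"
proof -
  have "\<tau> \<noteq> 0" using assms by auto
  then have "\<tau> ^ 12 * (- 1 / \<tau>) ^ 12 = 1" "- 1 / (- 1 / \<tau>) = \<tau>" by (simp_all add: power_divide)
  moreover have "theta_shadow (- 1 / (- 1 / \<tau>)) = (- 1 / \<tau>) ^ 12 * theta_alternating (- 1 / \<tau>)"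
    using theta_shadow_inversion [OF Im_inversion_pos [OF assms]] .
  ultimately show ?thesis by (simp only: mult.assoc [symmetric] mult_1)
qed

text \<open>With \<open>S\<close> for inversion and \<open>T\<close> for translation, this follows from the relation
  \<open>S T S = T\<^sup>-\<^sup>1 S T\<^sup>-\<^sup>1\<close> in the modular group.\<close>

lemma theta_shadow_add_1:
  assumes \<sigma>: "Im \<sigma> > 0" shows "theta_shadow (\<sigma> + 1) = theta_shadow \<sigma>"
proof -
  have nonzero: "\<sigma> \<noteq> 0" "\<sigma> + 1 \<noteq> 0" using \<sigma> by (auto simp: complex_eq_iff)
  define \<rho> where "\<rho> = - 1 / \<sigma> - 1"
  have \<rho>: "Im \<rho> > 0" using Im_inversion_pos [OF \<sigma>] by (simp add: \<rho>_def)
  then have "\<rho> \<noteq> 0" by auto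
  have \<rho>_eq: "\<rho> * \<sigma> = - (\<sigma> + 1)" using nonzero by (simp add: \<rho>_def field_simps)
  have "- 1 / (\<sigma> + 1) + 1 = - 1 / \<rho>"
    using nonzero \<open>\<rho> \<noteq> 0\<close> \<rho>_eq by (simp add: divide_simps) (simp add: algebra_simps)
  then have "theta_lattice (- 1 / \<rho>) = theta_alternating (- 1 / (\<sigma> + 1))"
    by (simp only: flip: theta_lattice_add_1)
  also have "\<dots> = (\<sigma> + 1) ^ 12 * theta_shadow (\<sigma> + 1)" by (rule theta_alternating_inversion) (simp add: \<sigma>)
  finally have "(\<sigma> + 1) ^ 12 * theta_shadow (\<sigma> + 1) = theta_lattice (- 1 / \<rho>)" by (rule sym)
  also have "\<dots> = \<rho> ^ 12 * theta_lattice \<rho>" by (rule theta_lattice_inversion [OF \<rho>])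
  also have "theta_lattice \<rho> = theta_alternating (- 1 / \<sigma>)"
    using theta_alternating_add_1 [of \<rho>] by (simp add: \<rho>_def)
  also have "\<rho> ^ 12 * theta_alternating (- 1 / \<sigma>) = (\<rho> * \<sigma>) ^ 12 * theta_shadow \<sigma>"
    by (simp only: theta_alternating_inversion [OF \<sigma>] power_mult_distrib mult.assoc)
  also have "(\<rho> * \<sigma>) ^ 12 = (\<sigma> + 1) ^ 12" unfolding \<rho>_eq by (rule power_minus_even) simp
  finally show ?thesis using nonzero by simp
qed

text \<open>At \<open>\<tau> = \<i>\<close> the invariance under translation is the vanishing of a series of nonnegative terms.\<close>

lemma shadow_norm_even:
  assumes "v \<in> shadow L" shows "v \<bullet> v / 2 \<in> \<int>"
proof -
  define f where "f x = gauss 1 x * (1 - cos (pi * (x \<bullet> x)))" for x :: vec24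
  have summable: "(\<lambda>x. 1 * exp (pi * \<i> * \<tau> * (x \<bullet> x))) summable_on shadow L" if "Im \<tau> > 0" for \<tau>
    by (rule theta_summable_imp_summable_on [OF theta_summable_shadow that])
  have "((\<lambda>x. 1 * exp (pi * \<i> * \<i> * (x \<bullet> x)) - 1 * exp (pi * \<i> * (\<i> + 1) * (x \<bullet> x))) has_sum
      (theta_shadow \<i> - theta_shadow (\<i> + 1))) (shadow L)"
    unfolding theta_def by (intro has_sum_diff has_sum_infsum summable) simp_all
  from has_sum_Re [OF this]
  have "(f has_sum 0) (shadow L)"
    by (simp add: theta_shadow_add_1 Re_exp f_def [abs_def] gauss_def algebra_simps)
  then have "f v = 0"
    using assms by (intro nonneg_has_sum_le_0D [of f "shadow L" 0]) (auto simp: f_def)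
  then have "cos (pi * (v \<bullet> v)) = 1" by (simp add: f_def gauss_def)
  then obtain n :: int where "pi * (v \<bullet> v) = of_int n * 2 * pi" by (auto simp: cos_one_2pi_int)
  then have "v \<bullet> v / 2 = of_int n" by simp
  then show ?thesis by simp
qed

end

section \<open>Even neighbours\<close>

context odd_selfdual_lattice
begin

definition neighbour :: "vec24 \<Rightarrow> vec24 set" where
  "neighbour w = {y. y \<in> even_part L \<or> y - w \<in> even_part L}"

lemma shadow_inner_Ints_iff:
  assumes "x \<in> L" "w \<in> shadow L" shows "x \<bullet> w \<in> \<int> \<longleftrightarrow> x \<in> even_part L"
  using assms shadow_inner_even_part shadow_inner_odd_notin_Ints by blast

lemma shadow_norm_Ints: assumes "w \<in> shadow L" shows "w \<bullet> w \<in> \<int>"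
proof -
  have "2 * (w \<bullet> w / 2) \<in> \<int>" by (intro Ints_mult Ints_numeral shadow_norm_even assms)
  then show ?thesis by simp
qed

lemma double_shadow_in_even_part:
  assumes "w \<in> shadow L" shows "2 *\<^sub>R w \<in> even_part L"
proof -
  have "2 *\<^sub>R w \<in> L"
  proof (subst mem_iff, intro ballI)
    fix z assume z: "z \<in> L"
    have "2 * (z \<bullet> w - z \<bullet> z / 2) + z \<bullet> z \<in> \<int>"
      using assms z inner_Ints [OF z z] by (intro Ints_add Ints_mult) (auto simp: shadow_iff)
    then show "z \<bullet> (2 *\<^sub>R w) \<in> \<int>" by simp
  qed
  moreover have "2 * (w \<bullet> w) \<in> \<int>" using shadow_norm_Ints [OF assms] by (intro Ints_mult) auto
  ultimately show ?thesis by (simp add: even_part_iff_half_norm)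
qed

lemma neighbour_imp_even_part_or_shadow:
  assumes "w \<in> shadow L" "x \<in> neighbour w" shows "x \<in> even_part L \<or> x \<in> shadow L"
  using assms shadow_add_mem [of w "x - w"] even_part_subset by (auto simp: neighbour_def)

lemma neighbour_inner_Ints:
  assumes w: "w \<in> shadow L" and "x \<in> neighbour w" "y \<in> neighbour w"
  shows "x \<bullet> y \<in> \<int>"
proof -
  have lattice_shadow: "a \<bullet> b \<in> \<int>" if "a \<in> even_part L" "b - w \<in> L" for a b
  proof -
    have "w + (b - w) \<in> shadow L" using w that by (intro shadow_add_mem)
    then show ?thesis using that shadow_inner_even_part by simp
  qed
  have shadow_shadow: "a \<bullet> b \<in> \<int>" if a: "a - w \<in> even_part L" and b: "b - w \<in> even_part L" for a b
  proof -
    have "(a - w) \<bullet> b + (b - w) \<bullet> w + w \<bullet> w \<in> \<int>"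
      using a b w even_part_subset by (intro Ints_add lattice_shadow shadow_norm_Ints) (auto simp: zero_mem)
    then show ?thesis by (simp add: inner_diff_left inner_commute [of b w])
  qed
  show ?thesis
    using assms(2,3) lattice_shadow [of x y] lattice_shadow [of y x]
      shadow_shadow [of x y] inner_Ints [of x y] even_part_subset
    by (auto simp: neighbour_def inner_commute)
qed

lemma dual_set_neighbour:
  assumes w: "w \<in> shadow L" shows "dual_set (neighbour w) = neighbour w"
proof (intro equalityI subsetI)
  fix y assume y: "y \<in> dual_set (neighbour w)"
  have "w \<in> neighbour w" using add_subgroup_zero [OF add_subgroup_even_part] by (simp add: neighbour_def)
  then have yw: "y \<bullet> w \<in> \<int>" using y by (auto simp: dual_set_def inner_commute)
  have "y \<in> dual_set (even_part L)" using y by (auto simp: dual_set_def neighbour_def)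
  then consider "y \<in> L" | "y \<in> shadow L" unfolding shadow_def by blast
  then show "y \<in> neighbour w"
  proof cases
    case 1
    then show ?thesis using yw w by (simp add: neighbour_def shadow_inner_Ints_iff)
  next
    case 2
    have "(y - w) \<bullet> w \<in> \<int>"
      unfolding inner_diff_left using yw shadow_norm_Ints [OF w] by (rule Ints_diff)
    then show ?thesis using shadow_diff [OF 2 w] w by (simp add: neighbour_def shadow_inner_Ints_iff)
  qed
qed (auto simp: dual_set_def neighbour_inner_Ints [OF w])

lemma add_subgroup_dual_set: "add_subgroup (dual_set A)"
  by (auto simp: add_subgroup_def dual_set_def inner_diff_right)

lemma lattice24_neighbour:
  assumes w: "w \<in> shadow L" shows "lattice24 (neighbour w)"
proof (rule lattice24_commensurable)
  show "add_subgroup (neighbour w)" using add_subgroup_dual_set [of "neighbour w"]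
    by (simp only: dual_set_neighbour [OF w])
  show "2 *\<^sub>R x \<in> neighbour w" if "x \<in> L" for x using double_in_even_part [OF that]
    by (simp add: neighbour_def)
  show "2 *\<^sub>R x \<in> L" if x: "x \<in> neighbour w" for x
    using neighbour_imp_even_part_or_shadow [OF w x] double_in_even_part
      double_shadow_in_even_part even_part_subset
    by blast
qed simp

theorem even_selfdual_neighbour:
  assumes w: "w \<in> shadow L" shows "even_selfdual_lattice (neighbour w)"
proof
  show "selfdual (neighbour w)"
    using lattice24_neighbour [OF w] neighbour_inner_Ints [OF w] dual_set_neighbour [OF w]
    by (simp add: selfdual_def integral_lattice_def)
  fix x assume x: "x \<in> neighbour w"
  then show "x \<bullet> x / 2 \<in> \<int>"
    using neighbour_imp_even_part_or_shadow [OF w] even_part_iff_half_norm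
      even_part_subset shadow_norm_even by blast
qed

lemma opposite_shadow_vectors:
  obtains v w where "v \<in> shadow L" "w \<in> shadow L" "v - w \<notin> even_part L"
proof -
  obtain w where w: "w \<in> shadow L" by (rule shadow_nonempty)
  obtain z where z: "z \<in> L" "z \<notin> even_part L" by (rule odd_vector)
  show thesis by (rule that [of "w + z" w]) (use w z shadow_add_mem in auto)
qed

lemma neighbour_minus_lattice: "w \<in> shadow L \<Longrightarrow> neighbour w - L = {x. x - w \<in> even_part L}"
  using shadow_add_mem [of w] shadow_notin even_part_subset by (fastforce simp: neighbour_def)

lemma neighbour_minus_lattice_subset_shadow: "w \<in> shadow L \<Longrightarrow> neighbour w - L \<subseteq> shadow L"
  using neighbour_imp_even_part_or_shadow even_part_subset by blast

lemma opposite_classes_diff: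
  assumes "v - w \<notin> even_part L" "x - v \<in> even_part L" "y - w \<in> even_part L"
  shows "x - y \<notin> even_part L"
proof
  assume "x - y \<in> even_part L"
  then have "(x - y) - (x - v) + (y - w) \<in> even_part L"
    using assms
    by (intro add_subgroup_add [of _ "(x - y) - (x - v)"] 
      add_subgroup_diff [of _ "x - y"] add_subgroup_even_part)
  then show False using assms(1) by simp
qed

lemma neighbour_Int:
  assumes "v \<in> shadow L" "w \<in> shadow L" "v - w \<notin> even_part L"
  shows "neighbour v \<inter> neighbour w = even_part L"
  using opposite_classes_diff [OF assms(3)] add_subgroup_zero [OF add_subgroup_even_part]
  by (fastforce simp: neighbour_def)

lemma shadow_eq_Un_neighbours:
  assumes v: "v \<in> shadow L" and w: "w \<in> shadow L" and "v - w \<notin> even_part L"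
  shows "shadow L = (neighbour v - L) \<union> (neighbour w - L)"
proof
  show "shadow L \<subseteq> (neighbour v - L) \<union> (neighbour w - L)"
  proof
    fix x assume x: "x \<in> shadow L"
    have "x - w = (x - v) + (v - w)" by simp
    then have "x - w \<in> even_part L \<longleftrightarrow> x - v \<notin> even_part L"
      using even_part_add_iff [OF shadow_diff [OF x v] shadow_diff [OF v w]] assms(3) by auto
    then show "x \<in> (neighbour v - L) \<union> (neighbour w - L)"
      using v w by (auto simp: neighbour_minus_lattice)
  qed
qed (use neighbour_minus_lattice_subset_shadow v w in blast)

lemma inner_opposite_shadow_vectors:
  assumes min: "\<And>x. x \<in> L \<Longrightarrow> x \<noteq> 0 \<Longrightarrow> 2 \<le> x \<bullet> x"
    and v: "v \<in> shadow L" "v \<bullet> v = 2" and w: "w \<in> shadow L" "w \<bullet> w = 2" and odd: "v - w \<notin> even_part L"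
  shows "v \<bullet> w = 1/2 \<or> v \<bullet> w = -1/2"
proof -
  have double: "2 *\<^sub>R w \<in> even_part L" by (rule double_shadow_in_even_part [OF w(1)])
  have diff: "v - w \<in> L" by (rule shadow_diff [OF v(1) w(1)])
  have add: "v + w \<in> L" "v + w \<notin> even_part L"
    using even_part_add_iff [OF diff, of "2 *\<^sub>R w"] add_mem [OF diff, of "2 *\<^sub>R w"] odd double even_part_subset
    by (auto simp: scaleR_2 algebra_simps)
  have "v - w \<noteq> 0" "v + w \<noteq> 0" using odd add(2) add_subgroup_zero [OF add_subgroup_even_part] by auto
  with min [OF diff] min [OF add(1)] have bounds: "- 1 \<le> v \<bullet> w" "v \<bullet> w \<le> 1"
    using v(2) w(2) by (simp_all add: inner_diff_left inner_diff_right
      inner_add_left inner_add_right inner_commute)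
  have "(v - w) \<bullet> (v - w) / 2 = 2 - v \<bullet> w"
    using v(2) w(2) by (simp add: inner_diff_left inner_diff_right inner_commute)
  then have "2 - v \<bullet> w - 1 / 2 \<in> \<int>" using half_norm_odd [OF diff odd] by (simp only:)
  then obtain k where k: "2 - v \<bullet> w - 1 / 2 = of_int k" by (rule Ints_cases)
  then have "real_of_int k \<ge> 1 / 2" "real_of_int k \<le> 5 / 2" using bounds by linarith+
  then have "k = 1 \<or> k = 2" by linarith
  then show ?thesis using k by auto
qed

end

section \<open>Jacobi theta functions\<close>

definition sq_nat :: "int \<Rightarrow> nat" where "sq_nat m = nat (m\<^sup>2)"
definition pronic_nat :: "int \<Rightarrow> nat" where "pronic_nat m = nat (m * (m + 1))"

lemma real_sq_nat: "(of_int m)\<^sup>2 = real (sq_nat m)"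
  by (simp add: sq_nat_def)

lemma int_pronic_nat: "int (pronic_nat m) = m * (m + 1)"
proof -
  have "m * (m + 1) \<ge> 0" by (cases "m \<ge> 0") (auto intro!: mult_nonpos_nonpos)
  then show ?thesis by (simp only: pronic_nat_def nat_0_le)
qed

lemma real_pronic_nat: "of_int m * (of_int m + 1) = real (pronic_nat m)"
  using arg_cong [OF int_pronic_nat, of real_of_int m] by simp

lemma even_pronic_nat: "even (pronic_nat m)"
proof -
  have "even (int (pronic_nat m))" unfolding int_pronic_nat by simp
  then show ?thesis by simp
qed

abbreviation theta2 :: "complex \<Rightarrow> complex" where
  "theta2 \<equiv> theta (\<lambda>m::int. (1 / 2 + of_int m)\<^sup>2) (\<lambda>_. 1) UNIV"

abbreviation theta3 :: "complex \<Rightarrow> complex" where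
  "theta3 \<equiv> theta (\<lambda>m::int. (of_int m)\<^sup>2) (\<lambda>_. 1) UNIV"

abbreviation theta4 :: "complex \<Rightarrow> complex" where
  "theta4 \<equiv> theta (\<lambda>m::int. (of_int m)\<^sup>2) (alternating sq_nat) UNIV"

lemma theta_summable_int:
  fixes x :: real
  shows "theta_summable (\<lambda>m::int. (x + of_int m)\<^sup>2) (\<lambda>_. 1) UNIV"
  using summable_on_gauss_int [of _ x] by (simp add: theta_summable_def gauss_def power2_eq_square)

lemmas theta_summable_jacobi = theta_summable_int [of "1 / 2"] theta_summable_int [of 0, simplified]
  theta_summable_alternating [OF theta_summable_int [of 0, simplified], of sq_nat]

lemma gauss_int_inversion:
  fixes x t :: real
  assumes "t > 0"
  shows "(\<Sum>\<^sub>\<infinity>m::int. complex_of_real (gauss (1 / t) (x + of_int m))) =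
    of_real (sqrt t) * (\<Sum>\<^sub>\<infinity>k::int. of_real (gauss t (real_of_int k)) * cis (2 * pi * x * of_int k))"
  using poisson_gauss_int [of "1 / t" x 0] assms by (simp add: real_sqrt_divide)

lemma theta_int_axis:
  "theta (\<lambda>m::int. (x + of_int m)\<^sup>2) c UNIV (\<i> * of_real t) = (\<Sum>\<^sub>\<infinity>m. c m * of_real (gauss t (x + of_int m)))"
  by (simp add: theta_imaginary_axis gauss_def power2_eq_square)

lemma cis_pi_times_int: "cis (pi * of_int m) = alternating sq_nat m"
proof (cases "even m")
  case True
  then obtain k where "m = 2 * k" by (rule evenE)
  then show ?thesis using True cis_2pi_of_int [of k] by (simp add: sq_nat_def even_nat_iff mult_ac)
next
  case False
  then obtain k where m: "m = 2 * k + 1" by (rule oddE)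
  have "cis (pi * of_int m) = cis (2 * pi * of_int k) * cis pi"
    unfolding cis_mult m by (simp add: algebra_simps)
  then show ?thesis using False by (simp add: sq_nat_def even_nat_iff)
qed

lemma theta3_axis: "t > 0 \<Longrightarrow> theta3 (\<i> * of_real (1 / t)) = of_real (sqrt t) * theta3 (\<i> * of_real t)"
  using gauss_int_inversion [of t 0] theta_int_axis [of 0 "\<lambda>_. 1"] by (simp del: of_real_divide)

lemma theta2_axis: "t > 0 \<Longrightarrow> theta2 (\<i> * of_real (1 / t)) = of_real (sqrt t) * theta4 (\<i> * of_real t)"
  using gauss_int_inversion [of t "1 / 2"] theta_int_axis [of "1 / 2" "\<lambda>_. 1"]
    theta_int_axis [of 0 "alternating sq_nat"]
  by (simp add: cis_pi_times_int mult.commute del: of_real_divide)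

lemma fourth_power_inversion:
  assumes f: "f holomorphic_on {\<tau>. Im \<tau> > 0}" and g: "g holomorphic_on {\<tau>. Im \<tau> > 0}"
    and axis: "\<And>t. t > 0 \<Longrightarrow> g (\<i> * of_real (1 / t)) = of_real (sqrt t) * f (\<i> * of_real t)" and \<tau>: "Im \<tau> > 0"
  shows "g (- 1 / \<tau>) ^ 4 = - (\<tau>\<^sup>2) * f \<tau> ^ 4"
proof -
  have "g (- 1 / \<tau>) ^ 4 = - 1 * \<tau> ^ 2 * f \<tau> ^ 4"
  proof (rule inversion_from_imaginary_axis [where f = "\<lambda>\<tau>. f \<tau> ^ 4" and g = "\<lambda>\<tau>. g \<tau> ^ 4", OF _ _ _ \<tau>])
    fix t :: real assume t: "t > 0"
    have "complex_of_real (sqrt t) ^ 4 = of_real ((sqrt t ^ 2) ^ 2)" by (simp flip: power_mult)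
    also have "\<dots> = - 1 * (\<i> * of_real t)\<^sup>2" using t by (simp add: power_mult_distrib)
    finally show "g (\<i> * of_real (1 / t)) ^ 4 = - 1 * (\<i> * of_real t)\<^sup>2 * f (\<i> * of_real t) ^ 4"
      by (simp only: axis [OF t] power_mult_distrib)
  qed (intro holomorphic_intros f g)+
  then show ?thesis by simp
qed

lemma jacobi_holomorphic:
  "theta2 holomorphic_on {\<tau>. Im \<tau> > 0}" "theta3 holomorphic_on {\<tau>. Im \<tau> > 0}"
  "theta4 holomorphic_on {\<tau>. Im \<tau> > 0}"
  by (intro theta_holomorphic theta_summable_jacobi; simp)+

lemma theta3_inversion: "Im \<tau> > 0 \<Longrightarrow> theta3 (- 1 / \<tau>) ^ 4 = - (\<tau>\<^sup>2) * theta3 \<tau> ^ 4"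
  by (rule fourth_power_inversion [OF jacobi_holomorphic(2,2) theta3_axis])

lemma theta2_inversion: "Im \<tau> > 0 \<Longrightarrow> theta2 (- 1 / \<tau>) ^ 4 = - (\<tau>\<^sup>2) * theta4 \<tau> ^ 4"
  by (rule fourth_power_inversion [OF jacobi_holomorphic(3,1) theta2_axis])

lemma theta4_inversion:
  assumes \<tau>: "Im \<tau> > 0" shows "theta4 (- 1 / \<tau>) ^ 4 = - (\<tau>\<^sup>2) * theta2 \<tau> ^ 4"
proof -
  have "\<tau> \<noteq> 0" using \<tau> by auto
  then have "\<tau>\<^sup>2 * (- 1 / \<tau>)\<^sup>2 = 1" "- 1 / (- 1 / \<tau>) = \<tau>" by (simp_all add: power_divide)
  moreover have "theta2 (- 1 / (- 1 / \<tau>)) ^ 4 = - ((- 1 / \<tau>)\<^sup>2) * theta4 (- 1 / \<tau>) ^ 4"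
    by (rule theta2_inversion [OF Im_inversion_pos [OF \<tau>]])
  ultimately show ?thesis by (simp only: minus_mult_minus mult.assoc [symmetric] mult_1)
qed

text \<open>In terms of the nome \<open>w\<close>, \<open>theta3\<close> and \<open>theta4\<close> are power series in \<open>w\<close>, whereas \<open>theta2\<close> is
  a fourth root of \<open>w\<close> times such a series.\<close>

abbreviation series2 :: "complex \<Rightarrow> complex" where
  "series2 \<equiv> theta_series pronic_nat (\<lambda>_. 1) UNIV"

abbreviation series3 :: "complex \<Rightarrow> complex" where
  "series3 \<equiv> theta_series sq_nat (\<lambda>_. 1) UNIV"

abbreviation series4 :: "complex \<Rightarrow> complex" where
  "series4 \<equiv> theta_series sq_nat (alternating sq_nat) UNIV"

lemma theta_summable_pronic: "theta_summable (\<lambda>m::int. of_int m * (of_int m + 1)) (\<lambda>_. 1) UNIV"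
  unfolding theta_summable_def
proof (intro allI impI)
  fix r :: real assume r: "r > 0"
  have "exp (pi * r / 4) * (norm (1::complex) * exp (- pi * r * (1 / 2 + of_int m)\<^sup>2)) =
      norm (1::complex) * exp (- pi * r * (of_int m * (of_int m + 1)))" for m :: int
    by (simp add: exp_add [symmetric] power2_eq_square field_simps)
  moreover have "(\<lambda>m::int. exp (pi * r / 4) *
      (norm (1::complex) * exp (- pi * r * (1 / 2 + of_int m)\<^sup>2))) summable_on UNIV"
    by (intro summable_on_cmult_right theta_summableD [OF theta_summable_jacobi(1) r])
  ultimately show "(\<lambda>m::int. norm (1::complex) * exp (- pi * r * (of_int m * (of_int m + 1)))) summable_on
      UNIV"
    by (simp only:)
qed

lemmas jacobi_series_has_fps_expansion =
  theta_series_has_fps_expansion [OF theta_summable_pronic real_pronic_nat]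
  theta_series_has_fps_expansion [OF theta_summable_jacobi(2) real_sq_nat]
  theta_series_has_fps_expansion [OF theta_summable_jacobi(3) real_sq_nat]

lemmas jacobi_series_holomorphic =
  theta_series_holomorphic [OF theta_summable_pronic real_pronic_nat]
  theta_series_holomorphic [OF theta_summable_jacobi(2) real_sq_nat]
  theta_series_holomorphic [OF theta_summable_jacobi(3) real_sq_nat]

lemma series3_nome: "series3 (nome \<tau>) = theta3 \<tau>" and series4_nome: "series4 (nome \<tau>) = theta4 \<tau>"
  by (simp_all add: theta_series_nome real_sq_nat)

lemma series2_nome: "nome \<tau> * series2 (nome \<tau>) ^ 4 = theta2 \<tau> ^ 4"
proof -
  have "theta2 \<tau> = exp (pi * \<i> * \<tau> / 4) * theta (\<lambda>m::int. of_int m * (of_int m + 1)) (\<lambda>_. 1) UNIV \<tau>"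
    unfolding theta_def infsum_cmult_right' [symmetric]
    by (intro infsum_cong) (simp add: exp_add [symmetric] power2_eq_square field_simps)
  also have "theta (\<lambda>m::int. of_int m * (of_int m + 1)) (\<lambda>_. 1) UNIV \<tau> = series2 (nome \<tau>)"
    by (rule theta_series_nome [symmetric]) (rule real_pronic_nat)
  finally show ?thesis by (simp add: power_mult_distrib nome_def exp_of_nat_mult [symmetric])
qed

lemma series2_minus: "series2 (- w) = series2 w"
  by (simp add: theta_series_minus) (simp add: even_pronic_nat)

lemma jacobi_coeffs:
  "theta_coeff sq_nat (\<lambda>_. 1) UNIV 0 = 1" "theta_coeff sq_nat (\<lambda>_. 1) UNIV 1 = 2"
  "theta_coeff sq_nat (\<lambda>_. 1) UNIV 2 = 0"
  "theta_coeff pronic_nat (\<lambda>_. 1) UNIV 0 = 2" "theta_coeff pronic_nat (\<lambda>_. 1) UNIV 1 = 0"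
proof -
  have sq: "sq_nat m = k \<longleftrightarrow> m\<^sup>2 = int k" for m k by (auto simp: sq_nat_def)
  have not_2: "m\<^sup>2 \<noteq> 2" for m :: int
  proof
    assume m: "m\<^sup>2 = 2"
    then have "\<bar>m\<bar> < 2" by (intro power2_less_imp_less [of "\<bar>m\<bar>" 2]) auto
    then have "m = - 1 \<or> m = 0 \<or> m = 1" by linarith
    then show False using m by auto
  qed
  have "pronic_nat m = 0 \<longleftrightarrow> m = 0 \<or> m = - 1" for m
    using int_pronic_nat [of m] by auto
  moreover have "pronic_nat m \<noteq> 1" for m
    using even_pronic_nat [of m] by auto
  ultimately have sets: "{m \<in> UNIV. sq_nat m = 0} = {0}"
    "{m \<in> UNIV. sq_nat m = 1} = {1, - 1}" "{m \<in> UNIV. sq_nat m = 2} = {}"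
    "{m \<in> UNIV. pronic_nat m = 0} = {0, - 1}" "{m \<in> UNIV. pronic_nat m = 1} = {}"
    using not_2 by (auto simp: sq power2_eq_1_iff)
  show "theta_coeff sq_nat (\<lambda>_. 1) UNIV 0 = 1" "theta_coeff sq_nat (\<lambda>_. 1) UNIV 1 = 2"
    "theta_coeff sq_nat (\<lambda>_. 1) UNIV 2 = 0"
    "theta_coeff pronic_nat (\<lambda>_. 1) UNIV 0 = 2" "theta_coeff pronic_nat (\<lambda>_. 1) UNIV 1 = 0"
    unfolding theta_coeff_def sets by simp_all
qed

section \<open>Counting shadow vectors of norm 2\<close>

lemma fps_mult_nth_2: "fps_nth (f * g) 2 = fps_nth f 0 * fps_nth g 2 +
    fps_nth f 1 * fps_nth g 1 + fps_nth f 2 * fps_nth g 0"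
  by (simp add: fps_mult_nth numeral_2_eq_2)

lemma fps_power_low_coeffs:
  fixes f :: "'a::field_char_0 fps"
  assumes "fps_nth f 0 = 1"
  shows "fps_nth (f ^ n) 1 = of_nat n * fps_nth f 1"
    and "fps_nth (f ^ n) 2 = of_nat n * fps_nth f 2 + of_nat n * (of_nat n - 1) / 2 * (fps_nth f 1)\<^sup>2"
proof (induction n)
  case (Suc n)
  have zero: "fps_nth (f ^ n) 0 = 1" by (simp add: assms fps_nth_power_0)
  {
    case 1
    show ?case unfolding power_Suc fps_mult_nth_1 Suc.IH zero assms by (simp add: algebra_simps)
  next
    case 2
    show ?case unfolding power_Suc fps_mult_nth_2 Suc.IH zero assms
      by (simp add: field_simps power2_eq_square)
  }
qed simp_all

definition jacobi_fps2 :: "complex fps" where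
  "jacobi_fps2 = fps_X * Abs_fps (theta_coeff pronic_nat (\<lambda>_. 1) UNIV) ^ 4"

definition jacobi_fps3 :: "complex fps" where
  "jacobi_fps3 = Abs_fps (theta_coeff sq_nat (\<lambda>_. 1) UNIV)"

definition jacobi_fps4 :: "complex fps" where
  "jacobi_fps4 = Abs_fps (theta_coeff sq_nat (alternating sq_nat) UNIV)"

lemma jacobi_fps_coeffs:
  "fps_nth jacobi_fps2 0 = 0" "fps_nth jacobi_fps2 1 = 16" "fps_nth jacobi_fps2 2 = 0"
  "fps_nth jacobi_fps3 0 = 1" "fps_nth jacobi_fps3 1 = 2" "fps_nth jacobi_fps3 2 = 0"
  "fps_nth jacobi_fps4 0 = 1" "fps_nth jacobi_fps4 1 = - 2" "fps_nth jacobi_fps4 2 = 0"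
  by (simp_all only: jacobi_fps2_def jacobi_fps3_def jacobi_fps4_def power4_eq_xxxx fps_nth_Abs_fps
      fps_mult_nth_0 fps_mult_nth_1 fps_mult_nth_2 theta_coeff_alternating jacobi_coeffs) simp_all

lemma jacobi_fps2_power_6_coeffs:
  "fps_nth (jacobi_fps2 ^ 6) 0 = 0" "fps_nth (jacobi_fps2 ^ 6) 1 = 0" "fps_nth (jacobi_fps2 ^ 6) 2 = 0"
proof -
  have "jacobi_fps2 ^ 6 = jacobi_fps2 ^ 3 * jacobi_fps2 ^ 3" by (simp flip: power_add)
  then show "fps_nth (jacobi_fps2 ^ 6) 0 = 0" "fps_nth (jacobi_fps2 ^ 6) 1 = 0"
    "fps_nth (jacobi_fps2 ^ 6) 2 = 0"
    by (simp_all only: power3_eq_cube fps_mult_nth_0 fps_mult_nth_1 fps_mult_nth_2 jacobi_fps_coeffs) simp_all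
qed

lemmas jacobi_fps_power_coeffs = jacobi_fps2_power_6_coeffs
  fps_power_low_coeffs [OF jacobi_fps_coeffs(4)] fps_power_low_coeffs [OF jacobi_fps_coeffs(7)]

context odd_selfdual_lattice
begin

abbreviation lattice_series :: "complex \<Rightarrow> complex" where
  "lattice_series \<equiv> theta_series norm_nat (\<lambda>_. 1) L"

abbreviation alternating_series :: "complex \<Rightarrow> complex" where
  "alternating_series \<equiv> theta_series norm_nat (alternating norm_nat) L"

abbreviation shadow_series :: "complex \<Rightarrow> complex" where
  "shadow_series \<equiv> theta_series norm_nat (\<lambda>_. 1) (shadow L)"

lemma shadow_norm_eq_norm_nat: "v \<in> shadow L \<Longrightarrow> v \<bullet> v = real (norm_nat v)"
  by (simp add: real_norm_nat shadow_norm_Ints)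

lemmas lattice_series_has_fps_expansion =
  theta_series_has_fps_expansion [OF theta_summable norm_eq_norm_nat]
  theta_series_has_fps_expansion [OF theta_summable_alternating [OF theta_summable, of norm_nat]
    norm_eq_norm_nat]
  theta_series_has_fps_expansion [OF theta_summable_shadow shadow_norm_eq_norm_nat]

lemmas lattice_series_holomorphic =
  theta_series_holomorphic [OF theta_summable norm_eq_norm_nat]
  theta_series_holomorphic [OF theta_summable_alternating [OF theta_summable, of norm_nat] norm_eq_norm_nat]
  theta_series_holomorphic [OF theta_summable_shadow shadow_norm_eq_norm_nat]

lemma lattice_series_nome:
  "lattice_series (nome \<tau>) = theta_lattice \<tau>" "alternating_series (nome \<tau>) = theta_alternating \<tau>"
  "shadow_series (nome \<tau>) = theta_shadow \<tau>"
  by (intro theta_series_nome norm_eq_norm_nat shadow_norm_eq_norm_nat; assumption)+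

lemma shadow_series_minus: "shadow_series (- w) = shadow_series w"
  unfolding theta_series_def
  by (intro infsum_cong) (simp add: even_norm_nat shadow_norm_even power_minus_even)

lemma finite_shell_shadow: "finite (shell (shadow L) m)"
  using theta_summable_finite_shell [OF theta_summable_shadow] by (simp add: shell_def)

lemma theta_coeff_shadow: "theta_coeff norm_nat (\<lambda>_. 1) (shadow L) k =
    of_nat (card (shell (shadow L) (real k)))"
  by (simp add: theta_coeff_norm_nat shadow_norm_Ints finite_shell_shadow)

lemma shell_shadow_0: "shell (shadow L) 0 = {}"
  using shadow_notin zero_mem by (auto simp: shell_def)

lemma shell_shadow_1: "shell (shadow L) 1 = {}"
  using shadow_norm_even by (force simp: shell_def)

text \<open>The weight 2 factors are multiples of the theta function of \<open>D\<^sub>4\<close> and its conjugates; subtracting the powers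
  of the Jacobi thetas, which are the theta functions of \<open>\<int>\<^sup>2\<^sup>4\<close> and of its shadow, removes the constant term.\<close>

definition cusp_series :: "complex \<Rightarrow> complex" where
  "cusp_series w = (shadow_series w - (w * series2 w ^ 4) ^ 6) * (series3 w ^ 4 + series4 w ^ 4)
     - (alternating_series w - series4 w ^ 24) * (series3 w ^ 4 + w * series2 w ^ 4)
     - (lattice_series w - series3 w ^ 24) * (series4 w ^ 4 - w * series2 w ^ 4)"

lemma cusp_series_nome:
  "cusp_series (nome \<tau>) = (theta_shadow \<tau> - (theta2 \<tau> ^ 4) ^ 6) * (theta3 \<tau> ^ 4 + theta4 \<tau> ^ 4)
     - (theta_alternating \<tau> - (theta4 \<tau> ^ 4) ^ 6) * (theta3 \<tau> ^ 4 + theta2 \<tau> ^ 4)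
     - (theta_lattice \<tau> - (theta3 \<tau> ^ 4) ^ 6) * (theta4 \<tau> ^ 4 - theta2 \<tau> ^ 4)"
  unfolding cusp_series_def lattice_series_nome series2_nome series3_nome series4_nome
  by (simp flip: power_mult)

lemma cusp_series_inversion:
  assumes \<tau>: "Im \<tau> > 0" shows "cusp_series (nome (- 1 / \<tau>)) = \<tau> ^ 14 * cusp_series (nome \<tau>)"
proof -
  have "(\<tau> ^ 12 * m - (- (\<tau>\<^sup>2) * b) ^ 6) * (- (\<tau>\<^sup>2) * a + - (\<tau>\<^sup>2) * c)
     - (\<tau> ^ 12 * s - (- (\<tau>\<^sup>2) * c) ^ 6) * (- (\<tau>\<^sup>2) * a + - (\<tau>\<^sup>2) * b)
     - (\<tau> ^ 12 * l - (- (\<tau>\<^sup>2) * a) ^ 6) * (- (\<tau>\<^sup>2) * c - - (\<tau>\<^sup>2) * b)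
   = \<tau> ^ 14 * ((s - c ^ 6) * (a + b) - (m - b ^ 6) * (a + c) - (l - a ^ 6) * (b - c))" for a b c l m s
  proof -
    have "(- (\<tau>\<^sup>2) * z) ^ 6 = \<tau> ^ 12 * z ^ 6" for z :: complex
      by (simp add: power_mult_distrib flip: power_mult)
    moreover have "\<tau> ^ 14 = \<tau> ^ 12 * \<tau>\<^sup>2" by (simp flip: power_add)
    ultimately show ?thesis by (simp only:) (simp add: algebra_simps)
  qed
  then show ?thesis
    unfolding cusp_series_nome theta_shadow_inversion [OF \<tau>] theta_alternating_inversion [OF \<tau>]
      theta_lattice_inversion [OF \<tau>]
      theta2_inversion [OF \<tau>] theta3_inversion [OF \<tau>] theta4_inversion [OF \<tau>] .
qed

lemma weight14_cusp_form_cusp_series: "weight14_cusp_form cusp_series"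
proof
  show "cusp_series holomorphic_on ball 0 1"
    unfolding cusp_series_def [abs_def]
    by (intro holomorphic_intros lattice_series_holomorphic jacobi_series_holomorphic)
  show "cusp_series 0 = 0"
    by (simp add: cusp_series_def theta_series_zero jacobi_coeffs
      theta_coeff_alternating theta_coeff_shell theta_coeff_shadow
      shell_0 shell_shadow_0)
  show "cusp_series (- w) = cusp_series w" for w
    unfolding cusp_series_def theta_series_alternating_minus shadow_series_minus
      series2_minus theta_series_minus [of norm_nat L]
      theta_series_minus [of sq_nat]
    by (simp add: algebra_simps)
qed (rule cusp_series_inversion)

definition cusp_fps :: "complex fps" where
  "cusp_fps = (Abs_fps (theta_coeff norm_nat (\<lambda>_. 1) (shadow L)) - jacobi_fps2 ^ 6)
       * (jacobi_fps3 ^ 4 + jacobi_fps4 ^ 4)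
     - (Abs_fps (theta_coeff norm_nat (alternating norm_nat) L) - jacobi_fps4 ^ 24)
       * (jacobi_fps3 ^ 4 + jacobi_fps2)
     - (Abs_fps (theta_coeff norm_nat (\<lambda>_. 1) L) - jacobi_fps3 ^ 24) * (jacobi_fps4 ^ 4 - jacobi_fps2)"

lemma cusp_fps_eq_0: "cusp_fps = 0"
proof (rule weight14_cusp_form.fps_eq_0 [OF weight14_cusp_form_cusp_series])
  show "cusp_series has_fps_expansion cusp_fps"
    unfolding cusp_series_def [abs_def] cusp_fps_def jacobi_fps2_def jacobi_fps3_def jacobi_fps4_def
    by (intro has_fps_expansion_diff has_fps_expansion_mult has_fps_expansion_add has_fps_expansion_power
        has_fps_expansion_fps_X lattice_series_has_fps_expansion jacobi_series_has_fps_expansion)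
qed

lemma cusp_fps_nth_2:
  assumes "shell L 1 = {}"
  shows "fps_nth cusp_fps 2 = 2 * of_nat (card (shell (shadow L) 2)) - 2 * of_nat (card (shell L 2)) - 96"
proof -
  have lattice: "theta_coeff norm_nat (\<lambda>_. 1) L 0 = 1" "theta_coeff norm_nat (\<lambda>_. 1) L 1 = 0"
      "theta_coeff norm_nat (\<lambda>_. 1) L 2 = of_nat (card (shell L 2))"
    using assms by (simp_all add: theta_coeff_shell shell_0)
  have shadow: "theta_coeff norm_nat (\<lambda>_. 1) (shadow L) 0 = 0" "theta_coeff norm_nat (\<lambda>_. 1) (shadow L) 1 = 0"
      "theta_coeff norm_nat (\<lambda>_. 1) (shadow L) 2 = of_nat (card (shell (shadow L) 2))"
    by (simp_all add: theta_coeff_shadow shell_shadow_0 shell_shadow_1)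
  show ?thesis
    unfolding cusp_fps_def fps_mult_nth_2 fps_sub_nth fps_add_nth fps_nth_Abs_fps theta_coeff_alternating
      fps_nth_power_0 jacobi_fps_power_coeffs jacobi_fps_coeffs lattice shadow
    by simp
qed

theorem card_shadow_shell:
  assumes "shell L 1 = {}"
  shows "card (shell (shadow L) 2) = card (shell L 2) + 48"
proof -
  have "complex_of_nat (2 * card (shell (shadow L) 2)) = of_nat (2 * card (shell L 2) + 96)"
    using cusp_fps_nth_2 [OF assms] by (simp add: cusp_fps_eq_0 algebra_simps)
  then have "2 * card (shell (shadow L) 2) = 2 * card (shell L 2) + 96" by (simp only: of_nat_eq_iff)
  then show ?thesis by simp
qed

end

section \<open>The two root systems\<close>

lemma shell_Int: "shell (A \<inter> B) m = shell A m \<inter> shell B m"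
  and shell_Un: "shell (A \<union> B) m = shell A m \<union> shell B m"
  and shell_Diff: "shell (A - B) m = shell A m - shell B m"
  by (auto simp: shell_def)

lemma strongly_eutactic_half_inner_iff:
  assumes R: "root_system_norm2 R" and S: "root_system_norm2 S" and T: "root_system_norm2 T" and "R = S \<inter> T"
    and eutactic: "strongly_eutactic S" "strongly_eutactic T"
    and half: "\<forall>s\<in>S - R. \<forall>t\<in>T - R. s \<bullet> t = 1/2 \<or> s \<bullet> t = -1/2"
  shows "(T = R \<or> S = R) \<longleftrightarrow> strongly_eutactic R"
proof
  assume "strongly_eutactic R"
  then have "eutactic R" "eutactic T" using R T eutactic by (simp_all add: strongly_eutactic_iff_eutactic)
  then show "T = R \<or> S = R"
    using S T \<open>R = S \<inter> T\<close> half by (intro eutactic_half_inner_imp_eq) (auto simp: root_system_norm2_def)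
qed (use eutactic in auto)

context odd_selfdual_lattice
begin

lemma shell_even_part_2: "shell (even_part L) 2 = shell L 2"
  using even_part_subset even_part_iff_half_norm by (auto simp: shell_def)

lemma shell_neighbour_Int:
  assumes "v \<in> shadow L" "w \<in> shadow L" "v - w \<notin> even_part L"
  shows "shell (neighbour v) 2 \<inter> shell (neighbour w) 2 = shell L 2"
  by (simp only: neighbour_Int [OF assms] shell_even_part_2 flip: shell_Int)

lemma shell_shadow_eq_Un_neighbours:
  assumes "v \<in> shadow L" "w \<in> shadow L" "v - w \<notin> even_part L"
  shows "shell (shadow L) 2 = (shell (neighbour v) 2 - shell L 2) \<union> (shell (neighbour w) 2 - shell L 2)"
  by (simp only: shadow_eq_Un_neighbours [OF assms] shell_Diff shell_Un)

lemma inner_shell_neighbours: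
  assumes min: "\<And>x. x \<in> L \<Longrightarrow> x \<noteq> 0 \<Longrightarrow> 2 \<le> x \<bullet> x"
    and vw: "v \<in> shadow L" "w \<in> shadow L" "v - w \<notin> even_part L"
    and s: "s \<in> shell (neighbour v) 2 - shell L 2" and t: "t \<in> shell (neighbour w) 2 - shell L 2"
  shows "s \<bullet> t = 1/2 \<or> s \<bullet> t = -1/2"
proof (rule inner_opposite_shadow_vectors [OF min])
  have st: "s \<in> neighbour v - L" "t \<in> neighbour w - L" using s t by (auto simp: shell_def)
  then show "s \<in> shadow L" "t \<in> shadow L" using vw neighbour_minus_lattice_subset_shadow by blast+
  show "s - t \<notin> even_part L"
    using opposite_classes_diff [OF vw(3)] st vw by (simp add: neighbour_minus_lattice)
qed (use s t in \<open>auto simp: shell_def\<close>)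

lemma card_shell_neighbours:
  assumes "shell L 1 = {}" and vw: "v \<in> shadow L" "w \<in> shadow L" "v - w \<notin> even_part L"
  shows "card (shell (neighbour v) 2) + card (shell (neighbour w) 2) = 3 * card (shell L 2) + 48"
proof -
  let ?R = "shell L 2" and ?S = "shell (neighbour v) 2" and ?T = "shell (neighbour w) 2"
  interpret V: even_selfdual_lattice "neighbour v" by (rule even_selfdual_neighbour [OF vw(1)])
  interpret W: even_selfdual_lattice "neighbour w" by (rule even_selfdual_neighbour [OF vw(2)])
  have finite: "finite ?S" "finite ?T" by (rule V.finite_shell W.finite_shell)+
  have Int: "?S \<inter> ?T = ?R" by (rule shell_neighbour_Int [OF vw])
  have "card (shell (shadow L) 2) = card (?S - ?R) + card (?T - ?R)"
    unfolding shell_shadow_eq_Un_neighbours [OF vw] using finite Int by (intro card_Un_disjoint) auto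
  moreover have "card ?S = card ?R + card (?S - ?R)" "card ?T = card ?R + card (?T - ?R)"
    using finite Int finite_shell
    by (subst card_Un_disjoint [symmetric]; force intro: arg_cong [where f = card])+
  ultimately show ?thesis using card_shadow_shell [OF assms(1)] by simp
qed

lemma coxeter_number_neighbours:
  assumes "shell L 1 = {}" "v \<in> shadow L" "w \<in> shadow L" "v - w \<notin> even_part L"
  shows "coxeter_number (shell (neighbour v) 2) + coxeter_number (shell (neighbour w) 2) =
    3 * (real (card (shell L 2)) / 24) + 2"
proof -
  have "real (card (shell (neighbour v) 2) + card (shell (neighbour w) 2)) = real (3 * card (shell L 2) + 48)"
    by (simp only: card_shell_neighbours [OF assms])
  then show ?thesis by (simp add: coxeter_number_def field_simps)
qed

end

theorem proposition13p1:
  fixes \<Lambda> :: "vec24 set"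
  assumes "selfdual \<Lambda>" and "odd_lattice \<Lambda>" and "has_minimum \<Lambda> 2"
  defines "R \<equiv> shell \<Lambda> 2"
  shows "\<exists>S T. root_system_norm2 S \<and> root_system_norm2 T \<and>
           strongly_eutactic S \<and> strongly_eutactic T \<and>
           R = S \<inter> T \<and>
           coxeter_number S + coxeter_number T = 3 * (real (card R) / 24) + 2 \<and>
           (\<forall>s\<in>S - R. \<forall>t\<in>T - R. s \<bullet> t = 1/2 \<or> s \<bullet> t = -1/2) \<and>
           shell (shadow \<Lambda>) 2 = (S - R) \<union> (T - R) \<and>
           ((T = R \<or> S = R) \<longleftrightarrow> strongly_eutactic R)"
proof -
  interpret odd_selfdual_lattice \<Lambda> using assms by unfold_locales
  obtain v w where vw: "v \<in> shadow \<Lambda>" "w \<in> shadow \<Lambda>" "v - w \<notin> even_part \<Lambda>"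
    by (rule opposite_shadow_vectors) (rule that)
  define S T where "S = shell (neighbour v) 2" and "T = shell (neighbour w) 2"
  interpret V: even_selfdual_lattice "neighbour v" by (rule even_selfdual_neighbour [OF vw(1)])
  interpret W: even_selfdual_lattice "neighbour w" by (rule even_selfdual_neighbour [OF vw(2)])
  have min: "2 \<le> x \<bullet> x" if "x \<in> \<Lambda>" "x \<noteq> 0" for x using assms(3) that by (simp add: has_minimum_def)
  have roots: "root_system_norm2 R" "root_system_norm2 S" "root_system_norm2 T"
    unfolding R_def S_def T_def by (rule root_system_shell V.root_system_shell W.root_system_shell)+
  have eutactic: "strongly_eutactic S" "strongly_eutactic T"
    unfolding S_def T_def by (rule V.strongly_eutactic_roots W.strongly_eutactic_roots)+
  have Int: "R = S \<inter> T" unfolding R_def S_def T_def by (rule shell_neighbour_Int [OF vw, symmetric])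
  have "shell \<Lambda> 1 = {}" using min by (force simp: shell_def)
  then have coxeter: "coxeter_number S + coxeter_number T = 3 * (real (card R) / 24) + 2"
    unfolding R_def S_def T_def by (rule coxeter_number_neighbours [OF _ vw])
  have half: "\<forall>s\<in>S - R. \<forall>t\<in>T - R. s \<bullet> t = 1/2 \<or> s \<bullet> t = -1/2"
    unfolding R_def S_def T_def by (intro ballI inner_shell_neighbours [OF min vw])
  have shadow: "shell (shadow \<Lambda>) 2 = (S - R) \<union> (T - R)"
    unfolding R_def S_def T_def by (rule shell_shadow_eq_Un_neighbours [OF vw])
  have "(T = R \<or> S = R) \<longleftrightarrow> strongly_eutactic R"
    by (rule strongly_eutactic_half_inner_iff [OF roots Int eutactic half])
  then show ?thesis using roots eutactic Int coxeter half shadow by blast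
qed

end
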